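(* Let $d_1, d_2$ be non-negative integers with $d_2 \geq 2 d_1 + 2$. If $G$ is an $(F_{d_1}, F_{d_2})$-critical multigraph without loops, then $$e(G) \geq \left(2 - \frac{d_2 + 2}{(d_1 + 2)(d_2 + 1)}\right)n(G) + \frac{1}{d_2 + 1}.$$ Moreover, if $G$ is a $\left(2 - \frac{d_2+2}{(d_1+2)(d_2+1)}, \frac{-1}{d_2+1}\right)$-strictly sparse multigraph without loops, then an $(F_{d_1}, F_{d_2})$-coloring of $G$ can be found in polynomial time.
   Context: All graphs are finite. For a multigraph $G$, $n(G)=|V(G)|$ and $e(G)=|E(G)|$ (edges counted with multiplicity). Two parallel edges are considered to be a cycle of length $2$, so a forest contains no parallel edges. $F_t$ denotes the family of forests with all vertex degrees at most $t$. An $(F_{d_1},F_{d_2})$-coloring of $G$ is a partition $V(G)=V_1\cup V_2$ (parts may be empty) such that the induced subgraph $G[V_i]$ is in $F_{d_i}$ for $i=1,2$. $G$ is $(F_{d_1},F_{d_2})$-critical if it has no $(F_{d_1},F_{d_2})$-coloring but every proper subgraph of $G$ does. $G$ is $(a,b)$-strictly sparse if $e(H) < a\, n(H) - b$ for every subgraph $H\subseteq G$. Polynomial time means time polynomial in the size of $G$. *)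

theory Defs
  imports
    "HOL-Library.Multiset"
    "HOL-Library.Uprod"
    "HOL-Computational_Algebra.Polynomial"
begin

section \<open>Multigraphs\<close>

text \<open>An edge is an unordered pair, the edge multiset records multiplicities, and
  \<^term>\<open>Upair v v\<close> is a loop at \<^term>\<open>v\<close>.\<close>

record 'v mgraph =
  verts :: "'v set"
  edges :: "'v uprod multiset"

definition multigraph :: "'v mgraph \<Rightarrow> bool" where
  "multigraph G \<longleftrightarrow> finite (verts G) \<and> (\<forall>e \<in># edges G. set_uprod e \<subseteq> verts G)"

definition loopless :: "'v mgraph \<Rightarrow> bool" where
  "loopless G \<longleftrightarrow> (\<forall>v. Upair v v \<notin># edges G)"

definition num_verts :: "'v mgraph \<Rightarrow> nat" where
  "num_verts G = card (verts G)"

definition num_edges :: "'v mgraph \<Rightarrow> nat" where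
  "num_edges G = size (edges G)"

definition is_subgraph :: "'v mgraph \<Rightarrow> 'v mgraph \<Rightarrow> bool" where
  "is_subgraph H G \<longleftrightarrow> multigraph H \<and> verts H \<subseteq> verts G \<and> edges H \<subseteq># edges G"

definition induced :: "'v mgraph \<Rightarrow> 'v set \<Rightarrow> 'v mgraph" where
  "induced G S = \<lparr>verts = verts G \<inter> S, edges = {#e \<in># edges G. set_uprod e \<subseteq> S#}\<rparr>"

text \<open>The second summand makes a loop contribute 2.\<close>

definition degree_of :: "'v mgraph \<Rightarrow> 'v \<Rightarrow> nat" where
  "degree_of G v = size {#e \<in># edges G. v \<in> set_uprod e#} + count (edges G) (Upair v v)"

text \<open>A cycle is given by its distinct vertices \<open>v\<^sub>0, \<dots>, v\<^sub>k\<^sub>-\<^sub>1\<close> with \<open>k \<ge> 1\<close>; its edges join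
  cyclically consecutive vertices. They have to be contained in the edge multiset with
  multiplicity: for \<open>k = 1\<close> this is a loop, for \<open>k = 2\<close> a pair of parallel edges.\<close>

definition cycle_edges :: "'v list \<Rightarrow> 'v uprod multiset" where
  "cycle_edges vs = mset (map2 Upair vs (rotate1 vs))"

definition is_cycle :: "'v mgraph \<Rightarrow> 'v list \<Rightarrow> bool" where
  "is_cycle G vs \<longleftrightarrow> vs \<noteq> [] \<and> distinct vs \<and> set vs \<subseteq> verts G \<and> cycle_edges vs \<subseteq># edges G"

definition forest :: "'v mgraph \<Rightarrow> bool" where
  "forest G \<longleftrightarrow> multigraph G \<and> (\<nexists>vs. is_cycle G vs)"

definition in_F :: "nat \<Rightarrow> 'v mgraph \<Rightarrow> bool" where
  "in_F t G \<longleftrightarrow> forest G \<and> (\<forall>v \<in> verts G. degree_of G v \<le> t)"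

definition F_coloring :: "nat \<Rightarrow> nat \<Rightarrow> 'v mgraph \<Rightarrow> 'v set \<Rightarrow> 'v set \<Rightarrow> bool" where
  "F_coloring d1 d2 G V1 V2 \<longleftrightarrow>
     V1 \<union> V2 = verts G \<and> V1 \<inter> V2 = {} \<and> in_F d1 (induced G V1) \<and> in_F d2 (induced G V2)"

definition F_colorable :: "nat \<Rightarrow> nat \<Rightarrow> 'v mgraph \<Rightarrow> bool" where
  "F_colorable d1 d2 G \<longleftrightarrow> (\<exists>V1 V2. F_coloring d1 d2 G V1 V2)"

definition F_critical :: "nat \<Rightarrow> nat \<Rightarrow> 'v mgraph \<Rightarrow> bool" where
  "F_critical d1 d2 G \<longleftrightarrow> \<not> F_colorable d1 d2 G \<and>
     (\<forall>H. is_subgraph H G \<and> H \<noteq> G \<longrightarrow> F_colorable d1 d2 H)"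

definition strictly_sparse :: "real \<Rightarrow> real \<Rightarrow> 'v mgraph \<Rightarrow> bool" where
  "strictly_sparse a b G \<longleftrightarrow>
     (\<forall>H. is_subgraph H G \<longrightarrow> real (num_edges H) < a * real (num_verts H) - b)"


section \<open>A model of computation\<close>

text \<open>Jones' language WHILE (N. D. Jones, Computability and Complexity from a Programming
  Perspective, MIT Press 1997): imperative programs over binary trees. Its polynomial-time
  computable functions are those of deterministic Turing machines. Jones charges one unit per
  operation; here reading a variable is charged the full size of its value, so that the cost of
  an expression bounds the size of the tree it produces and no step manipulates shared data
  for free.\<close>

datatype data = Atom | Pair data data

fun dsize :: "data \<Rightarrow> nat" where
  "dsize Atom = 1"
| "dsize (Pair a b) = 1 + dsize a + dsize b"

fun dhd :: "data \<Rightarrow> data" where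
  "dhd Atom = Atom"
| "dhd (Pair a b) = a"

fun dtl :: "data \<Rightarrow> data" where
  "dtl Atom = Atom"
| "dtl (Pair a b) = b"

datatype expr = Var nat | Quote_Atom | Cons_Of expr expr | Hd_Of expr | Tl_Of expr

datatype cmd =
    Skip
  | Assign nat expr
  | Seq cmd cmd
  | Cond expr cmd cmd
  | While expr cmd

type_synonym store = "nat \<Rightarrow> data"

fun val :: "expr \<Rightarrow> store \<Rightarrow> data" where
  "val (Var x) s = s x"
| "val Quote_Atom s = Atom"
| "val (Cons_Of e f) s = Pair (val e s) (val f s)"
| "val (Hd_Of e) s = dhd (val e s)"
| "val (Tl_Of e) s = dtl (val e s)"

fun cost :: "expr \<Rightarrow> store \<Rightarrow> nat" where
  "cost (Var x) s = dsize (s x)"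
| "cost Quote_Atom s = 1"
| "cost (Cons_Of e f) s = 1 + cost e s + cost f s"
| "cost (Hd_Of e) s = 1 + cost e s"
| "cost (Tl_Of e) s = 1 + cost e s"

text \<open>\<open>exec c s t s'\<close>: started in store \<open>s\<close>, the program \<open>c\<close> halts in store \<open>s'\<close> after time \<open>t\<close>.
  As a condition, \<^term>\<open>Atom\<close> means false and every other tree means true.\<close>

inductive exec :: "cmd \<Rightarrow> store \<Rightarrow> nat \<Rightarrow> store \<Rightarrow> bool" where
  Skip: "exec Skip s 1 s"
| Assign: "exec (Assign x e) s (1 + cost e s) (s(x := val e s))"
| Seq: "exec c s t s' \<Longrightarrow> exec d s' t' s'' \<Longrightarrow> exec (Seq c d) s (t + t') s''"
| Cond_True: "val e s \<noteq> Atom \<Longrightarrow> exec c s t s' \<Longrightarrow> exec (Cond e c d) s (1 + cost e s + t) s'"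
| Cond_False: "val e s = Atom \<Longrightarrow> exec d s t s' \<Longrightarrow> exec (Cond e c d) s (1 + cost e s + t) s'"
| While_False: "val e s = Atom \<Longrightarrow> exec (While e c) s (1 + cost e s) s"
| While_True: "val e s \<noteq> Atom \<Longrightarrow> exec c s t s' \<Longrightarrow> exec (While e c) s' t' s'' \<Longrightarrow>
    exec (While e c) s (1 + cost e s + t + t') s''"

inductive_cases exec_elims:
  "exec Skip s t s'" "exec (Assign x e) s t s'" "exec (Seq c d) s t s'"
  "exec (Cond e c d) s t s'" "exec (While e c) s t s'"

lemma dsize_val_le_cost: "dsize (val e s) \<le> cost e s"
proof (induction e)
  case (Hd_Of e)
  then show ?case by (cases "val e s") auto
next
  case (Tl_Of e)
  then show ?case by (cases "val e s") auto
qed auto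

lemma exec_deterministic: "exec c s t s' \<Longrightarrow> exec c s u s'' \<Longrightarrow> t = u \<and> s' = s''"
proof (induction arbitrary: u s'' rule: exec.induct)
  case Skip
  then show ?case by (auto elim: exec_elims(1))
next
  case Assign
  then show ?case by (auto elim: exec_elims(2))
next
  case (Seq c s t s' d t' s1)
  from Seq.prems show ?case by (rule exec_elims(3)) (use Seq.IH in blast)
next
  case Cond_True
  from Cond_True.prems show ?case
    by (rule exec_elims(4)) (use Cond_True.hyps in \<open>auto dest!: Cond_True.IH\<close>)
next
  case Cond_False
  from Cond_False.prems show ?case
    by (rule exec_elims(4)) (use Cond_False.hyps in \<open>auto dest!: Cond_False.IH\<close>)
next
  case While_False
  from While_False.prems show ?case
    by (rule exec_elims(5)) (use While_False.hyps in auto)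
next
  case While_True
  from While_True.prems show ?case
    by (rule exec_elims(5)) (use While_True.hyps in \<open>auto dest!: While_True.IH\<close>)
qed

text \<open>Input and output are passed in variable 0; all other variables initially hold
  \<^term>\<open>Atom\<close>.\<close>

definition computes_within :: "cmd \<Rightarrow> data \<Rightarrow> nat \<Rightarrow> data \<Rightarrow> bool" where
  "computes_within c inp T out \<longleftrightarrow>
     (\<exists>t s. exec c ((\<lambda>_. Atom)(0 := inp)) t s \<and> t \<le> T \<and> s 0 = out)"

text \<open>Search problems: one program and one polynomial serve all instances \<open>x\<close> satisfying the
  promise \<open>P\<close>; the program has to output some \<open>y\<close> with \<open>R x y\<close>. The time is measured in the
  instance size \<open>sz x\<close>.\<close>

definition poly_time_search ::
  "('x \<Rightarrow> data) \<Rightarrow> ('y \<Rightarrow> data) \<Rightarrow> ('x \<Rightarrow> nat) \<Rightarrow> ('x \<Rightarrow> bool) \<Rightarrow> ('x \<Rightarrow> 'y \<Rightarrow> bool) \<Rightarrow> bool" where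
  "poly_time_search enc_in enc_out sz P R \<longleftrightarrow>
     (\<exists>c. \<exists>q :: nat poly. \<forall>x. P x \<longrightarrow>
        (\<exists>y. R x y \<and> computes_within c (enc_in x) (poly q (sz x)) (enc_out y)))"


section \<open>Encoding of multigraphs and colorings\<close>

fun enc_list :: "('a \<Rightarrow> data) \<Rightarrow> 'a list \<Rightarrow> data" where
  "enc_list f [] = Atom"
| "enc_list f (x # xs) = Pair (f x) (enc_list f xs)"

fun enc_nat :: "nat \<Rightarrow> data" where
  "enc_nat 0 = Atom"
| "enc_nat (Suc n) = Pair Atom (enc_nat n)"

fun enc_bool :: "bool \<Rightarrow> data" where
  "enc_bool False = Atom"
| "enc_bool True = Pair Atom Atom"

text \<open>A multigraph with vertices \<open>0, \<dots>, n - 1\<close> is presented by \<open>n\<close> and a list of its edges, in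
  arbitrary order and each in arbitrary orientation; parallel edges are listed separately.
  Numbers are written in unary, so the encoding has size polynomial in \<open>n(G) + e(G)\<close>.\<close>

type_synonym instance_graph = "nat \<times> (nat \<times> nat) list"

definition graph_of :: "instance_graph \<Rightarrow> nat mgraph" where
  "graph_of I = \<lparr>verts = {..<fst I}, edges = mset (map (\<lambda>(u, v). Upair u v) (snd I))\<rparr>"

definition enc_graph :: "instance_graph \<Rightarrow> data" where
  "enc_graph I = Pair (enc_nat (fst I)) (enc_list (\<lambda>(u, v). Pair (enc_nat u) (enc_nat v)) (snd I))"

definition graph_size :: "instance_graph \<Rightarrow> nat" where
  "graph_size I = num_verts (graph_of I) + num_edges (graph_of I)"

text \<open>A coloring is output as a list of \<open>n\<close> bits, bit \<open>i\<close> telling whether vertex \<open>i\<close> is in the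
  first part.\<close>

definition coloring_output :: "nat \<Rightarrow> nat \<Rightarrow> instance_graph \<Rightarrow> bool list \<Rightarrow> bool" where
  "coloring_output d1 d2 I bs \<longleftrightarrow> length bs = fst I \<and>
     F_coloring d1 d2 (graph_of I) {i. i < fst I \<and> bs ! i} {i. i < fst I \<and> \<not> bs ! i}"

definition poly_time_F_coloring :: "nat \<Rightarrow> nat \<Rightarrow> (nat mgraph \<Rightarrow> bool) \<Rightarrow> bool" where
  "poly_time_F_coloring d1 d2 P \<longleftrightarrow>
     poly_time_search enc_graph (enc_list enc_bool) graph_size
       (\<lambda>I. P (graph_of I)) (coloring_output d1 d2)"

end

theory Submission
  imports Defs
begin

text \<open>Let \<open>A = d2 + 2\<close>, \<open>B = d1 + 2\<close> and \<open>D = B (A - 1)\<close>, so that the hypothesis says \<open>A \<ge> 2 B\<close> and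
  \<open>B \<ge> 2\<close>. In order to recurse, the problem is generalized: every vertex \<open>v\<close> carries a cap for each of the two
  colours, and a vertex that receives a colour must have fewer neighbours of that colour than its cap, parallel edges counted; cap
  \<open>0\<close> forbids the colour. The original problem has the caps \<open>B - 1\<close> and \<open>A - 1\<close> everywhere. A vertex is worth \<open>A\<close> for
  each unit of its first cap plus \<open>B\<close> for each unit of its second cap minus \<open>B\<close>, and the potential
  of a vertex set is the sum of these worths minus \<open>D\<close> for each edge inside the set. With the
  original caps a vertex is worth \<open>2 D - A\<close>, and multiplying the density condition by \<open>D\<close> turns it
  into: every nonempty vertex set has potential above \<open>- B\<close>. Call such caps good. The heart of the proof is
  that good caps admit a colouring if they do not exceed the original ones.

  To see this, pick a nonempty proper subset \<open>S\<close> of minimum potential, colour it first, and then adjust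
  the caps outside: a vertex \<open>y\<close> outside \<open>S\<close> loses each colour that occurs among its neighbours in
  \<open>S\<close>, except that one single edge from \<open>S\<close> to the outside may become monochromatic, which merely lowers a cap
  by one and closes no cycle (\<open>valid_extend\<close>). Each edge from \<open>y\<close> to \<open>S\<close> that disappears
  raises potentials by \<open>D\<close>, and losing a colour costs at most \<open>D\<close>; since \<open>S\<close> has minimum potential, the
  caps stay good on all proper subsets of the outside, and on the whole outside as well once the total gain reaches the potential of \<open>S\<close>
  (\<open>good_best\<close>). If that potential is small, then the gain can be enforced by lowering some
  caps in \<open>S\<close> at the ends of one or two boundary edges before \<open>S\<close> is coloured, or by colouring the outside
  first if there is only one boundary edge (\<open>step_first\<close>,
  \<open>step_second\<close>, \<open>step_bridge\<close>, \<open>step_third\<close>). If it is large, then all proper subsets have large potential, so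
  that \<open>S = V - {v}\<close> can be coloured with lowered caps around a suitable vertex \<open>v\<close> of
  degree at most three, after which \<open>v\<close> has a free colour (\<open>step_degree1\<close>, \<open>step_degree2\<close>, \<open>step_degree3\<close>). A
  discharging argument (\<open>exists_reducible\<close>) produces such a vertex.

  For the bound, suppose that a critical multigraph has too few edges; then the whole vertex set has potential
  above \<open>- B\<close>. If the caps are good, there is a colouring. Otherwise a set \<open>S\<close> of minimum potential is proper, so that criticality
  colours it, and minimality makes the remaining caps good without any monochromatic edge between \<open>S\<close> and the outside
  (\<open>critical_bound\<close>).

  For the algorithm, each step of this recursion has to be computed in polynomial time, and the only step that is
  not a direct computation is the choice of \<open>S\<close>. It is solved by local search instead of maximum
  flow: each edge becomes many tokens, each owned by one of its two ends, and tokens move to the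
  other end as long as this makes the loads more even. In a stable distribution, a set of minimum potential is found among the sets of
  all vertices with at least a given excess of load (\<open>stable_level_set\<close>). Finally, the functions computed by WHILE
  programs in polynomial time are shown to be closed under composition, pairing, case distinction and bounded
  iteration, which suffices to assemble the algorithm from its definition (\<open>pt_solve\<close>).\<close>

section \<open>Colourings with caps and their extension\<close>

text \<open>A list of pairs stands for a multigraph: the order within a pair is irrelevant, and repeated pairs
  are parallel edges.\<close>

definition inside :: "('v \<times> 'v) list \<Rightarrow> 'v set \<Rightarrow> nat" where
  "inside E S = length (filter (\<lambda>e. fst e \<in> S \<and> snd e \<in> S) E)"

definition cross :: "('v \<times> 'v) list \<Rightarrow> 'v set \<Rightarrow> 'v set \<Rightarrow> nat" where
  "cross E S T = length (filter (\<lambda>e. fst e \<in> S \<and> snd e \<in> T \<or> fst e \<in> T \<and> snd e \<in> S) E)"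

lemma inside_empty [simp]: "inside E {} = 0"
  by (simp add: inside_def)

lemma cross_empty [simp]: "cross E S {} = 0" "cross E {} S = 0"
  by (simp_all add: cross_def)

lemma cross_commute: "cross E S T = cross E T S"
  unfolding cross_def by (rule arg_cong[where f = length], rule filter_cong) auto

lemma length_filter_mono:
  "(\<And>x. x \<in> set xs \<Longrightarrow> P x \<Longrightarrow> Q x) \<Longrightarrow> length (filter P xs) \<le> length (filter Q xs)"
  by (induction xs) auto

lemma cross_mono: "S \<subseteq> S' \<Longrightarrow> T \<subseteq> T' \<Longrightarrow> cross E S T \<le> cross E S' T'"
  unfolding cross_def by (rule length_filter_mono) auto

lemma inside_Un: "S \<inter> T = {} \<Longrightarrow> inside E (S \<union> T) = inside E S + inside E T + cross E S T"
  unfolding inside_def cross_def by (induction E) auto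

lemma cross_Un:
  "S \<inter> T = {} \<Longrightarrow> S \<inter> T' = {} \<Longrightarrow> T \<inter> T' = {} \<Longrightarrow> cross E S (T \<union> T') = cross E S T + cross E S T'"
  unfolding cross_def by (induction E) auto

lemma cross_sum:
  assumes "finite T" "S \<inter> T = {}"
  shows "cross E S T = (\<Sum>y\<in>T. cross E {y} S)"
  using assms
proof (induction T rule: finite_induct)
  case (insert y T)
  have "cross E S (insert y T) = cross E S ({y} \<union> T)" by simp
  also have "\<dots> = cross E S {y} + cross E S T" by (rule cross_Un) (use insert in auto)
  finally show ?case using insert by (simp add: cross_commute)
qed simp

lemma cross_loopless_Un:
  assumes "\<forall>e\<in>set E. fst e \<noteq> snd e" "T \<inter> T' = {}"
  shows "cross E {v} (T \<union> T') = cross E {v} T + cross E {v} T'"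
  using assms unfolding cross_def by (induction E) auto

lemma inside_single: "\<forall>e\<in>set E. fst e \<noteq> snd e \<Longrightarrow> inside E {v} = 0"
  unfolding inside_def by (induction E) auto

lemma cross_loop: "\<forall>e\<in>set E. fst e \<noteq> snd e \<Longrightarrow> cross E {v} {v} = 0"
  unfolding cross_def by (induction E) auto

lemma handshake:
  assumes "\<forall>e\<in>set E. fst e \<noteq> snd e" "finite S"
  shows "(\<Sum>v\<in>S. cross E {v} S) = 2 * inside E S"
  using assms(1)
proof (induction E)
  case Nil
  then show ?case by (simp add: cross_def inside_def)
next
  case (Cons e E)
  obtain a b where e: "e = (a, b)" by (cases e)
  have ab: "a \<noteq> b" using Cons.prems e by auto
  have *: "cross (e # E) {v} S = cross E {v} S + (if v = a \<and> b \<in> S then 1 else 0) + (if v = b \<and> a \<in> S then 1 else 0)"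
    for v using ab by (auto simp: cross_def e)
  have "(\<Sum>v\<in>S. cross (e # E) {v} S) = (\<Sum>v\<in>S. cross E {v} S)
      + (\<Sum>v\<in>S. if v = a \<and> b \<in> S then 1 else 0) + (\<Sum>v\<in>S. if v = b \<and> a \<in> S then 1 else 0)"
    by (simp add: * sum.distrib)
  also have "(\<Sum>v\<in>S. if v = a \<and> b \<in> S then 1 else (0::nat)) = (if a \<in> S \<and> b \<in> S then 1 else 0)"
    using assms(2) by (cases "b \<in> S") (auto simp: sum.delta)
  also have "(\<Sum>v\<in>S. if v = b \<and> a \<in> S then 1 else (0::nat)) = (if a \<in> S \<and> b \<in> S then 1 else 0)"
    using assms(2) by (cases "a \<in> S") (auto simp: sum.delta)
  also have "(\<Sum>v\<in>S. cross E {v} S) = 2 * inside E S" using Cons by auto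
  finally show ?case by (auto simp: inside_def e)
qed

text \<open>Forests are expressed by counting: a multigraph is a forest iff each nonempty vertex set \<open>T\<close> spans fewer
  than \<open>card T\<close> edges. This form survives the joining of two parts. A cap is one more than the
  degree that it admits, so that cap \<open>0\<close> forbids a colour.\<close>

definition valid :: "('v \<times> 'v) list \<Rightarrow> (bool \<Rightarrow> 'v \<Rightarrow> nat) \<Rightarrow> 'v set \<Rightarrow> ('v \<Rightarrow> bool) \<Rightarrow> bool" where
  "valid E k V c \<longleftrightarrow> (\<forall>v\<in>V. cross E {v} {u\<in>V. c u = c v} < k (c v) v) \<and>
     (\<forall>b T. T \<noteq> {} \<and> T \<subseteq> {u\<in>V. c u = b} \<longrightarrow> inside E T < card T)"

definition seen :: "('v \<times> 'v) list \<Rightarrow> ('v \<Rightarrow> bool) \<Rightarrow> 'v set \<Rightarrow> bool \<Rightarrow> 'v \<Rightarrow> nat" where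
  "seen E c S b y = cross E {y} {u\<in>S. c u = b}"

text \<open>The caps that remain outside \<open>S\<close> if no edge from \<open>S\<close> to the outside may become monochromatic.\<close>

definition ban where
  "ban E c S k b y = (if seen E c S b y = 0 then k b y else (0::nat))"

text \<open>As before, but an edge from \<open>u0\<close> to \<open>y0\<close> may become monochromatic, at the price of one unit of the cap of \<open>y0\<close>.\<close>

definition use where
  "use E c S k u0 y0 b y = (if y = y0 \<and> b = c u0 then k b y - 1 else ban E c S k b y)"

text \<open>The edge between \<open>u\<close> and \<open>y\<close> can be made monochromatic: it is the only edge from \<open>y\<close> to the colour class of \<open>u\<close> in
  \<open>S\<close>, and \<open>u\<close> tolerates one more neighbour of its own colour.\<close>

definition usable where
  "usable E c S k u y \<longleftrightarrow> u \<in> S \<and> 0 < cross E {y} {u} \<and> seen E c S (c u) y = 1 \<and>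
     seen E c S (c u) u + 1 < (k (c u) u :: nat)"

text \<open>At most one edge is made monochromatic, since two of them could close a cycle.\<close>

definition cand where
  "cand E c S X k = insert (ban E c S k) {use E c S k u y | u y. y \<in> X \<and> usable E c S k u y}"

lemma valid_cong: "(\<And>v. v \<in> V \<Longrightarrow> c v = c' v) \<Longrightarrow> valid E k V c = valid E k V c'"
proof -
  assume *: "\<And>v. v \<in> V \<Longrightarrow> c v = c' v"
  then have "{u\<in>V. c u = b} = {u\<in>V. c' u = b}" for b by auto
  then show ?thesis unfolding valid_def by (auto simp: *)
qed

lemma validI:
  assumes "\<And>v. v \<in> V \<Longrightarrow> cross E {v} {u\<in>V. c u = c v} < k (c v) v"
    and "\<And>b T. T \<noteq> {} \<Longrightarrow> T \<subseteq> {u\<in>V. c u = b} \<Longrightarrow> inside E T < card T"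
  shows "valid E k V c"
  unfolding valid_def
proof (intro conjI ballI allI impI)
  fix b T assume "T \<noteq> {} \<and> T \<subseteq> {u\<in>V. c u = b}"
  then show "inside E T < card T" by (elim conjE) (rule assms(2))
qed (rule assms(1))

lemma validD1: "valid E k V c \<Longrightarrow> v \<in> V \<Longrightarrow> cross E {v} {u\<in>V. c u = c v} < k (c v) v"
  unfolding valid_def by simp

lemma validD2: "valid E k V c \<Longrightarrow> T \<noteq> {} \<Longrightarrow> T \<subseteq> {u\<in>V. c u = b} \<Longrightarrow> inside E T < card T"
  unfolding valid_def by simp

text \<open>Two forests joined by at most one edge form a forest.\<close>

lemma valid_merge:
  assumes lf: "\<forall>e\<in>set E. fst e \<noteq> snd e" and fin: "finite S" "finite X" and dj: "S \<inter> X = {}"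
    and vS: "valid E k S c" and vX: "valid E k X c"
    and degX: "\<And>y. y \<in> X \<Longrightarrow> cross E {y} {u\<in>X. c u = c y} + seen E c S (c y) y < k (c y) y"
    and degS: "\<And>u. u \<in> S \<Longrightarrow> seen E c S (c u) u + cross E {u} {y\<in>X. c y = c u} < k (c u) u"
    and one: "\<And>b. cross E {u\<in>S. c u = b} {y\<in>X. c y = b} \<le> 1"
  shows "valid E k (S \<union> X) c"
proof -
  have sp: "{u \<in> S \<union> X. c u = b} = {u\<in>S. c u = b} \<union> {u\<in>X. c u = b}" for b by auto
  have dj': "{u\<in>S. c u = b} \<inter> {u\<in>X. c u = b} = {}" for b using dj by auto
  have deg: "cross E {v} {u \<in> S \<union> X. c u = b} = cross E {v} {u\<in>S. c u = b} + cross E {v} {u\<in>X. c u = b}" for v b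
    unfolding sp by (rule cross_loopless_Un[OF lf dj'])
  show ?thesis
  proof (rule validI)
    fix v assume v: "v \<in> S \<union> X"
    show "cross E {v} {u \<in> S \<union> X. c u = c v} < k (c v) v"
    proof (cases "v \<in> S")
      case True
      then show ?thesis using degS[of v] unfolding deg seen_def by linarith
    next
      case False
      then have "v \<in> X" using v by blast
      then show ?thesis using degX[of v] unfolding deg seen_def by linarith
    qed
  next
    fix b T assume T0: "T \<noteq> {}" and TS: "T \<subseteq> {u\<in>S \<union> X. c u = b}"
    let ?P = "T \<inter> S" and ?Q = "T \<inter> X"
    have T: "?P \<union> ?Q = T" using TS by blast
    have PS: "?P \<subseteq> {u\<in>S. c u = b}" and QX: "?Q \<subseteq> {u\<in>X. c u = b}" using TS by blast+
    have dPQ: "?P \<inter> ?Q = {}" using dj by blast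
    have "inside E T = inside E ?P + inside E ?Q + cross E ?P ?Q"
      using inside_Un[OF dPQ, of E] unfolding T .
    moreover have "card T = card ?P + card ?Q"
      using card_Un_disjoint[of ?P ?Q] dPQ fin unfolding T by simp
    moreover have "cross E ?P ?Q \<le> 1"
      using order_trans[OF cross_mono[OF PS QX] one] .
    moreover have "?P \<noteq> {} \<Longrightarrow> inside E ?P < card ?P" using validD2[OF vS _ PS] .
    moreover have "?Q \<noteq> {} \<Longrightarrow> inside E ?Q < card ?Q" using validD2[OF vX _ QX] .
    moreover have "?P \<noteq> {} \<or> ?Q \<noteq> {}" using T T0 by blast
    ultimately show "inside E T < card T"
      by (cases "?P = {}"; cases "?Q = {}") simp_all
  qed
qed

lemma valid_mono: "valid E k V c \<Longrightarrow> (\<And>b v. v \<in> V \<Longrightarrow> k b v \<le> k' b v) \<Longrightarrow> valid E k' V c"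
  unfolding valid_def by (meson order_less_le_trans)

text \<open>Banning removes every monochromatic edge between \<open>S\<close> and \<open>X\<close> except for the edge that is used, and the unit of cap that was taken
  from its end in \<open>X\<close> pays for the additional neighbour there.\<close>

lemma valid_extend:
  assumes lf: "\<forall>e\<in>set E. fst e \<noteq> snd e" and fin: "finite S" "finite X" and dj: "S \<inter> X = {}"
    and vS: "valid E k S c" and k': "k' \<in> cand E c S X k" and vX: "valid E k' X c"
  shows "valid E k (S \<union> X) c"
proof -
  have le: "k' b v \<le> k b v" for b v using k' by (auto simp: cand_def ban_def use_def)
  have vX': "valid E k X c" by (rule valid_mono[OF vX]) (simp add: le)
  have dX: "cross E {y} {u\<in>X. c u = c y} < k' (c y) y" if "y \<in> X" for y
    using vX that unfolding valid_def by blast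
  have dS: "seen E c S (c u) u < k (c u) u" if "u \<in> S" for u
    using vS that unfolding valid_def seen_def by blast
  have sm: "cross E {u} T = (\<Sum>y\<in>T. cross E {y} {u})" if "T \<subseteq> X" "u \<in> S" for u T
    by (rule cross_sum) (use that dj finite_subset[OF that(1) fin(2)] in auto)
  have sm2: "cross E {u\<in>S. c u = b} {y\<in>X. c y = b} = (\<Sum>y\<in>{y\<in>X. c y = b}. seen E c S b y)" for b
    unfolding seen_def by (rule cross_sum) (use fin dj in auto)
  have le1: "cross E {y} {u} \<le> seen E c S b y" if "u \<in> S" "c u = b" for y u b
    unfolding seen_def by (rule cross_mono) (use that in auto)
  from k' consider "k' = ban E c S k" | u0 y0 where "k' = use E c S k u0 y0" "y0 \<in> X" "usable E c S k u0 y0"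
    unfolding cand_def by blast
  then show ?thesis
  proof cases
    case 1
    have z: "seen E c S (c y) y = 0" if "y \<in> X" for y
      using dX[OF that] unfolding 1 ban_def by (simp split: if_splits)
    have z2: "cross E {u} {y\<in>X. c y = c u} = 0" if "u \<in> S" for u
    proof -
      have "cross E {y} {u} = 0" if "y \<in> X" "c y = c u" for y
        using z[OF that(1)] le1[OF \<open>u \<in> S\<close> that(2)[symmetric], of y] by linarith
      then show ?thesis using that by (subst sm) (auto simp: fin)
    qed
    show ?thesis
    proof (rule valid_merge[OF lf fin dj vS vX'])
      fix y assume y: "y \<in> X"
      show "cross E {y} {u\<in>X. c u = c y} + seen E c S (c y) y < k (c y) y"
        using dX[OF y] le[of "c y" y] z[OF y] by linarith
    next
      fix u assume u: "u \<in> S"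
      show "seen E c S (c u) u + cross E {u} {y\<in>X. c y = c u} < k (c u) u"
        using dS[OF u] z2[OF u] by linarith
    next
      show "cross E {u\<in>S. c u = b} {y\<in>X. c y = b} \<le> 1" for b
        unfolding sm2 by (subst sum.neutral) (use z in auto)
    qed
  next
    case 2
    from 2(3) have us: "u0 \<in> S" "0 < cross E {y0} {u0}" "seen E c S (c u0) y0 = 1"
      "seen E c S (c u0) u0 + 1 < k (c u0) u0" unfolding usable_def by simp_all
    have z: "seen E c S (c y) y = 0" if "y \<in> X" "y \<noteq> y0 \<or> c y \<noteq> c u0" for y
    proof -
      have "\<not> (y = y0 \<and> c y = c u0)" using that(2) by blast
      then have "k' (c y) y = ban E c S k (c y) y" unfolding 2(1) use_def by (rule if_not_P)
      then show ?thesis using dX[OF that(1)] by (simp add: ban_def split: if_splits)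
    qed
    have z0: "cross E {y0} {u} = 0" if "u \<in> S" "u \<noteq> u0" "c u = c u0" for u
    proof -
      have "cross E {y0} ({u} \<union> {u0}) \<le> seen E c S (c u0) y0"
        unfolding seen_def by (rule cross_mono) (use that us(1) in simp_all)
      moreover have "cross E {y0} ({u} \<union> {u0}) = cross E {y0} {u} + cross E {y0} {u0}"
        by (rule cross_loopless_Un[OF lf]) (use that(2) in simp)
      ultimately show ?thesis using us by linarith
    qed
    have s1: "seen E c S (c u0) y0 = 1" and u0: "u0 \<in> S" and sat: "seen E c S (c u0) u0 + 1 < k (c u0) u0"
      using us by simp_all
    have tot: "(\<Sum>y\<in>{y\<in>X. c y = b}. seen E c S b y) \<le> 1" for b
    proof -
      have "seen E c S b y \<le> (if y = y0 then 1 else 0)" if "y \<in> {y\<in>X. c y = b}" for y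
      proof (cases "y = y0 \<and> c y = c u0")
        case True
        then have "b = c u0" "y = y0" using that by blast+
        then show ?thesis using s1 by (simp only: if_True refl order_refl)
      next
        case False
        then have "seen E c S (c y) y = 0" using that by (intro z) blast+
        then show ?thesis using that by simp
      qed
      then have "(\<Sum>y\<in>{y\<in>X. c y = b}. seen E c S b y) \<le> (\<Sum>y\<in>{y\<in>X. c y = b}. if y = y0 then 1 else 0)"
        by (rule sum_mono)
      also have "\<dots> \<le> 1" using fin by (simp add: sum.delta)
      finally show ?thesis .
    qed
    have z2: "cross E {u} {y\<in>X. c y = c u} = 0" if "u \<in> S" "u \<noteq> u0" for u
    proof -
      have "cross E {y} {u} = 0" if y: "y \<in> X" "c y = c u" for y
      proof (cases "y = y0 \<and> c y = c u0")
        case True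
        then have "y = y0" "c u = c u0" using y(2) by (blast, argo)
        then show ?thesis using z0[OF \<open>u \<in> S\<close> \<open>u \<noteq> u0\<close> \<open>c u = c u0\<close>] by (simp only:)
      next
        case False
        then have "seen E c S (c y) y = 0" by (intro z[OF y(1)]) blast
        then show ?thesis using le1[OF \<open>u \<in> S\<close> y(2)[symmetric], of y] by linarith
      qed
      then show ?thesis using that by (subst sm) (auto simp: fin)
    qed
    have z3: "cross E {u0} {y\<in>X. c y = c u0} \<le> 1"
    proof -
      have "cross E {u0} {y\<in>X. c y = c u0} \<le> cross E {u\<in>S. c u = c u0} {y\<in>X. c y = c u0}"
        by (rule cross_mono) (use u0 in auto)
      also have "\<dots> \<le> 1" unfolding sm2 by (rule tot)
      finally show ?thesis .
    qed
    show ?thesis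
    proof (rule valid_merge[OF lf fin dj vS vX'])
      fix y assume y: "y \<in> X"
      show "cross E {y} {u\<in>X. c u = c y} + seen E c S (c y) y < k (c y) y"
      proof (cases "y = y0 \<and> c y = c u0")
        case True
        have "k' (c y) y = k (c y) y - 1"
          unfolding 2(1) use_def by (rule if_P[OF True])
        moreover have "seen E c S (c y) y = 1"
          using s1 True by (elim conjE) (erule ssubst, erule ssubst, assumption)
        ultimately show ?thesis using dX[OF y] by linarith
      next
        case False
        then have "seen E c S (c y) y = 0" by (intro z[OF y]) blast
        then show ?thesis using dX[OF y] le[of "c y" y] by linarith
      qed
    next
      fix u assume u: "u \<in> S"
      show "seen E c S (c u) u + cross E {u} {y\<in>X. c y = c u} < k (c u) u"
      proof (cases "u = u0")
        case True
        then show ?thesis using z3 sat by simp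
      next
        case False
        then show ?thesis using dS[OF u] z2[OF u False] by linarith
      qed
    next
      show "cross E {u\<in>S. c u = b} {y\<in>X. c y = b} \<le> 1" for b
        unfolding sm2 by (rule tot)
    qed
  qed
qed

section \<open>Potential and sets of small potential\<close>

text \<open>In the application \<open>A = d2 + 2\<close> and \<open>B = d1 + 2\<close>.\<close>

locale params =
  fixes A B :: nat and E :: "('v \<times> 'v) list"
  assumes B2: "2 \<le> B" and AB: "2 * B \<le> A" and loopless: "\<forall>e\<in>set E. fst e \<noteq> snd e"
begin

definition D :: int where "D = int B * (int A - 1)"

text \<open>The colour \<open>True\<close> is the one with the small cap. The factors are chosen such that a full cap of
  \<open>B - 1\<close> in this colour is worth \<open>D - (A - B)\<close> and a full cap of \<open>A - 1\<close> in the other colour is worth \<open>D\<close>: neither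
  exceeds what an edge is worth. A vertex without any colour has weight exactly \<open>- B\<close>, the value that good caps exclude.\<close>

definition wt :: "(bool \<Rightarrow> 'v \<Rightarrow> nat) \<Rightarrow> 'v \<Rightarrow> int" where
  "wt k v = int A * int (k True v) + int B * int (k False v) - int B"

definition pot :: "(bool \<Rightarrow> 'v \<Rightarrow> nat) \<Rightarrow> 'v set \<Rightarrow> int" where
  "pot k S = (\<Sum>v\<in>S. wt k v) - D * int (inside E S)"

definition good :: "(bool \<Rightarrow> 'v \<Rightarrow> nat) \<Rightarrow> 'v set \<Rightarrow> bool" where
  "good k V \<longleftrightarrow> (\<forall>T. T \<noteq> {} \<and> T \<subseteq> V \<longrightarrow> - int B < pot k T)"

definition bounded :: "(bool \<Rightarrow> 'v \<Rightarrow> nat) \<Rightarrow> 'v set \<Rightarrow> bool" where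
  "bounded k V \<longleftrightarrow> (\<forall>v\<in>V. k True v < B \<and> k False v < A)"

lemma goodD: "good k V \<Longrightarrow> T \<noteq> {} \<Longrightarrow> T \<subseteq> V \<Longrightarrow> - int B < pot k T"
  unfolding good_def by simp

lemma D_ge: "2 * int A - int B \<le> D"
proof -
  have "0 \<le> (int B - 2) * int A" using B2 by simp
  then show ?thesis by (simp add: D_def algebra_simps)
qed

lemma D_ge3: "3 \<le> B \<Longrightarrow> 2 * int A + int B \<le> D"
proof -
  assume "3 \<le> B"
  then have "0 \<le> (int B - 3) * int A" by simp
  moreover have "0 \<le> (int B - 2) * (int A - 2 * int B)" using B2 AB by simp
  moreover have "0 \<le> (int B - 3) * int B" using \<open>3 \<le> B\<close> by simp
  ultimately show ?thesis by (simp add: D_def algebra_simps)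
qed

lemma D_ge4: "4 \<le> B \<Longrightarrow> 2 * int A + 3 * int B \<le> D"
proof -
  assume "4 \<le> B"
  then have h1: "0 \<le> int B * (int B - 4)" by simp
  have h2: "0 \<le> (int B - 2) * (int A - 2 * int B)" using B2 AB by simp
  have "(int B - 2) * (int A - 2 * int B) + 2 * (int B * (int B - 4)) = int A * int B - 2 * int A - 4 * int B"
    by algebra
  moreover have "D = int A * int B - int B" by (simp add: D_def algebra_simps)
  ultimately show ?thesis using h1 h2 by linarith
qed

lemma AB': "2 * int B \<le> int A" "2 \<le> int B" using AB B2 by simp_all

lemma cap1: assumes "p < B" shows "int A * int p \<le> D - (int A - int B)"
proof -
  have "int A * int p \<le> int A * (int B - 1)" using assms by (intro mult_left_mono) auto
  then show ?thesis by (simp add: D_def algebra_simps)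
qed

lemma cap2: assumes "q < A" shows "int B * int q \<le> D"
proof -
  have "int B * int q \<le> int B * (int A - 1)" using assms by (intro mult_left_mono) auto
  then show ?thesis by (simp add: D_def)
qed

lemma pot_Un:
  assumes "finite S" "finite T" "S \<inter> T = {}"
  shows "pot k (S \<union> T) = pot k S + pot k T - D * int (cross E S T)"
  unfolding pot_def sum.union_disjoint[OF assms] inside_Un[OF assms(3)] by (simp add: algebra_simps)

lemma pot_cong: "(\<And>b v. v \<in> S \<Longrightarrow> k b v = k' b v) \<Longrightarrow> pot k S = pot k' S"
  unfolding pot_def wt_def by simp

lemma cross_split:
  "cross E {y} S = seen E c S True y + seen E c S False y"
proof -
  have "S = {u\<in>S. c u = True} \<union> {u\<in>S. c u = False}" by blast
  then have "cross E {y} S = cross E {y} ({u\<in>S. c u = True} \<union> {u\<in>S. c u = False})" by metis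
  also have "\<dots> = cross E {y} {u\<in>S. c u = True} + cross E {y} {u\<in>S. c u = False}"
    by (rule cross_loopless_Un[OF loopless]) blast
  finally show ?thesis unfolding seen_def .
qed

text \<open>How much better off \<open>y\<close> is after its edges to \<open>S\<close> have been deleted and its caps have changed from \<open>k\<close> to \<open>k'\<close>.\<close>

definition gain where
  "gain c S k k' y = D * int (cross E {y} S) - (wt k y - wt k' y)"

text \<open>If \<open>S\<close> has minimum potential among the nonempty proper subsets of \<open>V\<close>, then the difference on the right is nonnegative unless
  \<open>S \<union> T = V\<close>. This is why only the whole complement of \<open>S\<close> can cause trouble.\<close>

lemma pot_after:
  assumes "finite S" "finite T" "S \<inter> T = {}"
  shows "pot k' T = pot k (S \<union> T) - pot k S + (\<Sum>y\<in>T. gain c S k k' y)"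
proof -
  have "int (cross E S T) = (\<Sum>y\<in>T. int (cross E {y} S))"
    unfolding cross_sum[OF assms(2,3)] by simp
  then have "(\<Sum>y\<in>T. gain c S k k' y) = D * int (cross E S T) - (\<Sum>y\<in>T. wt k y) + (\<Sum>y\<in>T. wt k' y)"
    by (simp add: gain_def sum_subtractf flip: sum_distrib_left)
  then show ?thesis unfolding pot_Un[OF assms] by (simp add: pot_def)
qed

lemma loss_le:
  assumes "m \<le> M" "0 \<le> M"
  shows "(if s = 0 then 0 else m) \<le> M * int (s::nat)"
proof (cases "s = 0")
  case False
  then have "M * 1 \<le> M * int s" using assms by (intro mult_left_mono) auto
  then show ?thesis using False assms by simp
qed simp

text \<open>Each edge from \<open>y\<close> to \<open>S\<close> frees \<open>D\<close>, while banning its colour costs at most \<open>D - (A - B)\<close> for colour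
  \<open>True\<close> and at most \<open>D\<close> for colour \<open>False\<close>. If two edges lead to the same colour, the second one is a pure gain.\<close>

lemma gain_ban:
  assumes "k True y < B" "k False y < A"
  shows "(int A - int B) * int (seen E c S True y) \<le> gain c S k (ban E c S k) y"
    and "2 \<le> seen E c S b y \<Longrightarrow> D \<le> gain c S k (ban E c S k) y"
    and "0 \<le> gain c S k (ban E c S k) y"
proof -
  let ?s = "seen E c S True y" and ?t = "seen E c S False y"
  let ?l1 = "if ?s = 0 then 0 else int A * int (k True y)"
  let ?l2 = "if ?t = 0 then 0 else int B * int (k False y)"
  have g: "gain c S k (ban E c S k) y = (D * int ?s - ?l1) + (D * int ?t - ?l2)"
    unfolding gain_def cross_split[of y S c] wt_def ban_def by (simp add: algebra_simps)
  note c1 = cap1[OF assms(1)] and c2 = cap2[OF assms(2)]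
  have l1: "?l1 \<le> (D - (int A - int B)) * int ?s" by (rule loss_le[OF c1]) (use D_ge AB' in linarith)
  have l2: "?l2 \<le> D * int ?t" by (rule loss_le[OF c2]) (use D_ge AB' in linarith)
  show 1: "(int A - int B) * int ?s \<le> gain c S k (ban E c S k) y"
    using l1 l2 unfolding g by (simp add: algebra_simps)
  have "0 \<le> (int A - int B) * int ?s" using AB' by simp
  with 1 show "0 \<le> gain c S k (ban E c S k) y" by linarith
  show "D \<le> gain c S k (ban E c S k) y" if "2 \<le> seen E c S b y"
  proof (cases b)
    case True
    then have "D * 2 \<le> D * int ?s" using that D_ge AB' by (intro mult_left_mono) auto
    moreover have "?l1 \<le> D" using c1 D_ge AB' by auto
    ultimately show ?thesis using l2 unfolding g by linarith
  next
    case False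
    then have "D * 2 \<le> D * int ?t" using that D_ge AB' by (intro mult_left_mono) auto
    moreover have "?l2 \<le> D" using c2 D_ge AB' by auto
    moreover have "?l1 \<le> D * int ?s" by (rule loss_le) (use c1 D_ge AB' in linarith)+
    ultimately show ?thesis unfolding g by linarith
  qed
qed

text \<open>The used edge frees \<open>D\<close> but costs a single unit of cap; the other colour loses at most what its edges free.\<close>

lemma gain_use:
  assumes "k True y < B" "k False y < A" "usable E c S k u y"
  shows "D - (if c u then int A else int B) \<le> gain c S k (use E c S k u y) y"
proof -
  let ?s = "seen E c S True y" and ?t = "seen E c S False y"
  have s1: "seen E c S (c u) y = 1" using assms(3) unfolding usable_def by simp
  note c1 = cap1[OF assms(1)] and c2 = cap2[OF assms(2)]
  show ?thesis
  proof (cases "c u")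
    case True
    let ?l2 = "if ?t = 0 then 0 else int B * int (k False y)"
    have l2: "?l2 \<le> D * int ?t" by (rule loss_le[OF c2]) (use D_ge AB' in linarith)
    have s: "?s = 1" using s1 True by simp
    have k1: "use E c S k u y True y = k True y - 1" and k2: "use E c S k u y False y = ban E c S k False y"
      using True by (simp_all add: use_def)
    have "int A * int (k True y) - int A * int (k True y - 1) \<le> int A"
      by (cases "k True y") (auto simp: algebra_simps)
    moreover have "gain c S k (use E c S k u y) y
        = D - (int A * int (k True y) - int A * int (k True y - 1)) + (D * int ?t - ?l2)"
      unfolding gain_def cross_split[of y S c] wt_def k1 k2 s by (simp add: ban_def algebra_simps)
    ultimately show ?thesis using l2 True by simp
  next
    case False
    let ?l1 = "if ?s = 0 then 0 else int A * int (k True y)"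
    have l1: "?l1 \<le> D * int ?s" by (rule loss_le) (use c1 D_ge AB' in linarith)+
    have s: "?t = 1" using s1 False by simp
    have k1: "use E c S k u y False y = k False y - 1" and k2: "use E c S k u y True y = ban E c S k True y"
      using False by (simp_all add: use_def)
    have "int B * int (k False y) - int B * int (k False y - 1) \<le> int B"
      by (cases "k False y") (auto simp: algebra_simps)
    moreover have "gain c S k (use E c S k u y) y
        = D - (int B * int (k False y) - int B * int (k False y - 1)) + (D * int ?s - ?l1)"
      unfolding gain_def cross_split[of y S c] wt_def k1 k2 s by (simp add: ban_def algebra_simps)
    ultimately show ?thesis using l1 False by simp
  qed
qed

lemma gain_use_other:
  "y \<noteq> y0 \<Longrightarrow> gain c S k (use E c S k u y0) y = gain c S k (ban E c S k) y"
  unfolding gain_def wt_def use_def by simp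

lemma gain_cand:
  assumes "bounded k X" "k' \<in> cand E c S X k" "y \<in> X"
  shows "0 \<le> gain c S k k' y"
proof -
  have bd: "k True y < B" "k False y < A" using assms(1,3) unfolding bounded_def by auto
  from assms(2) consider "k' = ban E c S k"
    | u y0 where "k' = use E c S k u y0" "usable E c S k u y0" unfolding cand_def by blast
  then show ?thesis
  proof cases
    case 1
    then show ?thesis using gain_ban(3)[where k = k and y = y, OF bd] by simp
  next
    case 2
    show ?thesis
    proof (cases "y = y0")
      case True
      then show ?thesis using gain_use[where k = k and y = y, OF bd, of c S u] 2 D_ge AB' by (auto split: if_splits)
    next
      case False
      then show ?thesis using gain_ban(3)[where k = k and y = y, OF bd] gain_use_other[OF False] 2 by simp
    qed
  qed
qed

text \<open>Among the ways to continue outside \<open>S\<close> the one of maximum total weight is taken: the whole outside is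
  the only set whose potential is in danger, and its potential differs from its total weight by a constant.\<close>

definition best where
  "best c S X k k' \<longleftrightarrow> k' \<in> cand E c S X k \<and>
     (\<forall>k''\<in>cand E c S X k. (\<Sum>y\<in>X. wt k'' y) \<le> (\<Sum>y\<in>X. wt k' y))"

lemma best_pot: "best c S X k k' \<Longrightarrow> k'' \<in> cand E c S X k \<Longrightarrow> pot k'' X \<le> pot k' X"
  unfolding best_def pot_def by simp

text \<open>One unit of the cap for colour \<open>True\<close> is set aside at the vertices of \<open>P\<close>, and one unit of the cap for colour
  \<open>False\<close> at those of \<open>Q\<close>. A vertex coloured under the lowered cap is unsaturated under the original one.\<close>

definition low :: "(bool \<Rightarrow> 'v \<Rightarrow> nat) \<Rightarrow> 'v set \<Rightarrow> 'v set \<Rightarrow> bool \<Rightarrow> 'v \<Rightarrow> nat" where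
  "low k P Q b v = k b v - (if v \<in> (if b then P else Q) then 1 else 0)"

lemma sum_indicator: "finite T \<Longrightarrow> (\<Sum>v\<in>T. if v \<in> P then (x::int) else 0) = x * int (card (T \<inter> P))"
  by (simp add: sum.If_cases)

lemma pot_low:
  assumes "finite T"
  shows "pot k T - int A * int (card (T \<inter> P)) - int B * int (card (T \<inter> Q)) \<le> pot (low k P Q) T"
proof -
  have le: "int A * int n - (if b then int A else 0) \<le> int A * int (n - (if b then 1 else 0))" for A n b
    by (cases n) (auto simp: algebra_simps)
  have "(\<Sum>v\<in>T. wt k v - (if v \<in> P then int A else 0) - (if v \<in> Q then int B else 0)) \<le> (\<Sum>v\<in>T. wt (low k P Q) v)"
  proof (rule sum_mono)
    fix v
    show "wt k v - (if v \<in> P then int A else 0) - (if v \<in> Q then int B else 0) \<le> wt (low k P Q) v"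
      using le[of A "k True v" "v \<in> P"] le[of B "k False v" "v \<in> Q"] unfolding wt_def low_def
      by (simp only: if_True if_False)
  qed
  then show ?thesis unfolding pot_def sum_subtractf sum_indicator[OF assms] by linarith
qed

lemma good_low:
  assumes "finite S"
    and "\<And>T. T \<noteq> {} \<Longrightarrow> T \<subseteq> S \<Longrightarrow> int A * int (card (T \<inter> P)) + int B * int (card (T \<inter> Q)) - int B < pot k T"
  shows "good (low k P Q) S"
  unfolding good_def
proof (intro allI impI)
  fix T assume T: "T \<noteq> {} \<and> T \<subseteq> S"
  then have "finite T" using assms(1) finite_subset by blast
  from pot_low[OF this, of k P Q] assms(2)[of T] T show "- int B < pot (low k P Q) T" by linarith
qed

lemma bounded_low: "bounded k V \<Longrightarrow> S \<subseteq> V \<Longrightarrow> bounded (low k P Q) S"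
  unfolding bounded_def low_def by (auto intro: le_less_trans[OF diff_le_self])

lemma bounded_cand:
  assumes "bounded k V" "X \<subseteq> V" "k' \<in> cand E c S X k"
  shows "bounded k' X"
proof -
  have "k' b v \<le> k b v" for b v using assms(3) by (auto simp: cand_def ban_def use_def)
  then show ?thesis using assms(1,2) unfolding bounded_def by (meson le_less_trans subsetD)
qed

lemma unsat:
  assumes "valid E (low k P Q) S c" "u \<in> S" "u \<in> (if c u then P else Q)"
  shows "seen E c S (c u) u + 1 < k (c u) u"
  using validD1[OF assms(1,2)] assms(3) unfolding seen_def low_def by (simp split: if_splits)

text \<open>What one step of the recursion needs: with the lowered caps \<open>S\<close> can be coloured recursively, and however this
  has turned out, the best continuation can be coloured recursively as well.\<close>

definition step_ok where
  "step_ok k V S P Q \<longleftrightarrow> S \<noteq> {} \<and> S \<subset> V \<and> good (low k P Q) S \<and>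
     (\<forall>c k'. valid E (low k P Q) S c \<longrightarrow> best c S (V - S) k k' \<longrightarrow> good k' (V - S))"

definition minimal where
  "minimal k V S \<longleftrightarrow> S \<noteq> {} \<and> S \<subset> V \<and> (\<forall>T. T \<noteq> {} \<and> T \<subset> V \<longrightarrow> pot k S \<le> pot k T)"

context
  fixes k V S
  assumes fin: "finite V" and good: "good k V" and bd: "bounded k V" and min: "minimal k V S"
begin

lemma SV: "S \<noteq> {}" "S \<subset> V" "S \<subseteq> V" using min unfolding minimal_def by auto

lemma min_le: "T \<noteq> {} \<Longrightarrow> T \<subset> V \<Longrightarrow> pot k S \<le> pot k T" using min unfolding minimal_def by auto

lemma finS: "finite S" "finite (V - S)" using fin SV finite_subset by auto

text \<open>Since \<open>S\<close> has minimum potential and no gain is negative, proper subsets of the complement keep a nonnegative potential.\<close>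

lemma good_after:
  assumes k': "k' \<in> cand E c S (V - S) k" and pos: "- int B < pot k' (V - S)"
  shows "good k' (V - S)"
  unfolding good_def
proof (intro allI impI)
  fix T assume T: "T \<noteq> {} \<and> T \<subseteq> V - S"
  show "- int B < pot k' T"
  proof (cases "T = V - S")
    case False
    have f: "finite T" using T finS finite_subset by blast
    have "pot k' T = pot k (S \<union> T) - pot k S + (\<Sum>y\<in>T. gain c S k k' y)"
      by (rule pot_after) (use T f finS in auto)
    moreover have "0 \<le> (\<Sum>y\<in>T. gain c S k k' y)"
      by (rule sum_nonneg, rule gain_cand[OF _ k']) (use T bd in \<open>auto simp: bounded_def\<close>)
    moreover have "pot k S \<le> pot k (S \<union> T)"
      by (rule min_le) (use T False SV in auto)
    ultimately show ?thesis using AB' by linarith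
  qed (use pos in simp)
qed

text \<open>The complement has potential above \<open>- B\<close> as soon as the total gain makes up for the potential of \<open>S\<close>, because \<open>V\<close> has
  potential above \<open>- B\<close>. It is enough to exhibit one continuation with that gain.\<close>

lemma good_best:
  assumes k'': "k'' \<in> cand E c S (V - S) k" and le: "pot k S \<le> (\<Sum>y\<in>V - S. gain c S k k'' y)"
    and best: "best c S (V - S) k k'"
  shows "good k' (V - S)"
proof (rule good_after)
  show "k' \<in> cand E c S (V - S) k" using best unfolding best_def by simp
  have "pot k'' (V - S) = pot k (S \<union> (V - S)) - pot k S + (\<Sum>y\<in>V - S. gain c S k k'' y)"
    by (rule pot_after) (use finS in auto)
  moreover have "S \<union> (V - S) = V" using SV by auto
  moreover have "- int B < pot k V" using good SV unfolding good_def by auto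
  ultimately have "- int B < pot k'' (V - S)" using le by simp
  then show "- int B < pot k' (V - S)" using best_pot[OF best k''] by simp
qed

lemma ban_cand: "ban E c S k \<in> cand E c S (V - S) k" unfolding cand_def by simp

lemma gain_one:
  assumes "k'' \<in> cand E c S (V - S) k" "y \<in> V - S" "g \<le> gain c S k k'' y"
  shows "g \<le> (\<Sum>y\<in>V - S. gain c S k k'' y)"
proof -
  have "gain c S k k'' y \<le> (\<Sum>y\<in>V - S. gain c S k k'' y)"
    by (rule member_le_sum)
      (use assms(2) finS gain_cand[OF _ assms(1)] bd in \<open>auto simp: bounded_def\<close>)
  then show ?thesis using assms(3) by linarith
qed

text \<open>An edge from \<open>S\<close> to \<open>v\<close> whose end \<open>u\<close> is unsaturated guarantees a large gain: either it can be used, or \<open>v\<close>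
  has two edges to the colour class of \<open>u\<close> and banning the colour leaves the second one as a gain.\<close>

lemma gain_edge:
  assumes "u \<in> S" "v \<in> V - S" "0 < cross E {v} {u}" "seen E c S (c u) u + 1 < k (c u) u"
  shows "\<exists>k''\<in>cand E c S (V - S) k. D - (if c u then int A else int B) \<le> (\<Sum>y\<in>V - S. gain c S k k'' y)"
proof -
  have b: "k True v < B" "k False v < A" using bd assms(2) by (auto simp: bounded_def)
  have "cross E {v} {u} \<le> seen E c S (c u) v" unfolding seen_def by (rule cross_mono) (use assms in auto)
  then consider "seen E c S (c u) v = 1" | "2 \<le> seen E c S (c u) v" using assms(3) by linarith
  then show ?thesis
  proof cases
    case 1
    then have us: "usable E c S k u v" using assms unfolding usable_def by simp
    then have "use E c S k u v \<in> cand E c S (V - S) k" using assms(2) unfolding cand_def by blast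
    with gain_one[OF this assms(2) gain_use[where k = k and y = v, OF b us]] show ?thesis by blast
  next
    case 2
    have "D - (if c u then int A else int B) \<le> gain c S k (ban E c S k) v"
      using gain_ban(2)[where k = k and y = v and b = "c u", OF b 2] by auto
    from gain_one[OF ban_cand assms(2) this] show ?thesis using ban_cand by blast
  qed
qed

lemma gain_colour1:
  "(int A - int B) * int (cross E {u\<in>S. c u} (V - S)) \<le> (\<Sum>y\<in>V - S. gain c S k (ban E c S k) y)"
proof -
  have "int (cross E {u\<in>S. c u} (V - S)) = (\<Sum>y\<in>V - S. int (seen E c S True y))"
    by (subst cross_sum) (use finS in \<open>auto simp: seen_def\<close>)
  then have "(int A - int B) * int (cross E {u\<in>S. c u} (V - S)) = (\<Sum>y\<in>V - S. (int A - int B) * int (seen E c S True y))"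
    by (simp add: sum_distrib_left)
  also have "\<dots> \<le> (\<Sum>y\<in>V - S. gain c S k (ban E c S k) y)"
    by (rule sum_mono, rule gain_ban) (use bd in \<open>auto simp: bounded_def\<close>)
  finally show ?thesis .
qed

lemma colour1_edge:
  assumes "u \<in> S" "v \<in> V - S" "0 < cross E {v} {u}" "c u"
  shows "1 \<le> cross E {u\<in>S. c u} (V - S)"
proof -
  have "cross E {u} {v} \<le> cross E {u\<in>S. c u} (V - S)" by (rule cross_mono) (use assms in auto)
  then show ?thesis using assms(3) by (simp add: cross_commute)
qed

lemma step_nonpos:
  assumes "pot k S \<le> 0"
  shows "step_ok k V S {} {}"
  unfolding step_ok_def
proof (intro conjI allI impI SV)
  show "good (low k {} {}) S"
  proof (rule good_low[OF finS(1)])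
    fix T assume "T \<noteq> {}" "T \<subseteq> S"
    then have "- int B < pot k T" using SV(3) by (intro goodD[OF good]) auto
    then show "int A * int (card (T \<inter> {})) + int B * int (card (T \<inter> {})) - int B < pot k T" by simp
  qed
next
  fix c k' assume "best c S (V - S) k k'"
  show "good k' (V - S)"
  proof (rule good_best[OF ban_cand _ \<open>best c S (V - S) k k'\<close>])
    have "0 \<le> (\<Sum>y\<in>V - S. gain c S k (ban E c S k) y)"
      by (rule sum_nonneg, rule gain_cand[OF _ ban_cand]) (use bd in \<open>auto simp: bounded_def\<close>)
    then show "pot k S \<le> (\<Sum>y\<in>V - S. gain c S k (ban E c S k) y)" using assms by linarith
  qed
qed

text \<open>Without boundary edges nothing changes outside \<open>S\<close>.\<close>

lemma step_component:
  assumes "cross E S (V - S) = 0"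
  shows "step_ok k V S {} {}"
  unfolding step_ok_def
proof (intro conjI allI impI SV)
  show "good (low k {} {}) S"
  proof (rule good_low[OF finS(1)])
    fix T assume "T \<noteq> {}" "T \<subseteq> S"
    then have "- int B < pot k T" using SV(3) by (intro goodD[OF good]) auto
    then show "int A * int (card (T \<inter> {})) + int B * int (card (T \<inter> {})) - int B < pot k T" by simp
  qed
next
  fix c k' assume b: "best c S (V - S) k k'"
  have z: "cross E {y} S = 0" if "y \<in> V - S" for y
    using assms that unfolding cross_sum[OF finS(2) Diff_disjoint] using finS by simp
  have "\<not> usable E c S k u y" if "y \<in> V - S" for u y
    using cross_mono[of "{y}" "{y}" "{u}" S E] z[OF that] unfolding usable_def by auto
  then have "k' = ban E c S k" using b unfolding best_def cand_def by blast
  moreover have "seen E c S bb y = 0" if "y \<in> V - S" for bb y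
    using cross_mono[of "{y}" "{y}" "{u\<in>S. c u = bb}" S E] z[OF that] unfolding seen_def by auto
  ultimately have eq: "k' bb y = k bb y" if "y \<in> V - S" for bb y using that by (simp add: ban_def)
  show "good k' (V - S)" unfolding good_def
  proof (intro allI impI)
    fix T assume T: "T \<noteq> {} \<and> T \<subseteq> V - S"
    have "pot k' T = pot k T" by (rule pot_cong) (use eq T in blast)
    then show "- int B < pot k' T" using good T unfolding good_def by auto
  qed
qed

lemma low_good_min:
  assumes "finite P" "finite Q" "int A * int (card P) + int B * int (card Q) - int B < pot k S"
  shows "good (low k P Q) S"
proof (rule good_low[OF finS(1)])
  fix T assume T: "T \<noteq> {}" "T \<subseteq> S"
  have "pot k S \<le> pot k T" by (rule min_le) (use T SV in auto)
  moreover have "int A * int (card (T \<inter> P)) \<le> int A * int (card P)" "int B * int (card (T \<inter> Q)) \<le> int B * int (card Q)"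
    using assms by (auto intro!: mult_left_mono card_mono)
  ultimately show "int A * int (card (T \<inter> P)) + int B * int (card (T \<inter> Q)) - int B < pot k T"
    using assms(3) by linarith
qed

text \<open>The end \<open>u\<close> of a boundary edge either gets colour \<open>True\<close>, and banning this colour at the other end gains
  \<open>A - B\<close>, or it gets colour \<open>False\<close> and is unsaturated, which gains \<open>D - B\<close>. The potential of \<open>S\<close> is large enough
  to pay for the lowered cap.\<close>

lemma step_first:
  assumes "0 < pot k S" "pot k S \<le> int A - int B" "u \<in> S" "v \<in> V - S" "0 < cross E {v} {u}"
  shows "step_ok k V S {} {u}"
  unfolding step_ok_def
proof (intro conjI allI impI SV)
  show "good (low k {} {u}) S" by (rule low_good_min) (use assms in auto)
next
  fix c k' assume val: "valid E (low k {} {u}) S c" and b: "best c S (V - S) k k'"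
  show "good k' (V - S)"
  proof (cases "c u")
    case True
    have "(int A - int B) * 1 \<le> (int A - int B) * int (cross E {u\<in>S. c u} (V - S))"
      using colour1_edge[OF assms(3-5), of c] True AB' by (intro mult_left_mono) auto
    then have "int A - int B \<le> (\<Sum>y\<in>V - S. gain c S k (ban E c S k) y)"
      using order_trans[OF _ gain_colour1[of c]] by simp
    with assms(2) show ?thesis by (intro good_best[OF ban_cand _ b]) (rule order_trans)
  next
    case False
    have "seen E c S (c u) u + 1 < k (c u) u"
      by (rule unsat[OF val assms(3)]) (simp add: False)
    from gain_edge[OF assms(3-5) this] False obtain k'' where k: "k''\<in>cand E c S (V - S) k"
      "D - int B \<le> (\<Sum>y\<in>V - S. gain c S k k'' y)" by auto
    have "pot k S \<le> (\<Sum>y\<in>V - S. gain c S k k'' y)" using k(2) assms(2) D_ge AB' by linarith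
    then show ?thesis by (rule good_best[OF k(1) _ b])
  qed
qed

text \<open>Now one edge of gain \<open>A - B\<close> does not suffice, but two of them do, as \<open>2 (A - B) \<ge> A\<close>; so the cap for
  colour \<open>False\<close> is lowered at the ends of two boundary edges. The last premise says that two different edges
  are meant, which may share their ends.\<close>

lemma step_second:
  assumes "3 \<le> B" "int A - int B < pot k S" "pot k S \<le> int A"
    and "u1 \<in> S" "v1 \<in> V - S" "0 < cross E {v1} {u1}"
    and "u2 \<in> S" "v2 \<in> V - S" "0 < cross E {v2} {u2}"
    and two: "\<And>c. c u1 \<Longrightarrow> c u2 \<Longrightarrow> 2 \<le> cross E {u\<in>S. c u} (V - S)"
  shows "step_ok k V S {} {u1, u2}"
  unfolding step_ok_def
proof (intro conjI allI impI SV)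
  have "int B * int (card {u1, u2}) \<le> int B * 2" by (intro mult_left_mono) (auto simp: card_insert_if)
  then have "int A * int (card {}) + int B * int (card {u1, u2}) - int B < pot k S"
    using assms(2) AB' unfolding card.empty by linarith
  then show "good (low k {} {u1, u2}) S" by (intro low_good_min) simp_all
next
  fix c k' assume val: "valid E (low k {} {u1, u2}) S c" and b: "best c S (V - S) k k'"
  have one: "good k' (V - S)" if "u \<in> {u1, u2}" "\<not> c u" "v \<in> V - S" "0 < cross E {v} {u}" for u v
  proof -
    have u: "u \<in> S" using that(1) assms(4,7) by blast
    have "seen E c S (c u) u + 1 < k (c u) u"
      by (rule unsat[OF val u]) (simp only: that if_False)
    from gain_edge[OF u that(3,4) this] that(2) obtain k'' where k: "k''\<in>cand E c S (V - S) k"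
      "D - int B \<le> (\<Sum>y\<in>V - S. gain c S k k'' y)" by auto
    have "pot k S \<le> (\<Sum>y\<in>V - S. gain c S k k'' y)" using k(2) assms(3) D_ge AB' by linarith
    then show ?thesis by (rule good_best[OF k(1) _ b])
  qed
  show "good k' (V - S)"
  proof (cases "c u1 \<and> c u2")
    case True
    have "(int A - int B) * 2 \<le> (int A - int B) * int (cross E {u\<in>S. c u} (V - S))"
      using two[of c] True AB' by (intro mult_left_mono) auto
    then have "(int A - int B) * 2 \<le> (\<Sum>y\<in>V - S. gain c S k (ban E c S k) y)"
      by (rule order_trans[OF _ gain_colour1[of c]])
    moreover have "int A \<le> (int A - int B) * 2" using AB' by simp
    ultimately have "pot k S \<le> (\<Sum>y\<in>V - S. gain c S k (ban E c S k) y)"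
      using assms(3) by (meson order_trans)
    then show ?thesis by (rule good_best[OF ban_cand _ b])
  next
    case False
    then show ?thesis using one[of u1 v1] one[of u2 v2] assms(5,6,8,9) by blast
  qed
qed

text \<open>The potential of \<open>S\<close> pays for lowering both caps at one end of a boundary edge. Then this end is unsaturated
  in either case, and the gain is at least \<open>D - A \<ge> A + B\<close>.\<close>

lemma step_third:
  assumes "3 \<le> B" "int A < pot k S" "pot k S \<le> int A + int B" "u \<in> S" "v \<in> V - S" "0 < cross E {v} {u}"
  shows "step_ok k V S {u} {u}"
  unfolding step_ok_def
proof (intro conjI allI impI SV)
  show "good (low k {u} {u}) S" by (rule low_good_min) (use assms in auto)
next
  fix c k' assume val: "valid E (low k {u} {u}) S c" and b: "best c S (V - S) k k'"
  have "seen E c S (c u) u + 1 < k (c u) u"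
    by (rule unsat[OF val assms(4)]) simp
  from gain_edge[OF assms(4-6) this] obtain k'' where k: "k''\<in>cand E c S (V - S) k"
    "D - (if c u then int A else int B) \<le> (\<Sum>y\<in>V - S. gain c S k k'' y)" by blast
  have "D - int A \<le> (\<Sum>y\<in>V - S. gain c S k k'' y)" using k(2) AB' by (auto split: if_splits)
  then have "pot k S \<le> (\<Sum>y\<in>V - S. gain c S k k'' y)" using assms(3) D_ge3[OF assms(1)] AB' by linarith
  then show "good k' (V - S)" by (rule good_best[OF k(1) _ b])
qed

end

end

section \<open>Removing a single vertex\<close>

context params begin

lemma cand_unseen:
  assumes "k' \<in> cand E c S X k" "cross E {y} S = 0"
  shows "k' b y = k b y"
proof -
  have s: "seen E c S b y = 0" for b
    using cross_mono[of "{y}" "{y}" "{u\<in>S. c u = b}" S E] assms(2) unfolding seen_def by auto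
  from assms(1) consider "k' = ban E c S k" | u y0 where "k' = use E c S k u y0" "usable E c S k u y0"
    unfolding cand_def by blast
  then show ?thesis
  proof cases
    case 1
    then show ?thesis using s by (simp add: ban_def)
  next
    case 2
    then have "y \<noteq> y0" using s unfolding usable_def by auto
    then show ?thesis using 2 s by (simp add: ban_def use_def)
  qed
qed

text \<open>If there is just one boundary edge \<open>uv\<close>, the roles are exchanged: the complement is coloured first. As \<open>V\<close> has potential
  above \<open>- B\<close> and \<open>S\<close> has potential at most \<open>A\<close>, sets in the complement that contain \<open>v\<close> have potential above \<open>D - A - B \<ge> A\<close>, so both
  caps of \<open>v\<close> can be lowered. Afterwards the edge is usable and costs \<open>S\<close> at most \<open>A\<close>, which all of its subsets can afford.\<close>

lemma step_bridge:
  assumes fin: "finite V" and good: "good k V" and bd: "bounded k V" and min: "minimal k V S"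
    and B3: "3 \<le> B" and lo: "int A - int B < pot k S" and hi: "pot k S \<le> int A"
    and r: "cross E S (V - S) = 1" and u: "u \<in> S" and v: "v \<in> V - S" and uv: "0 < cross E {v} {u}"
  shows "step_ok k V (V - S) {v} {v}"
  unfolding step_ok_def
proof (intro conjI allI impI)
  note SV = SV[OF fin good bd min] and finS = finS[OF fin good bd min]
  show "V - S \<noteq> {}" using v by blast
  show "V - S \<subset> V" using SV by blast
  show "good (low k {v} {v}) (V - S)"
  proof (rule good_low[OF finS(2)])
    fix T assume T: "T \<noteq> {}" "T \<subseteq> V - S"
    show "int A * int (card (T \<inter> {v})) + int B * int (card (T \<inter> {v})) - int B < pot k T"
    proof (cases "v \<in> T")
      case False
      then show ?thesis using goodD[OF good T(1)] T(2) by auto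
    next
      case True
      have fT: "finite T" using T finS finite_subset by blast
      have "cross E {u} {v} \<le> cross E S T" by (rule cross_mono) (use True u in auto)
      then have "D * 1 \<le> D * int (cross E S T)"
        using uv D_ge AB' by (intro mult_left_mono) (auto simp: cross_commute)
      moreover have "pot k (S \<union> T) = pot k S + pot k T - D * int (cross E S T)"
        by (rule pot_Un[OF finS(1) fT]) (use T in blast)
      moreover have "- int B < pot k (S \<union> T)" by (rule goodD[OF good]) (use T SV in auto)
      ultimately have "int A < pot k T" using hi D_ge3[OF B3] by linarith
      then show ?thesis using True by simp
    qed
  qed
  have VV: "V - (V - S) = S" using SV by blast
  fix c k' assume val: "valid E (low k {v} {v}) (V - S) c" and b: "best c (V - S) (V - (V - S)) k k'"
  have bb: "best c (V - S) S k k'" using b unfolding VV .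
  have tot: "(\<Sum>y\<in>S. cross E {y} (V - S)) = 1"
    using r cross_sum[OF finS(1), of "V - S" E] by (simp add: cross_commute Int_commute)
  have cu: "cross E {u} {v} \<le> cross E {u} (V - S)" by (rule cross_mono) (use v in auto)
  have cu1: "1 \<le> cross E {u} (V - S)" using cu uv by (simp add: cross_commute)
  have rem: "(\<Sum>y\<in>S. cross E {y} (V - S)) = cross E {u} (V - S) + (\<Sum>y\<in>S - {u}. cross E {y} (V - S))"
    by (rule sum.remove[OF finS(1) u])
  have ceq: "cross E {u} (V - S) = 1" using rem tot cu1 by linarith
  have "(\<Sum>y\<in>S - {u}. cross E {y} (V - S)) = 0" using rem tot ceq by linarith
  then have other: "cross E {y} (V - S) = 0" if "y \<in> S" "y \<noteq> u" for y using that finS by simp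
  have same: "k'' b y = k b y" if "k'' \<in> cand E c (V - S) S k" "y \<in> S" "y \<noteq> u" for k'' b y
    by (rule cand_unseen[OF that(1) other[OF that(2,3)]])
  have le: "cross E {u} {v} \<le> seen E c (V - S) (c v) u"
    unfolding seen_def by (rule cross_mono) (use v in auto)
  have spl: "seen E c (V - S) True u + seen E c (V - S) False u = 1"
    using ceq cross_split[of u "V - S" c] by simp
  have s1: "seen E c (V - S) (c v) u = 1" and s0: "seen E c (V - S) (\<not> c v) u = 0"
    using le uv spl by (cases "c v"; simp add: cross_commute)+
  have "seen E c (V - S) (c v) v + 1 < k (c v) v"
    using validD1[OF val v] unfolding seen_def low_def by (simp split: if_splits)
  then have us: "usable E c (V - S) k v u"
    using uv s1 v unfolding usable_def by (simp add: cross_commute)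
  let ?k = "use E c (V - S) k v u"
  have kc: "?k \<in> cand E c (V - S) S k" using us u unfolding cand_def by blast
  have k'c: "k' \<in> cand E c (V - S) S k" and kle: "(\<Sum>y\<in>S. wt ?k y) \<le> (\<Sum>y\<in>S. wt k' y)"
    using bb kc unfolding best_def by auto
  have "(\<Sum>y\<in>S - {u}. wt ?k y) = (\<Sum>y\<in>S - {u}. wt k' y)"
    unfolding wt_def using same[OF kc] same[OF k'c] by (intro sum.cong) auto
  then have "wt ?k u \<le> wt k' u" using kle sum.remove[OF finS(1) u, of "wt ?k"] sum.remove[OF finS(1) u, of "wt k'"]
    by linarith
  moreover have "wt k u - int A \<le> wt ?k u"
  proof -
    have "?k (c v) u = k (c v) u - 1" "?k (\<not> c v) u = k (\<not> c v) u" using s0 by (auto simp: use_def ban_def)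
    then show ?thesis unfolding wt_def using AB'
      by (cases "c v"; cases "k (c v) u") (auto simp: algebra_simps)
  qed
  ultimately have wu: "wt k u - int A \<le> wt k' u" by linarith
  show "good k' (V - (V - S))" unfolding VV good_def
  proof (intro allI impI)
    fix T assume T: "T \<noteq> {} \<and> T \<subseteq> S"
    have fT: "finite T" using T finS finite_subset by blast
    have m: "pot k S \<le> pot k T" by (rule min_le[OF fin good bd min]) (use T SV in auto)
    have "(\<Sum>y\<in>T. wt k y - (if y \<in> {u} then int A else 0)) \<le> (\<Sum>y\<in>T. wt k' y)"
    proof (rule sum_mono)
      fix y assume "y \<in> T"
      then show "wt k y - (if y \<in> {u} then int A else 0) \<le> wt k' y"
        using wu same[OF k'c, of y] T by (cases "y = u") (auto simp: wt_def)
    qed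
    then have "(\<Sum>y\<in>T. wt k y) - int A * int (card (T \<inter> {u})) \<le> (\<Sum>y\<in>T. wt k' y)"
      unfolding sum_subtractf sum_indicator[OF fT] .
    moreover have "int A * int (card (T \<inter> {u})) \<le> int A * 1"
      by (intro mult_left_mono) (auto simp: Int_insert_right)
    ultimately have "pot k T - int A \<le> pot k' T" unfolding pot_def by linarith
    then show "- int B < pot k' T" using m lo by linarith
  qed
qed

definition nbs :: "'v set \<Rightarrow> 'v \<Rightarrow> 'v set" where
  "nbs V v = {u\<in>V. 0 < cross E {v} {u}}"

definition deg :: "'v set \<Rightarrow> 'v \<Rightarrow> nat" where
  "deg V v = cross E {v} V"

lemma deg_remove: "deg V v = cross E {v} (V - {v})"
proof -
  have "cross E {v} V = cross E {v} ((V - {v}) \<union> (V \<inter> {v}))" by (rule arg_cong[where f = "cross E {v}"]) blast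
  also have "\<dots> = cross E {v} (V - {v}) + cross E {v} (V \<inter> {v})"
    by (rule cross_loopless_Un[OF loopless]) blast
  also have "cross E {v} (V \<inter> {v}) = 0"
    using cross_mono[of "{v}" "{v}" "V \<inter> {v}" "{v}" E] cross_loop[OF loopless, of v] by simp
  finally show ?thesis by (simp add: deg_def)
qed

lemma nbs_self: "v \<notin> nbs V v" using cross_loop[OF loopless, of v] unfolding nbs_def by simp

lemma card_nbs:
  assumes "finite T" "T \<subseteq> V" "v \<notin> T"
  shows "card (T \<inter> nbs V v) \<le> cross E {v} T"
proof -
  have "card (T \<inter> nbs V v) = (\<Sum>u\<in>T \<inter> nbs V v. 1)" by simp
  also have "\<dots> \<le> (\<Sum>u\<in>T \<inter> nbs V v. cross E {u} {v})"
    by (rule sum_mono) (auto simp: nbs_def cross_commute)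
  also have "\<dots> \<le> (\<Sum>u\<in>T. cross E {u} {v})" by (rule sum_mono2) (use assms in auto)
  also have "\<dots> = cross E {v} T" by (rule cross_sum[symmetric]) (use assms in auto)
  finally show ?thesis .
qed

lemma wt_full:
  assumes "k True v < B" "k False v < A"
  shows "wt k v \<le> 2 * D - int A"
  using cap1[OF assms(1)] cap2[OF assms(2)] unfolding wt_def by linarith

lemma pot_single: "pot k {v} = wt k v"
  unfolding pot_def by (simp add: inside_single[OF loopless])

text \<open>After \<open>V - {v}\<close> has been coloured by \<open>c\<close>, colour \<open>b\<close> remains available at \<open>v\<close>: either no neighbour of \<open>v\<close> has
  it, or a single edge leads to that colour class and can be used.\<close>

definition free where
  "free c V k v b \<longleftrightarrow> seen E c (V - {v}) b v = 0 \<and> 0 < k b v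
     \<or> seen E c (V - {v}) b v = 1 \<and> (1::nat) < k b v \<and>
       (\<forall>u\<in>nbs V v. c u = b \<longrightarrow> seen E c (V - {v}) b u + 1 < k b u)"

text \<open>For a single vertex outside \<open>S\<close> the potential condition just says that some cap remains positive.\<close>

lemma step_single:
  assumes v: "v \<in> V" and card: "2 \<le> card V" and fin: "finite V"
    and good: "good (low k P Q) (V - {v})"
    and free: "\<And>c. valid E (low k P Q) (V - {v}) c \<Longrightarrow> \<exists>b. free c V k v b"
  shows "step_ok k V (V - {v}) P Q"
  unfolding step_ok_def
proof (intro conjI allI impI good)
  show "V - {v} \<noteq> {}"
  proof
    assume "V - {v} = {}"
    then have "V = {v}" using v by blast
    then show False using card by simp
  qed
  show "V - {v} \<subset> V" using v by blast
  have VV: "V - (V - {v}) = {v}" using v by blast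
  fix c k' assume val: "valid E (low k P Q) (V - {v}) c" and b: "best c (V - {v}) (V - (V - {v})) k k'"
  from free[OF val] obtain b0 where f: "free c V k v b0" ..
  have "\<exists>k''\<in>cand E c (V - {v}) {v} k. 0 < k'' b0 v"
  proof (cases "seen E c (V - {v}) b0 v = 0")
    case True
    then have "0 < ban E c (V - {v}) k b0 v" using f unfolding free_def ban_def by auto
    then show ?thesis unfolding cand_def by blast
  next
    case False
    then have s1: "seen E c (V - {v}) b0 v = 1" and k1: "1 < k b0 v"
      and un: "\<And>u. u \<in> nbs V v \<Longrightarrow> c u = b0 \<Longrightarrow> seen E c (V - {v}) b0 u + 1 < k b0 u"
      using f unfolding free_def by auto
    have "\<exists>u\<in>{u\<in>V - {v}. c u = b0}. 0 < cross E {u} {v}"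
    proof (rule ccontr)
      assume "\<not> ?thesis"
      then have "\<forall>u\<in>{u\<in>V - {v}. c u = b0}. cross E {u} {v} = 0" by (metis not_gr_zero)
      then have "(\<Sum>u\<in>{u\<in>V - {v}. c u = b0}. cross E {u} {v}) = 0"
        by (rule sum.neutral)
      then have "cross E {v} {u\<in>V - {v}. c u = b0} = 0"
        by (subst cross_sum) (use fin in auto)
      then show False using s1 unfolding seen_def by simp
    qed
    then obtain u where u: "u \<in> V - {v}" "c u = b0" "0 < cross E {v} {u}"
      by (auto simp: cross_commute)
    then have "u \<in> nbs V v" unfolding nbs_def by simp
    from un[OF this u(2)] have us: "usable E c (V - {v}) k u v"
      unfolding usable_def using u s1 by simp
    have "use E c (V - {v}) k u v b0 v = k b0 v - 1" using u by (simp add: use_def)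
    then have "0 < use E c (V - {v}) k u v b0 v" using k1 by simp
    moreover have "use E c (V - {v}) k u v \<in> cand E c (V - {v}) {v} k" using us unfolding cand_def by blast
    ultimately show ?thesis by blast
  qed
  then obtain k'' where k: "k'' \<in> cand E c (V - {v}) {v} k" "0 < k'' b0 v" ..
  have "wt k'' v \<le> wt k' v" using b k(1) unfolding VV best_def by auto
  moreover have "- int B < wt k'' v"
  proof (cases b0)
    case True
    then have "int A * 1 \<le> int A * int (k'' True v)" using k by (intro mult_left_mono) auto
    moreover have "0 \<le> int B * int (k'' False v)" by simp
    ultimately show ?thesis unfolding wt_def using AB' by linarith
  next
    case False
    then have "int B * 1 \<le> int B * int (k'' False v)" using k by (intro mult_left_mono) auto
    moreover have "0 \<le> int A * int (k'' True v)" by simp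
    ultimately show ?thesis unfolding wt_def using AB' by linarith
  qed
  ultimately have "- int B < pot k' {v}" unfolding pot_single by linarith
  then show "good k' (V - (V - {v}))" unfolding VV good_def by (auto dest: subset_singletonD)
qed

text \<open>The neighbours of \<open>v\<close> that may become saturated in colour \<open>False\<close> after \<open>v\<close> has been removed. Every other
  neighbour has a cap above its degree and is unsaturated without any precaution.\<close>

definition tight where
  "tight k V v = {h\<in>nbs V v. k False h \<le> deg V h}"

context
  fixes k V v
  assumes fin: "finite V" and good: "good k V" and bd: "bounded k V" and v: "v \<in> V" and card: "2 \<le> card V"
    and gap: "\<And>T. T \<noteq> {} \<Longrightarrow> T \<subset> V \<Longrightarrow> int A - int B < pot k T"
begin

lemma vV: "{v} \<subset> V"
proof -
  have "{v} \<noteq> V" using card by auto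
  then show ?thesis using v by blast
qed

lemma seen_deg: "seen E c (V - {v}) True v + seen E c (V - {v}) False v = deg V v"
  unfolding deg_remove using cross_split[of v "V - {v}" c] by simp

lemma unsat_nbs:
  assumes "valid E (low k P Q) (V - {v}) c" "u \<in> nbs V v" "nbs V v \<subseteq> (if b then P else Q)" "c u = b"
  shows "seen E c (V - {v}) b u + 1 < k b u"
proof -
  have "u \<in> V - {v}" using assms(2) nbs_self[of v V] unfolding nbs_def by auto
  from unsat[OF assms(1) this] assms show ?thesis by auto
qed

text \<open>If colour \<open>False\<close> is forbidden at \<open>v\<close>, then \<open>v\<close> takes colour \<open>True\<close>, and the lowered cap of its neighbour makes the edge usable.
  Otherwise \<open>v\<close> takes colour \<open>False\<close> unless its neighbour has this colour; in that case it takes colour \<open>True\<close> if that is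
  allowed, and else colour \<open>False\<close> by means of the usable edge. That the cap of \<open>v\<close> is at least two where this is needed follows from its weight,
  which exceeds \<open>A - B\<close>.\<close>

lemma step_degree1:
  assumes "deg V v \<le> 1"
  shows "step_ok k V (V - {v}) (if k False v = 0 then nbs V v else {}) (if k False v = 0 then {} else nbs V v)"
    (is "step_ok k V _ ?P ?Q")
proof (rule step_single[OF v card fin])
  have one: "card (T \<inter> nbs V v) \<le> 1" if "T \<subseteq> V - {v}" for T
  proof -
    have "card (T \<inter> nbs V v) \<le> cross E {v} T" by (rule card_nbs) (use that fin finite_subset in auto)
    also have "\<dots> \<le> deg V v" unfolding deg_def by (rule cross_mono) (use that in auto)
    finally show ?thesis using assms by simp
  qed
  show "good (low k ?P ?Q) (V - {v})"
  proof (rule good_low)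
    fix T assume T: "T \<noteq> {}" "T \<subseteq> V - {v}"
    have g: "int A - int B < pot k T" using gap[of T] T v by blast
    have "int A * int (card (T \<inter> nbs V v)) \<le> int A * 1" "int B * int (card (T \<inter> nbs V v)) \<le> int B * 1"
      using one[OF T(2)] by (intro mult_left_mono; simp)+
    note b = this
    have "int A * int (card (T \<inter> ?P)) + int B * int (card (T \<inter> ?Q))
      = (if k False v = 0 then int A * int (card (T \<inter> nbs V v)) else int B * int (card (T \<inter> nbs V v)))" by simp
    also have "\<dots> \<le> int A" using b AB' by (simp only: split: if_splits) linarith
    finally show "int A * int (card (T \<inter> ?P)) + int B * int (card (T \<inter> ?Q)) - int B < pot k T"
      using g by linarith
  qed (use fin in simp)
  have w: "int A - int B < wt k v" using gap[of "{v}"] vV unfolding pot_single by simp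
  fix c assume val: "valid E (low k ?P ?Q) (V - {v}) c"
  note sd = seen_deg[of c]
  show "\<exists>b. free c V k v b"
  proof (cases "k False v = 0")
    case True
    have "2 \<le> k True v"
    proof (rule ccontr)
      assume "\<not> 2 \<le> k True v"
      then have "int A * int (k True v) \<le> int A * 1" by (intro mult_left_mono) auto
      then show False using w True unfolding wt_def by simp
    qed
    moreover have "seen E c (V - {v}) True v \<le> 1" using sd assms by simp
    moreover have "seen E c (V - {v}) True u + 1 < k True u" if "u \<in> nbs V v" "c u = True" for u
      by (rule unsat_nbs[OF val that(1) _ that(2)]) (simp add: True)
    ultimately have "free c V k v True" unfolding free_def by (cases "seen E c (V - {v}) True v = 0") auto
    then show ?thesis by blast
  next
    case F: False
    consider "seen E c (V - {v}) False v = 0"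
      | "seen E c (V - {v}) True v = 0" "seen E c (V - {v}) False v = 1" using sd assms by linarith
    then show ?thesis
    proof cases
      case 1
      then have "free c V k v False" using F unfolding free_def by simp
      then show ?thesis by blast
    next
      case 2
      show ?thesis
      proof (cases "k True v = 0")
        case False
        then have "free c V k v True" using 2 unfolding free_def by simp
        then show ?thesis by blast
      next
        case True
        have "2 \<le> k False v"
        proof (rule ccontr)
          assume "\<not> 2 \<le> k False v"
          then have "int B * int (k False v) \<le> int B * 1" by (intro mult_left_mono) auto
          then show False using w AB' unfolding wt_def True of_nat_0 mult_zero_right by linarith
        qed
        moreover have "seen E c (V - {v}) False u + 1 < k False u" if "u \<in> nbs V v" "c u = False" for u
          by (rule unsat_nbs[OF val that(1) _ that(2)]) (use F in simp)
        ultimately have "free c V k v False" using 2 unfolding free_def by auto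
        then show ?thesis by blast
      qed
    qed
  qed
qed

text \<open>If both colours occur among the neighbours, exactly one edge leads to colour \<open>False\<close>, and that edge is usable.\<close>

lemma step_degree2:
  assumes "deg V v = 2" "1 \<le> k True v" "2 \<le> k False v"
  shows "step_ok k V (V - {v}) {} (nbs V v)"
proof (rule step_single[OF v card fin])
  show "good (low k {} (nbs V v)) (V - {v})"
  proof (rule good_low)
    fix T assume T: "T \<noteq> {}" "T \<subseteq> V - {v}"
    have "card (T \<inter> nbs V v) \<le> cross E {v} T" by (rule card_nbs) (use T fin finite_subset in auto)
    also have "\<dots> \<le> deg V v" unfolding deg_def by (rule cross_mono) (use T in auto)
    finally have "int B * int (card (T \<inter> nbs V v)) \<le> int B * 2" using assms by (intro mult_left_mono) auto
    moreover have "int A - int B < pot k T" using gap[of T] T v by blast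
    ultimately show "int A * int (card (T \<inter> {})) + int B * int (card (T \<inter> nbs V v)) - int B < pot k T"
      using AB' by (simp only: Int_empty_right card.empty)
  qed (use fin in simp)
  fix c assume val: "valid E (low k {} (nbs V v)) (V - {v}) c"
  consider "seen E c (V - {v}) False v = 0" | "seen E c (V - {v}) True v = 0"
    | "seen E c (V - {v}) False v = 1" using seen_deg[of c] assms(1) by linarith
  then show "\<exists>b. free c V k v b"
  proof cases
    case 1
    then have "free c V k v False" using assms unfolding free_def by simp
    then show ?thesis by blast
  next
    case 2
    then have "free c V k v True" using assms unfolding free_def by simp
    then show ?thesis by blast
  next
    case 3
    have "seen E c (V - {v}) False u + 1 < k False u" if "u \<in> nbs V v" "c u = False" for u
      by (rule unsat_nbs[OF val that(1) _ that(2)]) simp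
    then have "free c V k v False" using 3 assms unfolding free_def by auto
    then show ?thesis by blast
  qed
qed

text \<open>Of the three edges at most one leads to one of the two colours, and this edge is usable: saturation in colour \<open>True\<close> is prevented at all
  neighbours, and saturation in colour \<open>False\<close> can only occur at the tight ones. To see that the lowered caps are good, consider a set \<open>T\<close> with
  \<open>i\<close> edges to \<open>v\<close>: adding \<open>v\<close> changes its potential by at most \<open>2 D - A - i D\<close>, so the more neighbours of \<open>v\<close> it contains,
  the larger its potential has to be.\<close>

lemma step_degree3:
  assumes B3: "3 \<le> B" and gap3: "\<And>T. T \<noteq> {} \<Longrightarrow> T \<subset> V \<Longrightarrow> int A + int B < pot k T"
    and d: "deg V v = 3" and k: "2 \<le> k True v" "2 \<le> k False v" and H: "card (tight k V v) \<le> 1 \<or> 4 \<le> B"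
  shows "step_ok k V (V - {v}) (nbs V v) (tight k V v)"
proof (rule step_single[OF v card fin])
  show "good (low k (nbs V v) (tight k V v)) (V - {v})"
  proof (rule good_low)
    fix T assume T: "T \<noteq> {}" "T \<subseteq> V - {v}"
    let ?i = "card (T \<inter> nbs V v)" and ?j = "card (T \<inter> tight k V v)"
    have fT: "finite T" using T fin finite_subset by blast
    have fH: "finite (tight k V v)" using fin unfolding tight_def nbs_def by simp
    have i: "?i \<le> cross E {v} T" by (rule card_nbs) (use T fT in auto)
    have i3: "cross E {v} T \<le> 3" unfolding d[symmetric] deg_def by (rule cross_mono) (use T in auto)
    have ji: "?j \<le> ?i" by (rule card_mono) (use fT in \<open>auto simp: tight_def\<close>)
    have jH: "?j \<le> card (tight k V v)" by (rule card_mono) (use fH in auto)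
    have jle: "?j \<le> 1 \<or> 4 \<le> B" using jH H by linarith
    have bdv: "k True v < B" "k False v < A" using bd v unfolding bounded_def by auto
    note wf = wt_full[where k = k and v = v, OF bdv]
    have pU: "pot k (T \<union> {v}) = pot k T + wt k v - D * int (cross E {v} T)"
      using pot_Un[OF fT, of "{v}"] T by (subst pot_Un[OF fT]) (auto simp: pot_single cross_commute)
    have Dc: "D * int n \<le> D * int m" if "n \<le> m" for n m
      using that D_ge AB' by (intro mult_left_mono) auto
    have gT: "int A + int B < pot k T" by (rule gap3) (use T v in auto)
    note Ds = D_ge3[OF B3]
    \<comment> \<open>If \<open>T\<close> and \<open>v\<close> exhaust \<open>V\<close>, nothing better than potential above \<open>- B\<close> is known, but then all three edges at \<open>v\<close> lead to \<open>T\<close>.\<close>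
    show "int A * int ?i + int B * int ?j - int B < pot k T"
    proof (cases "T \<union> {v} = V")
      case True
      then have "cross E {v} T = 3" using d unfolding deg_remove using T by (metis Diff_insert_absorb Un_insert_right insert_Diff_single sup_bot_right subset_Diff_insert)
      then have "- int B + D + int A < pot k T"
        using pU goodD[OF good, of V] v True wf by auto
      moreover have "int A * int ?i \<le> int A * 3" using i i3 by (intro mult_left_mono) auto
      moreover have "int B * int ?j \<le> D - 2 * int A"
      proof (cases "4 \<le> B")
        case True
        have "int B * int ?j \<le> int B * 3" using ji i i3 by (intro mult_left_mono) auto
        then show ?thesis using D_ge4[OF True] by linarith
      next
        case False
        then have "int B * int ?j \<le> int B * 1" using jle by (intro mult_left_mono) auto
        then show ?thesis using Ds by linarith
      qed
      ultimately show ?thesis by linarith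
    next
      case False
      have gU: "int A + int B < pot k (T \<union> {v})" by (rule gap3) (use T v False in auto)
      have ii: "?i = 0 \<or> ?i = 1 \<or> ?i = 2 \<or> ?i = 3" using i i3 by linarith
      have jj: "int B * int ?j \<le> int B * int ?i" using ji by (intro mult_left_mono) auto
      have "D * int ?i \<le> D * int (cross E {v} T)" by (rule Dc[OF i])
      then have "int A + int B - 2 * D + int A + D * int ?i < pot k T" using pU gU wf by linarith
      note u = this jj gT Ds AB'
      from ii show ?thesis
      proof (elim disjE)
        assume i: "?i = 0"
        show ?thesis using u unfolding i of_nat_0 mult_zero_right by linarith
      next
        assume i: "?i = 1"
        show ?thesis using u unfolding i of_nat_1 mult_1_right by linarith
      next
        assume i: "?i = 2"
        show ?thesis using u unfolding i of_nat_numeral by linarith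
      next
        assume i: "?i = 3"
        show ?thesis using u unfolding i of_nat_numeral by linarith
      qed
    qed
  qed (use fin in simp)
  fix c assume val: "valid E (low k (nbs V v) (tight k V v)) (V - {v}) c"
  have uT: "seen E c (V - {v}) True u + 1 < k True u" if "u \<in> nbs V v" "c u = True" for u
    by (rule unsat_nbs[OF val that(1) _ that(2)]) simp
  have uF: "seen E c (V - {v}) False u + 1 < k False u" if u: "u \<in> nbs V v" "c u = False" for u
  proof (cases "u \<in> tight k V v")
    case True
    have "u \<in> V - {v}" using u nbs_self[of v V] unfolding nbs_def by auto
    from unsat[OF val this] True u show ?thesis by auto
  next
    case False
    have uv: "u \<in> V" "u \<noteq> v" "0 < cross E {u} {v}" using u nbs_self[of v V] by (auto simp: nbs_def cross_commute)
    have "seen E c (V - {v}) False u + cross E {u} {v} = cross E {u} ({w\<in>V - {v}. c w = False} \<union> {v})"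
      unfolding seen_def by (rule cross_loopless_Un[OF loopless, symmetric]) auto
    also have "\<dots> \<le> deg V u" unfolding deg_def by (rule cross_mono) (use v in auto)
    also have "deg V u < k False u" using False u unfolding tight_def by auto
    finally show ?thesis using uv by simp
  qed
  consider "seen E c (V - {v}) False v = 0" | "seen E c (V - {v}) True v = 0"
    | "seen E c (V - {v}) False v = 1" | "seen E c (V - {v}) True v = 1" using seen_deg[of c] d by linarith
  then show "\<exists>b. free c V k v b"
  proof cases
    case 1
    then have "free c V k v False" using k unfolding free_def by simp
    then show ?thesis by blast
  next
    case 2
    then have "free c V k v True" using k unfolding free_def by simp
    then show ?thesis by blast
  next
    case 3
    then have "free c V k v False" using uF k unfolding free_def by auto
    then show ?thesis by blast
  next
    case 4
    then have "free c V k v True" using uT k unfolding free_def by auto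
    then show ?thesis by blast
  qed
qed

end

end

section \<open>Discharging\<close>

context params begin

text \<open>The situations in which \<open>step_degree1\<close>, \<open>step_degree2\<close> or \<open>step_degree3\<close> applies.\<close>

definition reducible :: "(bool \<Rightarrow> 'v \<Rightarrow> nat) \<Rightarrow> 'v set \<Rightarrow> 'v \<Rightarrow> bool" where
  "reducible k V v \<longleftrightarrow> deg V v \<le> 1 \<or> deg V v = 2 \<and> 1 \<le> k True v \<and> 2 \<le> k False v \<or>
     3 \<le> B \<and> deg V v = 3 \<and> 2 \<le> k True v \<and> 4 \<le> k False v \<and> (card (tight k V v) \<le> 1 \<or> 4 \<le> B)"

text \<open>Give each vertex the charge \<open>2 wt - D deg\<close>; the total charge is twice the potential of \<open>V\<close>, hence above \<open>- 2 B\<close>.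
  If no vertex is reducible, then the charges are so negative that the total is at most \<open>- 2 B\<close>. For \<open>B = 2\<close> and \<open>B \<ge> 4\<close> every vertex
  has charge at most \<open>- 2\<close> and \<open>- 2 B\<close>, respectively. For \<open>B = 3\<close> vertices of degree three in the set \<open>L\<close> may have a positive charge of up
  to \<open>A - 3\<close>. Each of them has at least two tight neighbours, in the set \<open>H\<close>, and sends half of \<open>A - 3\<close> to each;
  tight vertices are poor, and even after receiving this along every edge they keep a negative charge.\<close>

lemma exists_reducible:
  assumes fin: "finite V" and good: "good k V" and bd: "bounded k V" and card: "2 \<le> card V"
    and gap3: "\<And>T. 3 \<le> B \<Longrightarrow> T \<noteq> {} \<Longrightarrow> T \<subset> V \<Longrightarrow> int A + int B < pot k T"
  shows "\<exists>v\<in>V. reducible k V v"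
proof (rule ccontr)
  assume "\<not> ?thesis"
  then have irr: "\<And>v. v \<in> V \<Longrightarrow> \<not> reducible k V v" by blast
  define ch where "ch v = 2 * wt k v - D * int (deg V v)" for v
  have V0: "V \<noteq> {}" using card by auto
  have "int (\<Sum>v\<in>V. deg V v) = 2 * int (inside E V)"
    unfolding deg_def using handshake[OF loopless fin] by simp
  then have "(\<Sum>v\<in>V. ch v) = 2 * pot k V"
    unfolding ch_def sum_subtractf pot_def by (simp flip: sum_distrib_left)
  then have tot: "- 2 * int B < (\<Sum>v\<in>V. ch v)" using goodD[OF good V0] by simp
  have cp: "int A * int (k True v) \<le> D - (int A - int B)" "int B * int (k False v) \<le> D" if "v \<in> V" for v
    using cap1[of "k True v"] cap2[of "k False v"] bd that unfolding bounded_def by auto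
  have wf: "wt k v \<le> 2 * D - int A" if "v \<in> V" for v using cp[OF that] unfolding wt_def by linarith
  have small1: "int A * int (k True v) \<le> int A * int n" if "k True v \<le> n" for v n
    using that by (intro mult_left_mono) auto
  have small2: "int B * int (k False v) \<le> int B * int n" if "k False v \<le> n" for v n
    using that by (intro mult_left_mono) auto
  have dcases: "deg V v = 2 \<or> deg V v = 3 \<or> 4 \<le> deg V v" if "v \<in> V" for v
    using irr[OF that] unfolding reducible_def by linarith
  have ch4: "ch v \<le> - 2 * int A" if v: "v \<in> V" "4 \<le> deg V v" for v
  proof -
    have "D * 4 \<le> D * int (deg V v)" using v D_ge AB' by (intro mult_left_mono) auto
    then show ?thesis using wf[OF v(1)] unfolding ch_def by linarith
  qed
  have ch2: "ch v \<le> - 2 * int B" if v: "v \<in> V" "deg V v = 2" for v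
  proof -
    consider "k True v = 0" | "k False v \<le> 1" using irr[OF v(1)] v(2) unfolding reducible_def by linarith
    then have "wt k v \<le> D - int B"
    proof cases
      case 1
      then show ?thesis using cp[OF v(1)] unfolding wt_def by simp
    next
      case 2
      from small2[OF this] show ?thesis using cp(1)[OF v(1)] AB' unfolding wt_def of_nat_1 mult_1_right by linarith
    qed
    then show ?thesis unfolding ch_def v(2) by simp
  qed
  have ch3: "ch v \<le> - 2 * int B" if v: "v \<in> V" "deg V v = 3" "3 \<le> B" "k True v \<le> 1 \<or> k False v \<le> 3" for v
  proof -
    from v(4) have "2 * wt k v \<le> 3 * D - 2 * int B"
    proof
      assume "k True v \<le> 1"
      from small1[OF this] have "wt k v \<le> int A + D - int B" using cp(2)[OF v(1)]
        unfolding wt_def of_nat_1 mult_1_right by linarith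
      then show ?thesis using D_ge3[OF v(3)] AB' by linarith
    next
      assume "k False v \<le> 3"
      from small2[OF this] have "wt k v \<le> D - int A + 3 * int B" using cp(1)[OF v(1)]
        unfolding wt_def of_nat_numeral by linarith
      then show ?thesis using D_ge3[OF v(3)] AB' by linarith
    qed
    then show ?thesis unfolding ch_def v(2) by simp
  qed
  have sumle: "(\<Sum>v\<in>V. ch v) \<le> - x * int (card V)" if "\<And>v. v \<in> V \<Longrightarrow> ch v \<le> - x" for x
    using sum_bounded_above[of V ch "- x"] that by (simp add: mult.commute)
  consider "B = 2" | "B = 3" | "4 \<le> B" using B2 by linarith
  then show False
  proof cases
    case 1
    have "ch v \<le> - 2" if v: "v \<in> V" for v
      using dcases[OF v]
    proof (elim disjE)
      assume d: "deg V v = 3"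
      have "D = 2 * int A - 2" unfolding D_def by (simp add: 1)
      then show ?thesis using wf[OF v] unfolding ch_def d by simp
    qed (use ch2[OF v] ch4[OF v] AB' in linarith)+
    from sumle[OF this] have "(\<Sum>v\<in>V. ch v) \<le> - 2 * int (card V)" by simp
    moreover have "2 * 2 \<le> 2 * int (card V)" using card by simp
    ultimately show False using tot 1 by simp
  next
    case 3
    have "ch v \<le> - (2 * int B)" if v: "v \<in> V" for v
      using dcases[OF v]
    proof (elim disjE)
      assume d: "deg V v = 3"
      then show ?thesis using ch3[OF v d] irr[OF v] 3 unfolding reducible_def by fastforce
    qed (use ch2[OF v] ch4[OF v] AB' in linarith)+
    from sumle[OF this] have "(\<Sum>v\<in>V. ch v) \<le> - (2 * int B) * int (card V)" by simp
    moreover have "(2 * int B) * 1 \<le> (2 * int B) * int (card V)" using card by (intro mult_left_mono) auto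
    ultimately show False using tot by linarith
  next
    case 2
    define L where "L = {v\<in>V. deg V v = 3 \<and> 2 \<le> k True v \<and> 4 \<le> k False v}"
    define H where "H = {h\<in>V. k False h \<le> deg V h}"
    have DB: "D = 3 * int A - 3" unfolding D_def by (simp add: 2)
    have A6: "6 \<le> int A" using AB' 2 by simp
    have B3: "3 \<le> B" using 2 by simp
    have finLH: "finite L" "finite H" using fin unfolding L_def H_def by auto
    have LH: "L \<inter> H = {}" unfolding L_def H_def by auto
    have LV: "L \<subseteq> V" "H \<subseteq> V" unfolding L_def H_def by auto
    have out: "ch v \<le> - 6" if v: "v \<in> V" "v \<notin> L" for v
      using dcases[OF v(1)]
    proof (elim disjE)
      assume d: "deg V v = 3"
      then have "k True v \<le> 1 \<or> k False v \<le> 3" using v unfolding L_def by auto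
      from ch3[OF v(1) d B3 this] show ?thesis using 2 by simp
    qed (use ch2[OF v(1)] ch4[OF v(1)] A6 2 in linarith)+
    show False
    proof (cases "L = {}")
      case True
      then have "ch v \<le> - 6" if "v \<in> V" for v using out that by blast
      from sumle[OF this] have "(\<Sum>v\<in>V. ch v) \<le> - 6 * int (card V)" by simp
      then show False using tot 2 card by linarith
    next
      case False
      \<comment> \<open>Charges are doubled from here on, since half of \<open>s\<close> is sent along an edge.\<close>
      define s where "s = int A - 3"
      have s0: "3 \<le> s" using A6 unfolding s_def by simp
      have tight_sub_H: "tight k V v \<subseteq> H" for v unfolding tight_def H_def nbs_def by auto
      have two: "2 \<le> card (tight k V v)" if "v \<in> L" for v
        using irr[of v] that B3 2 unfolding L_def reducible_def by auto
      have H2: "2 \<le> card H"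
      proof -
        obtain v where "v \<in> L" using False by blast
        from two[OF this] card_mono[OF finLH(2) tight_sub_H, of v] show ?thesis by linarith
      qed
      have cL: "2 * ch v \<le> s * int (cross E {v} H)" if v: "v \<in> L" for v
      proof -
        have vV: "v \<in> V" "deg V v = 3" "v \<notin> H" using v LH unfolding L_def by auto
        have "tight k V v = H \<inter> nbs V v" unfolding tight_def H_def nbs_def by blast
        then have "2 \<le> cross E {v} H"
          using two[OF v] card_nbs[OF finLH(2) LV(2) vV(3)] by simp
        then have "s * 2 \<le> s * int (cross E {v} H)" using s0 by (intro mult_left_mono) auto
        moreover have "ch v \<le> s" using wf[OF vV(1)] unfolding ch_def vV(2) DB s_def by simp
        ultimately show ?thesis by linarith
      qed
      have "(\<Sum>v\<in>L. int (cross E {v} H)) = int (cross E H L)"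
        using cross_sum[OF finLH(1), of H E] LH by (simp add: Int_commute)
      also have "\<dots> = (\<Sum>h\<in>H. int (cross E {h} L))"
        using cross_sum[OF finLH(2), of L E] LH by (simp add: cross_commute)
      finally have dc: "(\<Sum>v\<in>L. s * int (cross E {v} H)) = (\<Sum>h\<in>H. s * int (cross E {h} L))"
        by (simp flip: sum_distrib_left)
      have "(\<Sum>v\<in>L. 2 * ch v) \<le> (\<Sum>v\<in>L. s * int (cross E {v} H))" by (rule sum_mono) (rule cL)
      then have SL: "(\<Sum>v\<in>L. 2 * ch v) \<le> (\<Sum>h\<in>H. s * int (cross E {h} L))" unfolding dc .
      have cH: "2 * ch h + s * int (cross E {h} L) \<le> - 6" if h: "h \<in> H" for h
      proof -
        have hV: "h \<in> V" and hk: "k False h \<le> deg V h" using h unfolding H_def by auto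
        have "cross E {h} L \<le> deg V h" unfolding deg_def by (rule cross_mono) (use LV in auto)
        then have "s * int (cross E {h} L) \<le> s * int (deg V h)" using s0 by (intro mult_left_mono) auto
        moreover have "2 * ch h + s * int (deg V h) \<le> - 6"
          using dcases[OF hV]
        proof (elim disjE)
          assume d: "deg V h = 2"
          have "{h} \<subset> V" using hV card by (metis card_1_singleton_iff insert_subset not_less_eq_eq numeral_2_eq_2 One_nat_def order_refl psubsetI empty_subsetI)
          then have g: "int A + int B < wt k h" using gap3[OF B3, of "{h}"] unfolding pot_single by simp
          have "k True h \<noteq> 0"
          proof
            assume "k True h = 0"
            moreover have "int B * int (k False h) \<le> int B * int 2" by (rule small2) (use hk d in simp)
            ultimately show False using g AB' unfolding wt_def by (simp only: of_nat_0 mult_zero_right of_nat_numeral)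
          qed
          then have "k False h \<le> 1" using irr[OF hV] d unfolding reducible_def by auto
          from small2[OF this] have "wt k h \<le> 2 * int A"
            using cp(1)[OF hV] 2 unfolding wt_def DB by simp
          then show ?thesis unfolding ch_def d DB s_def using A6 by simp
        next
          assume d: "deg V h = 3"
          have "int B * int (k False h) \<le> int B * int 3" by (rule small2) (use hk d in simp)
          then have "wt k h \<le> 2 * int A + 6" using cp(1)[OF hV] 2 unfolding wt_def DB by simp
          then show ?thesis unfolding ch_def d DB s_def using A6 by simp
        next
          assume d: "4 \<le> deg V h"
          define X where "X = (5 * int A - 3) * int (deg V h)"
          have "(5 * int A - 3) * 4 \<le> X" unfolding X_def using d A6 by (intro mult_left_mono) auto
          then have "20 * int A - 12 \<le> X" by simp
          moreover have "wt k h \<le> 5 * int A - 6" using wf[OF hV] unfolding DB by simp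
          moreover have "2 * ch h + s * int (deg V h) = 4 * wt k h - X"
            unfolding X_def ch_def DB s_def by (simp add: algebra_simps)
          ultimately show ?thesis by linarith
        qed
        ultimately show ?thesis by linarith
      qed
      have "(\<Sum>v\<in>V. 2 * ch v) = (\<Sum>v\<in>V - (L \<union> H). 2 * ch v) + (\<Sum>v\<in>L \<union> H. 2 * ch v)"
        by (rule sum.subset_diff) (use LV fin in auto)
      also have "(\<Sum>v\<in>L \<union> H. 2 * ch v) = (\<Sum>v\<in>L. 2 * ch v) + (\<Sum>v\<in>H. 2 * ch v)"
        by (rule sum.union_disjoint[OF finLH LH])
      finally have "(\<Sum>v\<in>V. 2 * ch v) = (\<Sum>v\<in>V - (L \<union> H). 2 * ch v) + (\<Sum>v\<in>L. 2 * ch v) + (\<Sum>v\<in>H. 2 * ch v)"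
        by simp
      moreover have "(\<Sum>v\<in>V - (L \<union> H). 2 * ch v) \<le> 0"
      proof (rule sum_nonpos)
        fix v assume "v \<in> V - (L \<union> H)"
        then show "2 * ch v \<le> 0" using out[of v] by auto
      qed
      moreover have "(\<Sum>h\<in>H. 2 * ch h) + (\<Sum>h\<in>H. s * int (cross E {h} L)) \<le> - 6 * int (card H)"
        unfolding sum.distrib[symmetric] using sum_bounded_above[of H "\<lambda>h. 2 * ch h + s * int (cross E {h} L)" "- 6"] cH
        by simp
      ultimately have "(\<Sum>v\<in>V. 2 * ch v) \<le> - 12" using SL H2 by linarith
      then have "2 * (\<Sum>v\<in>V. ch v) \<le> - 12" by (simp add: sum_distrib_left)
      then show False using tot 2 by simp
    qed
  qed
qed

end

section \<open>Local search for sets of minimum potential\<close>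

text \<open>A token for an edge is a pair of its ends, the first of which owns it.\<close>

definition load :: "('v \<times> 'v) list \<Rightarrow> 'v \<Rightarrow> nat" where
  "load tk v = length (filter (\<lambda>t. fst t = v) tk)"

text \<open>Each vertex should own \<open>K\<close> times its weight; the move of \<open>t\<close> to its other end pays if the excess of the owner
  is larger by at least two. The inequality is written without subtraction.\<close>

definition improves :: "nat \<Rightarrow> ('v \<Rightarrow> nat) \<Rightarrow> ('v \<times> 'v) list \<Rightarrow> 'v \<times> 'v \<Rightarrow> bool" where
  "improves K w tk t \<longleftrightarrow> load tk (snd t) + K * w (fst t) + 2 \<le> load tk (fst t) + K * w (snd t)"

text \<open>Moves the last improving token in the list, if there is one; the flag records that the move has been made. As \<open>foldr\<close>
  visits the list from its end, the tokens to the left are copied afterwards.\<close>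

definition flip :: "nat \<Rightarrow> ('v \<Rightarrow> nat) \<Rightarrow> ('v \<times> 'v) list \<Rightarrow> ('v \<times> 'v) list" where
  "flip K w tk = snd (foldr (\<lambda>t s. if \<not> fst s \<and> improves K w tk t then (True, (snd t, fst t) # snd s)
     else (fst s, t # snd s)) tk (False, []))"

lemma flip_cases:
  "(\<forall>t\<in>set tk. \<not> improves K w tk t) \<and> flip K w tk = tk \<or>
   (\<exists>us a b vs. tk = us @ (a, b) # vs \<and> improves K w tk (a, b) \<and> flip K w tk = us @ (b, a) # vs)"
proof -
  let ?g = "\<lambda>P t s. if \<not> fst s \<and> P t then (True, (snd t, fst t) # snd s) else (fst s, t # snd s)"
  have "(\<forall>t\<in>set xs. \<not> P t) \<and> foldr (?g P) xs (False, []) = (False, xs) \<or>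
   (\<exists>us a b vs. xs = us @ (a, b) # vs \<and> P (a, b) \<and> foldr (?g P) xs (False, []) = (True, us @ (b, a) # vs))" for xs P
  proof (induction xs)
    case (Cons x xs)
    from Cons.IH show ?case
    proof (elim disjE exE conjE)
      assume 1: "\<forall>t\<in>set xs. \<not> P t" "foldr (?g P) xs (False, []) = (False, xs)"
      show ?thesis
      proof (cases "P x")
        case True
        have "x # xs = [] @ (fst x, snd x) # xs" by simp
        moreover have "foldr (?g P) (x # xs) (False, []) = (True, [] @ (snd x, fst x) # xs)" using 1 True by simp
        ultimately show ?thesis using True by (metis prod.collapse)
      next
        case False
        then show ?thesis using 1 by simp
      qed
    next
      fix us a b vs
      assume 2: "xs = us @ (a, b) # vs" "P (a, b)" "foldr (?g P) xs (False, []) = (True, us @ (b, a) # vs)"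
      have "x # xs = (x # us) @ (a, b) # vs" using 2(1) by simp
      moreover have "foldr (?g P) (x # xs) (False, []) = (True, (x # us) @ (b, a) # vs)" using 2(3) by simp
      ultimately show ?thesis using 2(2) by blast
    qed
  qed simp
  from this[of tk "improves K w tk"] show ?thesis unfolding flip_def by fastforce
qed

lemma inside_flip: "inside (flip K w tk) S = inside tk S"
  using flip_cases[of tk K w] by (elim disjE exE conjE) (auto simp: inside_def)

lemma ends_flip: "(\<And>t. t \<in> set tk \<Longrightarrow> fst t \<in> V \<and> snd t \<in> V) \<Longrightarrow> t \<in> set (flip K w tk) \<Longrightarrow> fst t \<in> V \<and> snd t \<in> V"
proof -
  assume V: "\<And>t. t \<in> set tk \<Longrightarrow> fst t \<in> V \<and> snd t \<in> V" and t: "t \<in> set (flip K w tk)"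
  from flip_cases[of tk K w] have "t \<in> set tk \<or> (snd t, fst t) \<in> set tk"
  proof (elim disjE exE conjE)
    assume "flip K w tk = tk"
    then show ?thesis using t by simp
  next
    fix us a b vs assume "tk = us @ (a, b) # vs" "flip K w tk = us @ (b, a) # vs"
    then show ?thesis using t by auto
  qed
  then show ?thesis using V[of t] V[of "(snd t, fst t)"] by auto
qed

lemma sum_load:
  assumes "finite S"
  shows "(\<Sum>v\<in>S. load tk v) = length (filter (\<lambda>t. fst t \<in> S) tk)"
proof (induction tk)
  case Nil
  then show ?case by (simp add: load_def)
next
  case (Cons t tk)
  have "load (t # tk) v = load tk v + (if v = fst t then 1 else 0)" for v by (auto simp: load_def)
  then have "(\<Sum>v\<in>S. load (t # tk) v) = (\<Sum>v\<in>S. load tk v) + (\<Sum>v\<in>S. if v = fst t then 1 else 0)"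
    by (simp add: sum.distrib)
  also have "(\<Sum>v\<in>S. if v = fst t then 1 else (0::nat)) = (if fst t \<in> S then 1 else 0)"
    using assms by (simp add: sum.delta)
  finally show ?case using Cons by simp
qed

definition exc :: "nat \<Rightarrow> ('v \<Rightarrow> nat) \<Rightarrow> ('v \<times> 'v) list \<Rightarrow> 'v \<Rightarrow> int" where
  "exc K w tk v = int (load tk v) - int K * int (w v)"

lemma improves_exc: "improves K w tk (a, b) \<longleftrightarrow> exc K w tk b + 2 \<le> exc K w tk a"
proof -
  have "improves K w tk (a, b) \<longleftrightarrow> int (load tk b + K * w a + 2) \<le> int (load tk a + K * w b)"
    unfolding improves_def by (simp only: of_nat_le_iff fst_conv snd_conv)
  then show ?thesis unfolding exc_def by (simp add: algebra_simps)
qed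

definition energy :: "'v set \<Rightarrow> nat \<Rightarrow> ('v \<Rightarrow> nat) \<Rightarrow> ('v \<times> 'v) list \<Rightarrow> int" where
  "energy V K w tk = (\<Sum>v\<in>V. (exc K w tk v)\<^sup>2)"

text \<open>Replacing \<open>x\<^sup>2 + y\<^sup>2\<close> by \<open>(x - 1)\<^sup>2 + (y + 1)\<^sup>2\<close> decreases the sum if \<open>y + 2 \<le> x\<close>.\<close>

lemma energy_flip:
  assumes fin: "finite V" and ends: "\<And>t. t \<in> set tk \<Longrightarrow> fst t \<in> V \<and> snd t \<in> V"
    and ex: "\<exists>t\<in>set tk. improves K w tk t"
  shows "energy V K w (flip K w tk) < energy V K w tk"
proof -
  obtain us a b vs where t: "tk = us @ (a, b) # vs" "improves K w tk (a, b)" "flip K w tk = us @ (b, a) # vs"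
    using flip_cases[of tk K w] ex by blast
  have ab: "exc K w tk b + 2 \<le> exc K w tk a" using t(2) unfolding improves_exc .
  have ne: "a \<noteq> b" using ab by auto
  have V: "a \<in> V" "b \<in> V" using ends[of "(a, b)"] t(1) by auto
  have la: "exc K w (flip K w tk) a = exc K w tk a - 1" and lb: "exc K w (flip K w tk) b = exc K w tk b + 1"
    and lo: "\<And>v. v \<noteq> a \<Longrightarrow> v \<noteq> b \<Longrightarrow> exc K w (flip K w tk) v = exc K w tk v"
    using ne unfolding t(3) unfolding exc_def load_def t(1) by auto
  have sp: "energy V K w tk' = (exc K w tk' a)\<^sup>2 + ((exc K w tk' b)\<^sup>2 + (\<Sum>v\<in>V - {a} - {b}. (exc K w tk' v)\<^sup>2))" for tk'
    unfolding energy_def using fin V ne by (simp add: sum.remove[of V a] sum.remove[of "V - {a}" b])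
  have "(\<Sum>v\<in>V - {a} - {b}. (exc K w (flip K w tk) v)\<^sup>2) = (\<Sum>v\<in>V - {a} - {b}. (exc K w tk v)\<^sup>2)"
    by (rule sum.cong) (auto simp: lo)
  then show ?thesis unfolding sp la lb using ab by (simp add: power2_eq_square algebra_simps)
qed

lemma energy_nonneg: "0 \<le> energy V K w tk" unfolding energy_def by (intro sum_nonneg) simp

lemma flip_terminates:
  assumes fin: "finite V" and ends: "\<And>t. t \<in> set tk \<Longrightarrow> fst t \<in> V \<and> snd t \<in> V"
    and N: "energy V K w tk \<le> int N"
  shows "\<forall>t\<in>set ((flip K w ^^ N) tk). \<not> improves K w ((flip K w ^^ N) tk) t"
  using ends N
proof (induction N arbitrary: tk)
  case 0
  show ?case
  proof (rule ccontr)
    assume "\<not> ?thesis"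
    then have "\<exists>t\<in>set tk. improves K w tk t" by simp
    from energy_flip[OF fin 0(1) this] energy_nonneg[of V K w "flip K w tk"] 0(2) show False by simp
  qed
next
  case (Suc N)
  have eq: "(flip K w ^^ Suc N) tk = (flip K w ^^ N) (flip K w tk)" by (simp only: funpow_Suc_right o_apply)
  show ?case
  proof (cases "\<exists>t\<in>set tk. improves K w tk t")
    case True
    have en: "energy V K w (flip K w tk) \<le> int N"
      using energy_flip[OF fin Suc.prems(1) True] Suc.prems(2) by simp
    show ?thesis unfolding eq by (rule Suc.IH[OF ends_flip[OF Suc.prems(1)] en])
  next
    case False
    then have "flip K w tk = tk" using flip_cases[of tk K w] by fastforce
    then have "(flip K w ^^ Suc N) tk = tk" by (induction N) auto
    then show ?thesis using False by simp
  qed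
qed

text \<open>Some value \<open>t0\<close> among \<open>0, \<dots>, card V\<close> is not the excess of a vertex. In a stable distribution all tokens owned in the set
  \<open>L\<close> of vertices of excess above \<open>t0\<close> belong to edges inside \<open>L\<close>, so that \<open>K\<close> times the potential of \<open>L\<close> equals minus its
  total excess. For any other set \<open>K\<close> times the potential is at least minus the total excess, and this total exceeds that of \<open>L\<close> by at most \<open>t0 \<le> card V\<close> for
  each vertex outside \<open>L\<close>. The error is less than \<open>K\<close>, so \<open>L\<close> is an exact minimizer.\<close>

lemma stable_level_set:
  fixes D :: int and K :: nat and w :: "'v \<Rightarrow> nat"
  assumes fin: "finite V" and ends: "\<And>t. t \<in> set tk \<Longrightarrow> fst t \<in> V \<and> snd t \<in> V"
    and ins: "\<And>S. S \<subseteq> V \<Longrightarrow> int (inside tk S) = int K * (D * int (inside E S))"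
    and stable: "\<And>t. t \<in> set tk \<Longrightarrow> \<not> improves K w tk t"
    and K: "card V * card V < K"
  defines "\<rho> \<equiv> \<lambda>S. (\<Sum>v\<in>S. int (w v)) - D * int (inside E S)"
  shows "\<exists>L\<subseteq>V. (L = {} \<or> (\<exists>y\<in>L. L = {v\<in>V. exc K w tk y \<le> exc K w tk v})) \<and> (\<forall>S\<subseteq>V. \<rho> L \<le> \<rho> S)"
proof -
  let ?e = "exc K w tk"
  have "\<not> {0..int (card V)} \<subseteq> ?e ` V"
  proof
    assume "{0..int (card V)} \<subseteq> ?e ` V"
    then have "card {0..int (card V)} \<le> card (?e ` V)" by (rule card_mono[rotated]) (use fin in simp)
    also have "\<dots> \<le> card V" by (rule card_image_le[OF fin])
    finally show False by simp
  qed
  \<comment> \<open>There are more values than vertices.\<close>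
  then obtain t0 where t0: "0 \<le> t0" "t0 \<le> int (card V)" "t0 \<notin> ?e ` V" by (meson atLeastAtMost_iff subsetI)
  define L where "L = {v\<in>V. t0 < ?e v}"
  have LV: "L \<subseteq> V" unfolding L_def by blast
  have finL: "finite L" using LV fin finite_subset by blast
  have pot: "int K * \<rho> S = (\<Sum>v\<in>S. int K * int (w v)) - int (inside tk S)" if "S \<subseteq> V" for S
    unfolding \<rho>_def ins[OF that] by (simp add: right_diff_distrib sum_distrib_left)
  have out: "fst t \<in> L \<Longrightarrow> snd t \<in> L" if t: "t \<in> set tk" for t
  proof -
    assume "fst t \<in> L"
    then have "t0 < ?e (fst t)" unfolding L_def by simp
    moreover have "\<not> ?e (snd t) + 2 \<le> ?e (fst t)" using stable[OF t] improves_exc[of K w tk "fst t" "snd t"] by simp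
    ultimately have "t0 \<le> ?e (snd t)" by linarith
    moreover have "?e (snd t) \<noteq> t0" using t0(3) ends[OF t] by auto
    ultimately show "snd t \<in> L" using ends[OF t] unfolding L_def by auto
  qed
  have "filter (\<lambda>t. fst t \<in> L) tk = filter (\<lambda>t. fst t \<in> L \<and> snd t \<in> L) tk"
    by (rule filter_cong) (use out in auto)
  then have inL: "inside tk L = (\<Sum>v\<in>L. load tk v)" unfolding inside_def sum_load[OF finL] by simp
  have potL: "int K * \<rho> L = - (\<Sum>v\<in>L. ?e v)"
    unfolding pot[OF LV] inL exc_def by (simp add: sum_subtractf)
  have main: "\<rho> L \<le> \<rho> S" if S: "S \<subseteq> V" for S
  proof -
    have finS: "finite S" using S fin finite_subset by blast
    have "inside tk S \<le> (\<Sum>v\<in>S. load tk v)" unfolding inside_def sum_load[OF finS] by (rule length_filter_mono) simp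
    then have "int (inside tk S) \<le> (\<Sum>v\<in>S. int (load tk v))" by (simp flip: of_nat_sum)
    then have 1: "- (\<Sum>v\<in>S. ?e v) \<le> int K * \<rho> S" unfolding pot[OF S] exc_def by (simp add: sum_subtractf)
    have "(\<Sum>v\<in>S. ?e v) \<le> (\<Sum>v\<in>S. if v \<in> L then ?e v else int (card V))"
    proof (rule sum_mono)
      fix v assume "v \<in> S"
      then show "?e v \<le> (if v \<in> L then ?e v else int (card V))" using S t0 unfolding L_def by auto
    qed
    also have "\<dots> \<le> (\<Sum>v\<in>V. if v \<in> L then ?e v else int (card V))"
      by (rule sum_mono2[OF fin S]) (use t0 in \<open>auto simp: L_def\<close>)
    also have "\<dots> = (\<Sum>v\<in>V \<inter> L. ?e v) + (\<Sum>v\<in>V \<inter> - L. int (card V))"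
      by (rule sum.If_cases[OF fin, of "\<lambda>v. v \<in> L", unfolded Collect_mem_eq Collect_neg_eq])
    also have "V \<inter> L = L" using LV by blast
    also have "(\<Sum>v\<in>V \<inter> - L. int (card V)) \<le> int (card V * card V)"
    proof -
      have "card (V \<inter> - L) \<le> card V" by (rule card_mono[OF fin]) blast
      then have "card (V \<inter> - L) * card V \<le> card V * card V" by (rule mult_le_mono1)
      then show ?thesis by (simp flip: of_nat_mult)
    qed
    finally have "(\<Sum>v\<in>S. ?e v) \<le> (\<Sum>v\<in>L. ?e v) + int (card V * card V)" by simp
    then have le: "int K * \<rho> L - int (card V * card V) \<le> int K * \<rho> S" using 1 potL by linarith
    show ?thesis
    proof (rule ccontr)
      assume "\<not> ?thesis"
      then have "\<rho> S + 1 \<le> \<rho> L" by simp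
      then have "int K * (\<rho> S + 1) \<le> int K * \<rho> L" by (intro mult_left_mono) auto
      then have "int K * \<rho> S + int K \<le> int K * \<rho> L" by (simp add: algebra_simps)
      moreover have "int (card V * card V) < int K" using K by (simp only: of_nat_less_iff)
      ultimately show False using le by linarith
    qed
  qed
  have "L = {} \<or> (\<exists>y\<in>L. L = {v\<in>V. ?e y \<le> ?e v})"
  proof (cases "L = {}")
    case False
    have "\<exists>y\<in>L. \<forall>z\<in>L. ?e y \<le> ?e z"
    proof -
      obtain y where "y \<in> L" "?e y = Min (?e ` L)"
        using Min_in[of "?e ` L"] finL False by fastforce
      moreover have "Min (?e ` L) \<le> ?e z" if "z \<in> L" for z using that finL by simp
      ultimately show ?thesis by metis
    qed
    then obtain y where y: "y \<in> L" "\<forall>z\<in>L. ?e y \<le> ?e z" by blast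
    have "L = {v\<in>V. ?e y \<le> ?e v}"
    proof (intro set_eqI iffI)
      fix v assume "v \<in> L" then show "v \<in> {v\<in>V. ?e y \<le> ?e v}" using y LV by auto
    next
      fix v assume "v \<in> {v\<in>V. ?e y \<le> ?e v}" then show "v \<in> L" using y(1) unfolding L_def by auto
    qed
    then show ?thesis using y by blast
  qed simp
  then show ?thesis using LV main by blast
qed

section \<open>The colouring algorithm\<close>

text \<open>The caps of the algorithm are stored as two lists in which each vertex is repeated as often as its cap says.\<close>

definition cap_of :: "'v list \<Rightarrow> 'v list \<Rightarrow> bool \<Rightarrow> 'v \<Rightarrow> nat" where
  "cap_of P Q b v = length (filter (\<lambda>u. u = v) (if b then P else Q))"

definition tab :: "'v list \<Rightarrow> ('v \<Rightarrow> nat) \<Rightarrow> 'v list" where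
  "tab V f = concat (map (\<lambda>v. replicate (f v) v) V)"

lemma filter_tab:
  "distinct V \<Longrightarrow> length (filter (\<lambda>u. u = v) (tab V f)) = (if v \<in> set V then f v else 0)"
proof (induction V)
  case (Cons a V)
  have "length (filter (\<lambda>u. u = v) (tab (a # V) f)) = (if a = v then f a else 0) + length (filter (\<lambda>u. u = v) (tab V f))"
    by (simp add: tab_def)
  then show ?case using Cons by auto
qed (simp add: tab_def)

lemma set_tab: "set (tab V f) \<subseteq> set V"
  unfolding tab_def by auto

lemma length_tab: "length (tab V f) = (\<Sum>v\<leftarrow>V. f v)"
  unfolding tab_def by (induction V) auto

lemma cap_of_tab: "distinct V \<Longrightarrow> v \<in> set V \<Longrightarrow> cap_of (tab V f) (tab V g) b v = (if b then f v else g v)"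
  unfolding cap_of_def by (simp add: filter_tab)

definition pick :: "('a \<Rightarrow> 'a \<Rightarrow> bool) \<Rightarrow> 'a list \<Rightarrow> 'a \<Rightarrow> 'a" where
  "pick bt xs d = fold (\<lambda>y b. if bt y b then y else b) xs d"

lemma pick_in: "pick bt xs d \<in> set (d # xs)"
proof (induction xs arbitrary: d)
  case (Cons x xs)
  show ?case using Cons[of "if bt x d then x else d"] by (auto simp: pick_def split: if_splits)
qed (simp add: pick_def)

lemma pick_min: "y \<in> set (d # xs) \<Longrightarrow> f (pick (\<lambda>y b. f y < f b) xs d) \<le> (f y :: nat)"
proof (induction xs arbitrary: d y)
  case (Cons x xs)
  let ?e = "if f x < f d then x else d"
  have p: "pick (\<lambda>y b. f y < f b) (x # xs) d = pick (\<lambda>y b. f y < f b) xs ?e" by (simp add: pick_def)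
  have "f (pick (\<lambda>y b. f y < f b) xs ?e) \<le> f ?e" by (rule Cons.IH) simp
  moreover have "f ?e \<le> f x" "f ?e \<le> f d" by auto
  moreover have "f (pick (\<lambda>y b. f y < f b) xs ?e) \<le> f y" if "y \<in> set xs" by (rule Cons.IH) (use that in simp)
  ultimately show ?case using Cons.prems unfolding p by auto
qed (simp add: pick_def)

lemma pick_max: "y \<in> set (d # xs) \<Longrightarrow> (f y :: nat) \<le> f (pick (\<lambda>y b. f b < f y) xs d)"
proof (induction xs arbitrary: d y)
  case (Cons x xs)
  let ?e = "if f d < f x then x else d"
  have p: "pick (\<lambda>y b. f b < f y) (x # xs) d = pick (\<lambda>y b. f b < f y) xs ?e" by (simp add: pick_def)
  have "f ?e \<le> f (pick (\<lambda>y b. f b < f y) xs ?e)" by (rule Cons.IH) simp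
  moreover have "f x \<le> f ?e" "f d \<le> f ?e" by auto
  moreover have "f y \<le> f (pick (\<lambda>y b. f b < f y) xs ?e)" if "y \<in> set xs" by (rule Cons.IH) (use that in simp)
  ultimately show ?case using Cons.prems unfolding p by auto
qed (simp add: pick_def)

definition tokens :: "('v \<times> 'v) list \<Rightarrow> 'v list \<Rightarrow> nat \<Rightarrow> ('v \<times> 'v) list" where
  "tokens E V m = concat (map (\<lambda>e. if fst e \<in> set V \<and> snd e \<in> set V then replicate m e else []) E)"

text \<open>For good caps these are the weights of the vertices, except that the root \<open>r\<close> is free of charge and hence may be added to any set.\<close>

definition root_weight :: "nat \<Rightarrow> nat \<Rightarrow> 'v list \<Rightarrow> 'v list \<Rightarrow> 'v \<Rightarrow> 'v \<Rightarrow> nat" where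
  "root_weight A B P Q r v = (if v = r then 0 else A * cap_of P Q True v + B * cap_of P Q False v - B)"

text \<open>The number of iterations bounds the initial energy; each vertex has excess at most \<open>M\<close> in absolute value.\<close>

definition balanced where
  "balanced A B E P Q r V K = (let tk = tokens E V (K * (B * (A - 1))); M = length tk + K * (A * length P + B * length Q)
     in (flip K (root_weight A B P Q r) ^^ (length V * (M * M))) tk)"

text \<open>The sets that contain the root \<open>r\<close>, avoid \<open>x\<close>, and otherwise consist of the vertices with at least a given excess.
  Ranging over all \<open>r\<close> and \<open>x\<close> makes sure that the minimizer is nonempty and proper.\<close>

definition levels where
  "levels A B E V P Q r x = (let K = length V * length V + 1; W = filter (\<lambda>v. v \<noteq> x) V; tk = balanced A B E P Q r W K
     in filter (\<lambda>v. v = r) V # map (\<lambda>y. filter (\<lambda>v. v = r \<or> v \<noteq> x \<and>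
        load tk y + K * root_weight A B P Q r v \<le> load tk v + K * root_weight A B P Q r y) V) W)"

text \<open>The potential of \<open>S\<close>, shifted by a constant in order to be a natural number.\<close>

definition shifted_pot where
  "shifted_pot A B E V P Q S = A * length (filter (\<lambda>v. v \<in> set S) P) + B * length (filter (\<lambda>v. v \<in> set S) Q)
     + B * (A - 1) * (length E - inside E (set S)) + B * (length V - length S)"

definition minset where
  "minset A B E V P Q = pick (\<lambda>S T. shifted_pot A B E V P Q S < shifted_pot A B E V P Q T)
     (concat (map (\<lambda>r. concat (map (\<lambda>x. if r = x then [] else levels A B E V P Q r x) V)) V))
     (case V of [] \<Rightarrow> [] | v # _ \<Rightarrow> [v])"

definition nbs_list where
  "nbs_list E V v = filter (\<lambda>u. 0 < cross E {v} {u}) V"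

definition tight_list where
  "tight_list E V P Q v = filter (\<lambda>h. cap_of P Q False h \<le> cross E {h} (set V)) (nbs_list E V v)"

definition reducible_test where
  "reducible_test B E V P Q v \<longleftrightarrow> cross E {v} (set V) \<le> 1 \<or>
     cross E {v} (set V) = 2 \<and> 1 \<le> cap_of P Q True v \<and> 2 \<le> cap_of P Q False v \<or>
     3 \<le> B \<and> cross E {v} (set V) = 3 \<and> 2 \<le> cap_of P Q True v \<and> 4 \<le> cap_of P Q False v \<and>
       (length (tight_list E V P Q v) \<le> 1 \<or> 4 \<le> B)"

text \<open>The value in the case without reducible vertices is arbitrary: by \<open>exists_reducible\<close> it is never returned when this step is taken.\<close>

definition vertex_step where
  "vertex_step B E V P Q = (case filter (reducible_test B E V P Q) V of [] \<Rightarrow> (V, [], []) | v # _ \<Rightarrow>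
     (filter (\<lambda>u. u \<noteq> v) V,
      if cross E {v} (set V) \<le> 1 then (if cap_of P Q False v = 0 then (nbs_list E V v, []) else ([], nbs_list E V v))
      else if cross E {v} (set V) = 2 then ([], nbs_list E V v) else (nbs_list E V v, tight_list E V P Q v)))"

text \<open>The edges between \<open>S\<close> and \<open>X\<close>, directed from \<open>S\<close> to \<open>X\<close>.\<close>

definition cut_edges where
  "cut_edges E S X = concat (map (\<lambda>e. if fst e \<in> set S \<and> snd e \<in> set X then [e]
     else if snd e \<in> set S \<and> fst e \<in> set X then [(snd e, fst e)] else []) E)"

text \<open>The step that fits the potential of a set of minimum potential: the set to be coloured first and the vertices at which
  the caps for the colours \<open>True\<close> and \<open>False\<close> are lowered. The number \<open>Z\<close> represents potential \<open>0\<close>.\<close>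

definition plan where
  "plan A B E V P Q = (let S = minset A B E V P Q; X = filter (\<lambda>v. v \<notin> set S) V;
       m = shifted_pot A B E V P Q S; Z = B * (A - 1) * length E + B * length V in
     case cut_edges E S X of [] \<Rightarrow> (S, [], []) | e # es \<Rightarrow>
       if m \<le> Z then (S, [], [])
       else if m \<le> Z + (A - B) then (S, [], [fst e])
       else if B = 2 then vertex_step B E V P Q
       else if m \<le> Z + A then (case es of [] \<Rightarrow> (X, [snd e], [snd e]) | e' # _ \<Rightarrow> (S, [], [fst e, fst e']))
       else if m \<le> Z + A + B then (S, [fst e], [fst e])
       else vertex_step B E V P Q)"

definition lowered where
  "lowered V P us = tab V (\<lambda>v. length (filter (\<lambda>u. u = v) P) - (if v \<in> set us then 1 else 0))"

definition cap_lists where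
  "cap_lists X f = (tab X (f True), tab X (f False))"

text \<open>The continuation of maximum weight for the complement \<open>X\<close> after \<open>S\<close> has been coloured, where \<open>C\<close> lists the vertices of colour \<open>True\<close>.\<close>

definition best_caps where
  "best_caps A B E P Q S X C = pick (\<lambda>y b. A * length (fst b) + B * length (snd b) < A * length (fst y) + B * length (snd y))
     (concat (map (\<lambda>u. concat (map (\<lambda>y. if usable E (\<lambda>v. v \<in> set C) (set S) (cap_of P Q) u y
          then [cap_lists X (use E (\<lambda>v. v \<in> set C) (set S) (cap_of P Q) u y)] else []) X)) S))
     (cap_lists X (ban E (\<lambda>v. v \<in> set C) (set S) (cap_of P Q)))"

text \<open>The recursion is unfolded into a stack of tasks. A task without flag asks for a colouring of its vertices under its caps; a
  task with flag belongs to a vertex set whose part \<open>S\<close> has been coloured in the meantime. The vertices of colour \<open>True\<close> are accumulated.\<close>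

type_synonym 'v task = "bool \<times> 'v list \<times> 'v list \<times> 'v list"

definition step :: "nat \<Rightarrow> nat \<Rightarrow> ('v \<times> 'v) list \<Rightarrow> 'v task list \<times> 'v list \<Rightarrow> 'v task list \<times> 'v list" where
  "step A B E st = (case fst st of [] \<Rightarrow> st | t # rest \<Rightarrow>
     let V = fst (snd t); P = fst (snd (snd t)); Q = snd (snd (snd t)); pl = plan A B E V P Q; S = fst pl in
     if fst t then
       let X = filter (\<lambda>v. v \<notin> set S) V in ((False, X, best_caps A B E P Q S X (snd st)) # rest, snd st)
     else case V of [] \<Rightarrow> (rest, snd st) | v # vs \<Rightarrow>
       if vs = [] then (rest, if v \<in> set P then v # snd st else snd st)
       else ((False, S, lowered S P (fst (snd pl)), lowered S Q (snd (snd pl))) # (True, V, P, Q) # rest, snd st))"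

text \<open>Every task with \<open>n\<close> vertices is finished after at most \<open>3 n - 2\<close> steps.\<close>

definition solve where
  "solve A B E V = snd ((step A B E ^^ (3 * length V)) ([(False, V, tab V (\<lambda>_. B - 1), tab V (\<lambda>_. A - 1))], []))"

lemma length_filter_set:
  assumes "finite S"
  shows "length (filter (\<lambda>v. v \<in> S) P) = (\<Sum>v\<in>S. length (filter (\<lambda>u. u = v) P))"
proof (induction P)
  case (Cons a P)
  have "(\<Sum>v\<in>S. length (filter (\<lambda>u. u = v) (a # P))) = (\<Sum>v\<in>S. length (filter (\<lambda>u. u = v) P) + (if v = a then 1 else 0))"
    by (rule sum.cong) auto
  also have "\<dots> = (\<Sum>v\<in>S. length (filter (\<lambda>u. u = v) P)) + (if a \<in> S then 1 else 0)"
    using assms by (simp add: sum.distrib sum.delta)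
  finally show ?case using Cons by auto
qed simp

lemma inside_tokens:
  assumes "S \<subseteq> set V"
  shows "inside (tokens E V m) S = m * inside E S"
  using assms by (induction E) (auto simp: inside_def tokens_def)

lemma ends_tokens: "t \<in> set (tokens E V m) \<Longrightarrow> fst t \<in> set V \<and> snd t \<in> set V"
  unfolding tokens_def by (auto split: if_splits)

lemma inside_le: "inside E S \<le> length E" unfolding inside_def by simp

lemma inside_mono: "S \<subseteq> T \<Longrightarrow> inside E S \<le> inside E T"
  unfolding inside_def by (rule length_filter_mono) auto

context params begin

lemma D_nat: "D = int (B * (A - 1))"
  using AB B2 by (simp add: D_def of_nat_diff)

lemma D_pos: "0 \<le> D" using D_ge AB' by linarith

lemma shifted_pot_eq:
  assumes "distinct S" "set S \<subseteq> set V" "distinct V"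
  shows "int (shifted_pot A B E V P Q S) = pot (cap_of P Q) (set S) + int (B * (A - 1) * length E + B * length V)"
proof -
  have 1: "int (length E - inside E (set S)) = int (length E) - int (inside E (set S))"
    using inside_le[of E "set S"] by (simp add: of_nat_diff)
  have "length S = card (set S)" "length V = card (set V)" using assms by (simp_all add: distinct_card)
  then have "length S \<le> length V" using assms card_mono[of "set V" "set S"] by simp
  then have 2: "int (length V - length S) = int (length V) - int (length S)" by (simp add: of_nat_diff)
  have 3: "int (length S) = (\<Sum>v\<in>set S. 1)" using assms by (simp add: distinct_card)
  have "pot (cap_of P Q) (set S) = int A * (\<Sum>v\<in>set S. int (cap_of P Q True v)) + int B * (\<Sum>v\<in>set S. int (cap_of P Q False v))
      - int B * int (length S) - D * int (inside E (set S))"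
    unfolding pot_def wt_def 3 by (simp add: sum_subtractf sum.distrib sum_distrib_left)
  also have "(\<Sum>v\<in>set S. int (cap_of P Q True v)) = int (length (filter (\<lambda>v. v \<in> set S) P))"
    unfolding length_filter_set[OF finite_set] by (simp add: cap_of_def)
  also have "(\<Sum>v\<in>set S. int (cap_of P Q False v)) = int (length (filter (\<lambda>v. v \<in> set S) Q))"
    unfolding length_filter_set[OF finite_set] by (simp add: cap_of_def)
  finally show ?thesis
    unfolding shifted_pot_def of_nat_add of_nat_mult[of "B * (A - 1)" "length E - inside E (set S)"] of_nat_mult[of B "length V - length S"] 1 2
      of_nat_mult[of "B * (A - 1)" "length E"] of_nat_mult[of A] of_nat_mult[of B "length (filter _ _)"] of_nat_mult[of B "length V"]
      D_nat[symmetric]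
    by (simp add: algebra_simps)
qed

lemma wt_good: assumes "good k V" "v \<in> V" shows "0 \<le> wt k v" "wt k v = int (A * k True v + B * k False v - B)"
proof -
  have w: "- int B < wt k v" using goodD[OF assms(1), of "{v}"] assms(2) by (simp add: pot_single)
  have "B \<le> A * k True v + B * k False v"
  proof (cases "k True v = 0 \<and> k False v = 0")
    case True
    then show ?thesis using w unfolding wt_def by simp
  next
    case False
    then consider "1 \<le> k True v" | "1 \<le> k False v" by linarith
    then show ?thesis
    proof cases
      case 1
      then have "A * 1 \<le> A * k True v" by (rule mult_le_mono2)
      then show ?thesis using AB by linarith
    next
      case 2
      then have "B * 1 \<le> B * k False v" by (rule mult_le_mono2)
      then show ?thesis by linarith
    qed
  qed
  then show eq: "wt k v = int (A * k True v + B * k False v - B)" unfolding wt_def by (simp add: of_nat_diff)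
  then show "0 \<le> wt k v" by simp
qed

lemma root_weight_le: "root_weight A B P Q r v \<le> A * length P + B * length Q"
proof -
  have "A * cap_of P Q True v \<le> A * length P" "B * cap_of P Q False v \<le> B * length Q"
    unfolding cap_of_def by (intro mult_le_mono2; simp)+
  then have "A * cap_of P Q True v + B * cap_of P Q False v - B \<le> A * length P + B * length Q" by linarith
  then show ?thesis unfolding root_weight_def by (cases "v = r") (simp_all only: if_True if_False le0 refl)
qed

lemma balanced_level_set:
  fixes P Q :: "'v list" and r :: 'v
  assumes W: "distinct W" and K: "length W * length W < K"
  defines "w \<equiv> root_weight A B P Q r" and "tk \<equiv> balanced A B E P Q r W K"
  shows "\<exists>L\<subseteq>set W. (L = {} \<or> (\<exists>y\<in>L. L = {v\<in>set W. load tk y + K * w v \<le> load tk v + K * w y})) \<and>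
    (\<forall>S\<subseteq>set W. (\<Sum>v\<in>L. int (w v)) - D * int (inside E L) \<le> (\<Sum>v\<in>S. int (w v)) - D * int (inside E S))"
proof -
  let ?t0 = "tokens E W (K * (B * (A - 1)))"
  define M where "M = length ?t0 + K * (A * length P + B * length Q)"
  have tk: "tk = (flip K w ^^ (length W * (M * M))) ?t0"
    unfolding tk_def balanced_def Let_def M_def w_def ..
  have e0: "\<And>t. t \<in> set ?t0 \<Longrightarrow> fst t \<in> set W \<and> snd t \<in> set W" by (rule ends_tokens)
  have ends: "t \<in> set ((flip K w ^^ j) ?t0) \<Longrightarrow> fst t \<in> set W \<and> snd t \<in> set W" for j t
  proof (induction j arbitrary: t)
    case (Suc j)
    show ?case by (rule ends_flip[OF Suc.IH]) (use Suc.prems in simp_all)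
  qed (use e0 in simp)
  have ins: "inside ((flip K w ^^ j) ?t0) S = inside ?t0 S" for j S
    by (induction j) (auto simp: inside_flip)
  have "energy (set W) K w ?t0 \<le> int (length W * (M * M))"
  proof -
    have "(exc K w ?t0 v)\<^sup>2 \<le> int (M * M)" for v
    proof -
      have "load ?t0 v \<le> M" unfolding load_def M_def by (simp add: trans_le_add1)
      moreover have "K * w v \<le> M" unfolding M_def w_def using root_weight_le[of P Q r v] by (simp add: trans_le_add2)
      ultimately have "\<bar>exc K w ?t0 v\<bar> \<le> int M" unfolding exc_def by (simp flip: of_nat_mult)
      then have "\<bar>exc K w ?t0 v\<bar>\<^sup>2 \<le> (int M)\<^sup>2" by (intro power_mono) auto
      then show ?thesis by (simp add: power2_eq_square)
    qed
    then have "energy (set W) K w ?t0 \<le> (\<Sum>v\<in>set W. int (M * M))" unfolding energy_def by (rule sum_mono)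
    then show ?thesis using W by (simp add: distinct_card)
  qed
  from flip_terminates[OF finite_set e0 this]
  have st: "\<And>t. t \<in> set tk \<Longrightarrow> \<not> improves K w tk t" unfolding tk by blast
  have ins': "int (inside tk S) = int K * (D * int (inside E S))" if "S \<subseteq> set W" for S
    unfolding tk ins inside_tokens[OF that] D_nat by simp
  have en': "\<And>t. t \<in> set tk \<Longrightarrow> fst t \<in> set W \<and> snd t \<in> set W" unfolding tk by (rule ends)
  have lev: "exc K w tk y \<le> exc K w tk v \<longleftrightarrow> load tk y + K * w v \<le> load tk v + K * w y" for y v
  proof -
    have "load tk y + K * w v \<le> load tk v + K * w y \<longleftrightarrow> int (load tk y + K * w v) \<le> int (load tk v + K * w y)"
      by (simp only: of_nat_le_iff)
    then show ?thesis unfolding exc_def by (simp add: algebra_simps)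
  qed
  have "card (set W) * card (set W) < K" using K W by (simp add: distinct_card)
  from stable_level_set[OF finite_set en' ins' st this] show ?thesis unfolding lev .
qed

lemma levels_sub:
  assumes "S \<in> set (levels A B E V P Q r x)" "r \<in> set V" "x \<in> set V" "r \<noteq> x" "distinct V"
  shows "distinct S \<and> set S \<noteq> {} \<and> set S \<subset> set V"
proof -
  have "distinct S \<and> r \<in> set S \<and> x \<notin> set S \<and> set S \<subseteq> set V"
    using assms unfolding levels_def Let_def by auto
  then have "distinct S" "r \<in> set S" "x \<notin> set S" "set S \<subseteq> set V" by simp_all
  moreover from this have "set S \<noteq> set V" using assms(3) by metis
  ultimately show ?thesis by auto
qed

text \<open>Let \<open>T\<close> be a nonempty proper subset, \<open>r\<close> a vertex in it and \<open>x\<close> a vertex outside. Among the sets that avoid \<open>x\<close> the local search finds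
  one of minimum potential with respect to the weights that ignore \<open>r\<close>. Adding \<open>r\<close> does not increase this, so the result is no worse than \<open>T\<close>.\<close>

lemma minset_minimal:
  assumes V: "distinct V" "2 \<le> length V" and good: "good (cap_of P Q) (set V)"
  shows "distinct (minset A B E V P Q) \<and> minimal (cap_of P Q) (set V) (set (minset A B E V P Q))"
proof -
  let ?S = "minset A B E V P Q" and ?k = "cap_of P Q"
  let ?xs = "concat (map (\<lambda>r. concat (map (\<lambda>x. if r = x then [] else levels A B E V P Q r x) V)) V)"
  obtain v0 vs where vs: "V = v0 # vs" "vs \<noteq> []" using V(2) by (cases V; cases "tl V") auto
  have d: "(case V of [] \<Rightarrow> [] | v # _ \<Rightarrow> [v]) = [v0]" using vs by simp
  have sub: "distinct S \<and> set S \<noteq> {} \<and> set S \<subset> set V" if "S \<in> set ([v0] # ?xs)" for S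
  proof -
    from that have "S = [v0] \<or> S \<in> set ?xs" by (simp only: list.set insert_iff)
    then show ?thesis
    proof
      assume "S = [v0]"
      then show ?thesis using vs V(1) by (cases vs) auto
    next
      assume "S \<in> set ?xs"
      then have "\<exists>r\<in>set V. \<exists>x\<in>set V. S \<in> set (if r = x then [] else levels A B E V P Q r x)"
        by (simp only: set_concat set_map image_image UN_iff)
      then obtain r x where rx: "r \<in> set V" "x \<in> set V" "S \<in> set (if r = x then [] else levels A B E V P Q r x)"
        by blast
      then have "r \<noteq> x" by (cases "r = x") simp_all
      then have "S \<in> set (levels A B E V P Q r x)" using rx(3) by simp
      from levels_sub[OF this rx(1,2) \<open>r \<noteq> x\<close> V(1)] show ?thesis .
    qed
  qed
  have in0: "?S \<in> set ([v0] # ?xs)" unfolding minset_def d by (rule pick_in)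
  note subS = sub[OF in0]
  have le: "pot ?k (set ?S) \<le> pot ?k (set T)" if T: "T \<in> set ([v0] # ?xs)" for T
  proof -
    have "shifted_pot A B E V P Q ?S \<le> shifted_pot A B E V P Q T" unfolding minset_def d by (rule pick_min[OF T])
    then have "int (shifted_pot A B E V P Q ?S) \<le> int (shifted_pot A B E V P Q T)" by simp
    moreover have "int (shifted_pot A B E V P Q T) = pot ?k (set T) + int (B * (A - 1) * length E + B * length V)"
      by (rule shifted_pot_eq) (use sub[OF T] V in auto)
    moreover have "int (shifted_pot A B E V P Q ?S) = pot ?k (set ?S) + int (B * (A - 1) * length E + B * length V)"
      by (rule shifted_pot_eq) (use subS V in auto)
    ultimately show ?thesis by linarith
  qed
  have "pot ?k (set ?S) \<le> pot ?k T" if T: "T \<noteq> {}" "T \<subset> set V" for T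
  proof -
    obtain r x where rx: "r \<in> T" "x \<in> set V" "x \<notin> T" using T by blast
    define W where "W = filter (\<lambda>v. v \<noteq> x) V"
    \<comment> \<open>Any number above the square of the number of vertices would do.\<close>
    define K where "K = length V * length V + 1"
    define tk where "tk = balanced A B E P Q r W K"
    let ?w = "root_weight A B P Q r"
    have dW: "distinct W" "set W = set V - {x}" unfolding W_def using V by auto
    have KW: "length W * length W < K"
    proof -
      have "length W \<le> length V" unfolding W_def by simp
      from mult_le_mono[OF this this] have "length W * length W \<le> length V * length V" .
      then show ?thesis unfolding K_def by simp
    qed
    from balanced_level_set[OF dW(1) KW, where P = P and Q = Q and r = r, folded tk_def]
    obtain L where L: "L \<subseteq> set W" "L = {} \<or> (\<exists>y\<in>L. L = {v\<in>set W. load tk y + K * ?w v \<le> load tk v + K * ?w y})"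
      "\<forall>S\<subseteq>set W. (\<Sum>v\<in>L. int (?w v)) - D * int (inside E L) \<le> (\<Sum>v\<in>S. int (?w v)) - D * int (inside E S)"
      by (elim exE conjE) (rule that)
    have L3: "(\<Sum>v\<in>L. int (?w v)) - D * int (inside E L) \<le> (\<Sum>v\<in>T. int (?w v)) - D * int (inside E T)"
    proof -
      have "T \<subseteq> set W" using T rx dW by blast
      then show ?thesis using L(3) by (simp only: simp_thms)
    qed
    have TW: "T \<subseteq> set W" using T rx dW by blast
    have rW: "r \<in> set W" using TW rx by blast
    have finT: "finite T" using TW finite_subset by blast
    have finL: "finite L" using L(1) finite_subset by blast
    have weq: "wt ?k v = int (?w v)" if "v \<in> set V" "v \<noteq> r" for v
      using wt_good(2)[OF good that(1)] that(2) by (simp add: root_weight_def)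
    have pot_r: "pot ?k U = (\<Sum>v\<in>U. int (?w v)) - D * int (inside E U) + wt ?k r" if U: "U \<subseteq> set W" "r \<in> U" for U
    proof -
      have fU: "finite U" using U finite_subset by blast
      have "(\<Sum>v\<in>U - {r}. wt ?k v) = (\<Sum>v\<in>U - {r}. int (?w v))"
        by (rule sum.cong) (use weq U dW in auto)
      moreover have "?w r = 0" by (simp add: root_weight_def)
      ultimately show ?thesis unfolding pot_def sum.remove[OF fU U(2)] by simp
    qed
    have rL: "insert r L \<subseteq> set W" using L(1) rW by simp
    have "(\<Sum>v\<in>insert r L. int (?w v)) = (\<Sum>v\<in>L. int (?w v))"
      using finL by (cases "r \<in> L") (simp_all add: insert_absorb root_weight_def)
    moreover have "D * int (inside E L) \<le> D * int (inside E (insert r L))"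
      using D_pos inside_mono[of L "insert r L" E] by (intro mult_left_mono) auto
    ultimately have "pot ?k (insert r L) \<le> pot ?k T"
      using L3 unfolding pot_r[OF rL insertI1] pot_r[OF TW rx(1)] by linarith
    moreover obtain Y where "Y \<in> set ?xs" "set Y = insert r L"
    proof -
      have rV: "r \<in> set V" "r \<noteq> x" using rW dW by auto
      have lev: "levels A B E V P Q r x = filter (\<lambda>v. v = r) V # map (\<lambda>y. filter (\<lambda>v. v = r \<or> v \<noteq> x \<and>
        load tk y + K * ?w v \<le> load tk v + K * ?w y) V) W"
        unfolding levels_def Let_def tk_def K_def W_def ..
      have "\<exists>Y\<in>set (levels A B E V P Q r x). set Y = insert r L"
        using L(2)
      proof
        assume "L = {}"
        then have "set (filter (\<lambda>v. v = r) V) = insert r L" using rV by auto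
        then show ?thesis unfolding lev by (intro bexI[of _ "filter (\<lambda>v. v = r) V"]) auto
      next
        assume "\<exists>y\<in>L. L = {v\<in>set W. load tk y + K * ?w v \<le> load tk v + K * ?w y}"
        then obtain y where y: "y \<in> L" "L = {v\<in>set W. load tk y + K * ?w v \<le> load tk v + K * ?w y}" by blast
        let ?Y = "filter (\<lambda>v. v = r \<or> v \<noteq> x \<and> load tk y + K * ?w v \<le> load tk v + K * ?w y) V"
        have yW: "y \<in> set W" using y(1) L(1) by blast
        have "set ?Y = insert r {v\<in>set W. load tk y + K * ?w v \<le> load tk v + K * ?w y}"
          using rV dW by auto
        then have "set ?Y = insert r L" using y(2) by simp
        moreover have "?Y \<in> set (levels A B E V P Q r x)" unfolding lev using yW by simp
        ultimately show ?thesis by blast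
      qed
      then obtain Y where Y: "Y \<in> set (levels A B E V P Q r x)" "set Y = insert r L" by blast
      have "Y \<in> set (if r = x then [] else levels A B E V P Q r x)" using Y(1) rV(2) by simp
      then have "\<exists>r\<in>set V. \<exists>x\<in>set V. Y \<in> set (if r = x then [] else levels A B E V P Q r x)"
        by (rule bexI[OF bexI[OF _ rx(2)] rV(1)])
      then have "Y \<in> set ?xs" by (simp only: set_concat set_map image_image UN_iff)
      then show ?thesis using Y(2) by (rule that)
    qed
    moreover have "pot ?k (set ?S) \<le> pot ?k (set Y)" by (rule le) (simp only: list.set insert_iff \<open>Y \<in> set ?xs\<close> simp_thms)
    ultimately show ?thesis by (simp only: \<open>set Y = insert r L\<close>)
  qed
  then have "\<forall>T. T \<noteq> {} \<and> T \<subset> set V \<longrightarrow> pot ?k (set ?S) \<le> pot ?k T" by simp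
  then show ?thesis using subS unfolding minimal_def by (intro conjI) simp_all
qed

lemma cut_edges_mem:
  assumes "e \<in> set (cut_edges E S X)"
  shows "fst e \<in> set S" "snd e \<in> set X" "0 < cross E {snd e} {fst e}"
proof -
  obtain x y where xy: "(x, y) \<in> set E \<or> (y, x) \<in> set E" "e = (x, y)" "x \<in> set S" "y \<in> set X"
  proof -
    have "\<exists>f\<in>set E. e \<in> set (if fst f \<in> set S \<and> snd f \<in> set X then [f]
     else if snd f \<in> set S \<and> fst f \<in> set X then [(snd f, fst f)] else [])"
      using assms unfolding cut_edges_def by (simp only: set_concat set_map image_image UN_iff)
    then obtain f where f: "f \<in> set E" "e \<in> set (if fst f \<in> set S \<and> snd f \<in> set X then [f]
     else if snd f \<in> set S \<and> fst f \<in> set X then [(snd f, fst f)] else [])" by (elim bexE)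
    show ?thesis
    proof (cases "fst f \<in> set S \<and> snd f \<in> set X")
      case True
      then have "e = f" using f(2) by simp
      then show ?thesis using True f(1) by (intro that[of "fst f" "snd f"]) simp_all
    next
      case False
      then have "snd f \<in> set S" "fst f \<in> set X" "e = (snd f, fst f)" using f(2) by (simp_all split: if_splits)
      then show ?thesis using f(1) by (intro that[of "snd f" "fst f"]) simp_all
    qed
  qed
  then show "fst e \<in> set S" "snd e \<in> set X" by simp_all
  have "\<exists>g\<in>set E. fst g = y \<and> snd g = x \<or> fst g = x \<and> snd g = y" using xy(1) by force
  then have "filter (\<lambda>g. fst g \<in> {y} \<and> snd g \<in> {x} \<or> fst g \<in> {x} \<and> snd g \<in> {y}) E \<noteq> []"
    unfolding filter_empty_conv by simp
  then show "0 < cross E {snd e} {fst e}" unfolding cross_def xy(2) fst_conv snd_conv by simp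
qed

lemma cross_cut_edges:
  assumes "set S \<inter> set X = {}" "U \<subseteq> set S"
  shows "cross E U (set X) = length (filter (\<lambda>e. fst e \<in> U) (cut_edges E S X))"
proof -
  have "cross F U (set X) = length (filter (\<lambda>e. fst e \<in> U) (cut_edges F S X))" for F
  proof (induction F)
    case Nil
    then show ?case by (simp add: cross_def cut_edges_def)
  next
    case (Cons f F)
    have "cross (f # F) U (set X) = (if fst f \<in> U \<and> snd f \<in> set X \<or> fst f \<in> set X \<and> snd f \<in> U then 1 else 0) + cross F U (set X)"
      by (simp add: cross_def)
    moreover have "length (filter (\<lambda>e. fst e \<in> U) (cut_edges (f # F) S X)) =
      (if fst f \<in> U \<and> snd f \<in> set X \<or> fst f \<in> set X \<and> snd f \<in> U then 1 else 0) + length (filter (\<lambda>e. fst e \<in> U) (cut_edges F S X))"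
      using assms by (auto simp: cut_edges_def)
    ultimately show ?case using Cons by simp
  qed
  then show ?thesis .
qed

lemma set_nbs_list: "set (nbs_list E V v) = nbs (set V) v"
  unfolding nbs_list_def nbs_def by auto

lemma card_tight_list: "distinct V \<Longrightarrow> length (tight_list E V P Q v) = card (tight (cap_of P Q) (set V) v)"
  and set_tight_list: "set (tight_list E V P Q v) = tight (cap_of P Q) (set V) v"
proof -
  show *: "set (tight_list E V P Q v) = tight (cap_of P Q) (set V) v"
    unfolding tight_list_def tight_def deg_def using set_nbs_list[of V v] by auto
  assume "distinct V"
  then have "distinct (tight_list E V P Q v)" unfolding tight_list_def nbs_list_def by simp
  then show "length (tight_list E V P Q v) = card (tight (cap_of P Q) (set V) v)" unfolding *[symmetric] by (simp add: distinct_card)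
qed

lemma reducible_test_iff: "distinct V \<Longrightarrow> reducible_test B E V P Q v \<longleftrightarrow> reducible (cap_of P Q) (set V) v"
  unfolding reducible_test_def reducible_def deg_def by (simp add: card_tight_list)

lemma vertex_step_ok:
  assumes V: "distinct V" "2 \<le> length V" and good: "good (cap_of P Q) (set V)" and bd: "bounded (cap_of P Q) (set V)"
    and gap: "\<And>T. T \<noteq> {} \<Longrightarrow> T \<subset> set V \<Longrightarrow> int A - int B < pot (cap_of P Q) T"
    and gap3: "\<And>T. 3 \<le> B \<Longrightarrow> T \<noteq> {} \<Longrightarrow> T \<subset> set V \<Longrightarrow> int A + int B < pot (cap_of P Q) T"
    and s: "vertex_step B E V P Q = (S, us, ws)"
  shows "distinct S \<and> step_ok (cap_of P Q) (set V) (set S) (set us) (set ws)"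
proof -
  have card: "2 \<le> card (set V)" using V by (simp add: distinct_card)
  obtain v0 where "v0 \<in> set V" "reducible (cap_of P Q) (set V) v0"
    using exists_reducible[OF finite_set good bd card gap3] by blast
  then have "filter (reducible_test B E V P Q) V \<noteq> []" using reducible_test_iff[OF V(1)] by (auto simp: filter_empty_conv)
  then obtain v vs where f: "filter (reducible_test B E V P Q) V = v # vs" by (cases "filter (reducible_test B E V P Q) V") auto
  then have "v \<in> set (filter (reducible_test B E V P Q) V)" by simp
  then have v: "v \<in> set V" and red: "reducible (cap_of P Q) (set V) v" using reducible_test_iff[OF V(1)] by auto
  have S: "S = filter (\<lambda>u. u \<noteq> v) V" using s unfolding vertex_step_def f by simp
  have setS: "set S = set V - {v}" unfolding S by auto
  note ctx = finite_set good bd v card gap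
  consider "deg (set V) v \<le> 1"
    | "deg (set V) v = 2" "1 \<le> cap_of P Q True v" "2 \<le> cap_of P Q False v"
    | "deg (set V) v = 3" "3 \<le> B" "2 \<le> cap_of P Q True v" "4 \<le> cap_of P Q False v"
      "card (tight (cap_of P Q) (set V) v) \<le> 1 \<or> 4 \<le> B"
    using red unfolding reducible_def by blast
  then have "step_ok (cap_of P Q) (set V) (set V - {v}) (set us) (set ws)"
  proof cases
    case 1
    then have "us = (if cap_of P Q False v = 0 then nbs_list E V v else [])" "ws = (if cap_of P Q False v = 0 then [] else nbs_list E V v)"
      using s unfolding vertex_step_def f deg_def by (auto split: if_splits)
    then have "set us = (if cap_of P Q False v = 0 then nbs (set V) v else {})" "set ws = (if cap_of P Q False v = 0 then {} else nbs (set V) v)"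
      by (auto simp: set_nbs_list)
    then show ?thesis using step_degree1[OF ctx 1] by simp
  next
    case 2
    then have "us = []" "ws = nbs_list E V v" using s unfolding vertex_step_def f deg_def by auto
    then show ?thesis using step_degree2[OF ctx 2] by (simp add: set_nbs_list)
  next
    case 3
    then have "us = nbs_list E V v" "ws = tight_list E V P Q v" using s unfolding vertex_step_def f deg_def by auto
    then show ?thesis using step_degree3[OF ctx 3(2) gap3[OF 3(2)] 3(1) 3(3) _ 3(5)] 3(4) by (simp add: set_nbs_list set_tight_list)
  qed
  then show ?thesis unfolding setS using V(1) S by simp
qed

lemma plan_ok:
  assumes V: "distinct V" "2 \<le> length V" and good: "good (cap_of P Q) (set V)" and bd: "bounded (cap_of P Q) (set V)"
    and pl: "plan A B E V P Q = (S', us, ws)"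
  shows "distinct S' \<and> step_ok (cap_of P Q) (set V) (set S') (set us) (set ws)"
proof -
  let ?k = "cap_of P Q"
  define S where "S = minset A B E V P Q"
  define X where "X = filter (\<lambda>v. v \<notin> set S) V"
  define Z where "Z = B * (A - 1) * length E + B * length V"
  define m where "m = shifted_pot A B E V P Q S"
  have dS: "distinct S" and min: "minimal ?k (set V) (set S)" using minset_minimal[OF V good] unfolding S_def by auto
  note ctx = finite_set good bd min
  have SV: "set S \<noteq> {}" "set S \<subset> set V" using min unfolding minimal_def by auto
  have X: "set X = set V - set S" "distinct X" unfolding X_def using V by auto
  have m: "int m = pot ?k (set S) + int Z" unfolding m_def Z_def by (rule shifted_pot_eq) (use dS SV V in auto)
  have minT: "pot ?k (set S) \<le> pot ?k T" if "T \<noteq> {}" "T \<subset> set V" for T using min that unfolding minimal_def by blast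
  have pl': "(case cut_edges E S X of [] \<Rightarrow> (S, [], []) | e # es \<Rightarrow>
       if m \<le> Z then (S, [], [])
       else if m \<le> Z + (A - B) then (S, [], [fst e])
       else if B = 2 then vertex_step B E V P Q
       else if m \<le> Z + A then (case es of [] \<Rightarrow> (X, [snd e], [snd e]) | e' # _ \<Rightarrow> (S, [], [fst e, fst e']))
       else if m \<le> Z + A + B then (S, [fst e], [fst e])
       else vertex_step B E V P Q) = (S', us, ws)"
    using pl unfolding plan_def Let_def S_def X_def Z_def m_def .
  have dj: "set S \<inter> set X = {}" using X by blast
  have cr: "cross E (set S) (set V - set S) = length (cut_edges E S X)"
  proof -
    have "filter (\<lambda>e. fst e \<in> set S) (cut_edges E S X) = cut_edges E S X"
      by (rule filter_True) (use cut_edges_mem(1) in blast)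
    then show ?thesis using cross_cut_edges[OF dj subset_refl] unfolding X(1) by simp
  qed
  have AmB: "int (A - B) = int A - int B" using AB by (simp add: of_nat_diff)
  show ?thesis
  proof (cases "cut_edges E S X")
    case Nil
    then have "S' = S" "us = []" "ws = []" using pl' by auto
    then show ?thesis using step_component[OF ctx] cr Nil dS by simp
  next
    case (Cons e es)
    have e: "fst e \<in> set S" "snd e \<in> set V - set S" "0 < cross E {snd e} {fst e}"
      using cut_edges_mem[of e S X] Cons X by auto
    consider (a) "m \<le> Z" | (b) "Z < m" "m \<le> Z + (A - B)" | (c) "Z + (A - B) < m" "B = 2"
      | (d) "Z + (A - B) < m" "B \<noteq> 2" "m \<le> Z + A" | (e) "B \<noteq> 2" "Z + A < m" "m \<le> Z + A + B"
      | (f) "B \<noteq> 2" "Z + A + B < m" by linarith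
    then show ?thesis
    proof cases
      case a
      then have "S' = S" "us = []" "ws = []" using pl' Cons by auto
      moreover have "pot ?k (set S) \<le> 0" using a m by linarith
      ultimately show ?thesis using step_nonpos[OF ctx] dS by simp
    next
      case b
      moreover have "m \<le> Z + A - B" using b AB by linarith
      ultimately have "S' = S" "us = []" "ws = [fst e]" using pl' Cons by auto
      moreover have "0 < pot ?k (set S)" "pot ?k (set S) \<le> int A - int B" using b m AmB by linarith+
      ultimately show ?thesis using step_first[OF ctx _ _ e] dS by simp
    next
      case c
      then have s: "vertex_step B E V P Q = (S', us, ws)" using pl' Cons by auto
      have g: "int A - int B < pot ?k (set S)" using c m AmB by linarith
      show ?thesis
      proof (rule vertex_step_ok[OF V good bd _ _ s])
        show "int A - int B < pot ?k T" if "T \<noteq> {}" "T \<subset> set V" for T using minT[OF that] g by linarith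
        show "int A + int B < pot ?k T" if "3 \<le> B" for T using that c(2) by simp
      qed
    next
      case d
      have B3: "3 \<le> B" using d B2 by linarith
      have lo: "int A - int B < pot ?k (set S)" and hi: "pot ?k (set S) \<le> int A" using d m AmB by linarith+
      show ?thesis
      proof (cases es)
        case Nil
        then have "S' = X" "us = [snd e]" "ws = [snd e]" using pl' Cons d by auto
        moreover have "cross E (set S) (set V - set S) = 1" using cr Cons Nil by simp
        ultimately show ?thesis using step_bridge[OF ctx B3 lo hi _ e] X by simp
      next
        case (Cons e' es')
        note c2 = \<open>cut_edges E S X = e # es\<close> Cons
        then have "S' = S" "us = []" "ws = [fst e, fst e']" using pl' d by auto
        moreover have e': "fst e' \<in> set S" "snd e' \<in> set V - set S" "0 < cross E {snd e'} {fst e'}"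
          using cut_edges_mem[of e' S X] c2 X by auto
        moreover have "2 \<le> cross E {u\<in>set S. c u} (set V - set S)" if "c (fst e)" "c (fst e')" for c
        proof -
          have "cross E {u\<in>set S. c u} (set X) = length (filter (\<lambda>e. fst e \<in> {u\<in>set S. c u}) (cut_edges E S X))"
            by (rule cross_cut_edges[OF dj]) blast
          also have "filter (\<lambda>e. fst e \<in> {u\<in>set S. c u}) (cut_edges E S X) = e # e' # filter (\<lambda>e. fst e \<in> {u\<in>set S. c u}) es'"
            unfolding c2 using that e(1) e'(1) by simp
          finally show ?thesis unfolding X(1) by simp
        qed
        ultimately show ?thesis using step_second[OF ctx B3 lo hi e e'] dS by simp
      qed
    next
      case e2: e
      have B3: "3 \<le> B" using e2 B2 by linarith
      have "int A < pot ?k (set S)" "pot ?k (set S) \<le> int A + int B" using e2 m by linarith+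
      moreover have "\<not> m \<le> Z" "\<not> m \<le> Z + (A - B)" "\<not> m \<le> Z + A" using e2 by linarith+
      then have "(S, [fst e], [fst e]) = (S', us, ws)"
        using pl' e2 unfolding Cons list.case by (simp only: if_False if_True)
      then have "S' = S" "us = [fst e]" "ws = [fst e]" by auto
      ultimately show ?thesis using step_third[OF ctx B3 _ _ e] dS by simp
    next
      case f
      have "\<not> m \<le> Z" "\<not> m \<le> Z + (A - B)" "\<not> m \<le> Z + A" "\<not> m \<le> Z + A + B" using f by linarith+
      then have s: "vertex_step B E V P Q = (S', us, ws)"
        using pl' f unfolding Cons list.case by (simp_all only: if_False if_True)
      have g: "int A + int B < pot ?k (set S)" using f m by linarith
      show ?thesis
      proof (rule vertex_step_ok[OF V good bd _ _ s])
        show "int A - int B < pot ?k T" if "T \<noteq> {}" "T \<subset> set V" for T using minT[OF that] g by linarith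
        show "int A + int B < pot ?k T" if "T \<noteq> {}" "T \<subset> set V" for T using minT[OF that] g by linarith
      qed
    qed
  qed
qed

lemma cap_of_lowered:
  assumes "distinct S" "v \<in> set S"
  shows "cap_of (lowered S P us) (lowered S Q ws) b v = low (cap_of P Q) (set us) (set ws) b v"
  unfolding lowered_def cap_of_tab[OF assms] low_def by (simp add: cap_of_def)

lemma best_caps_best:
  assumes X: "distinct X" and PQ: "best_caps A B E P Q S X C = (P', Q')"
  shows "\<exists>k'. best (\<lambda>v. v \<in> set C) (set S) (set X) (cap_of P Q) k' \<and> (\<forall>v\<in>set X. \<forall>b. cap_of P' Q' b v = k' b v)"
proof -
  let ?c = "\<lambda>v. v \<in> set C" and ?k = "cap_of P Q"
  let ?W = "\<lambda>y. A * length (fst y) + B * length (snd y)"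
  let ?xs = "concat (map (\<lambda>u. concat (map (\<lambda>y. if usable E ?c (set S) ?k u y
          then [cap_lists X (use E ?c (set S) ?k u y)] else []) X)) S)"
  let ?d = "cap_lists X (ban E ?c (set S) ?k)"
  have ct: "best_caps A B E P Q S X C = pick (\<lambda>y b. ?W b < ?W y) ?xs ?d" unfolding best_caps_def ..
  have set: "set (?d # ?xs) = cap_lists X ` cand E ?c (set S) (set X) ?k"
    unfolding cand_def usable_def by (auto split: if_splits)
  have in0: "(P', Q') \<in> cap_lists X ` cand E ?c (set S) (set X) ?k"
    using pick_in[of "\<lambda>y b. ?W b < ?W y" ?xs ?d] unfolding set ct[symmetric] PQ .
  then obtain k' where k': "k' \<in> cand E ?c (set S) (set X) ?k" "(P', Q') = cap_lists X k'" by blast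
  have W: "int (?W (cap_lists X f)) = (\<Sum>y\<in>set X. wt f y) + int B * int (card (set X))" for f
  proof -
    have "(\<Sum>y\<in>set X. wt f y) + int B * int (card (set X)) = (\<Sum>y\<in>set X. int A * int (f True y) + int B * int (f False y))"
      unfolding wt_def by (simp add: sum_subtractf)
    also have "\<dots> = int A * int (\<Sum>y\<leftarrow>X. f True y) + int B * int (\<Sum>y\<leftarrow>X. f False y)"
      unfolding sum_list_distinct_conv_sum_set[OF X] by (simp add: sum.distrib sum_distrib_left)
    finally show ?thesis by (simp add: cap_lists_def length_tab)
  qed
  have "(\<Sum>y\<in>set X. wt k'' y) \<le> (\<Sum>y\<in>set X. wt k' y)" if k'': "k'' \<in> cand E ?c (set S) (set X) ?k" for k''
  proof -
    have "cap_lists X k'' \<in> set (?d # ?xs)" unfolding set using k'' by blast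
    from pick_max[OF this, of ?W] have "?W (cap_lists X k'') \<le> ?W (cap_lists X k')"
      unfolding ct[symmetric] PQ k'(2) .
    then have "int (?W (cap_lists X k'')) \<le> int (?W (cap_lists X k'))" by (simp only: of_nat_le_iff)
    then show ?thesis unfolding W by simp
  qed
  then have "best ?c (set S) (set X) ?k k'" unfolding best_def using k'(1) by blast
  moreover have "cap_of P' Q' b v = k' b v" if "v \<in> set X" for b v
  proof -
    have "P' = tab X (k' True)" "Q' = tab X (k' False)" using k'(2) by (auto simp: cap_lists_def)
    then show ?thesis using cap_of_tab[OF X that] by (cases b) simp_all
  qed
  ultimately show ?thesis by blast
qed

lemma good_cong: "(\<And>b v. v \<in> V \<Longrightarrow> k b v = k' b v) \<Longrightarrow> good k V = good k' V"
  unfolding good_def using pot_cong[of _ k k'] by (metis (no_types, lifting) subsetD)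

lemma bounded_cong: "(\<And>b v. v \<in> V \<Longrightarrow> k b v = k' b v) \<Longrightarrow> bounded k V = bounded k' V"
  unfolding bounded_def by simp

text \<open>Induction on the number of vertices: the task is replaced by one for \<open>S\<close>, whose colouring determines the task
  for the complement. The two colourings fit together by \<open>valid_extend\<close>. The two steps for opening and
  resuming the task are absorbed by the \<open>+ 2\<close>, which the two subtasks provide twice.\<close>

lemma step_solves:
  assumes "distinct V" "V \<noteq> []" "good (cap_of P Q) (set V)" "bounded (cap_of P Q) (set V)" "set V \<inter> set C = {}"
  shows "\<exists>j C'. j + 2 \<le> 3 * length V \<and> (step A B E ^^ j) ((False, V, P, Q) # rest, C) = (rest, C') \<and>
    set C \<subseteq> set C' \<and> set C' \<subseteq> set C \<union> set V \<and> valid E (cap_of P Q) (set V) (\<lambda>v. v \<in> set C')"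
  using assms
proof (induction "length V" arbitrary: V P Q C rest rule: less_induct)
  case less
  let ?k = "cap_of P Q"
  show ?case
  proof (cases "2 \<le> length V")
    case False
    then obtain v where V: "V = [v]" using less.prems(2) by (cases V; cases "tl V") auto
    let ?C = "if v \<in> set P then v # C else C"
    have st: "step A B E ((False, V, P, Q) # rest, C) = (rest, ?C)" by (simp add: step_def Let_def V)
    have vC: "v \<notin> set C" using less.prems(5) V by simp
    have pos: "0 < ?k (v \<in> set ?C) v"
    proof (cases "v \<in> set P")
      case True
      then have "filter (\<lambda>u. u = v) P \<noteq> []" by (auto simp: filter_empty_conv)
      then show ?thesis using True by (simp add: cap_of_def)
    next
      case False
      then have "?k True v = 0" by (auto simp: cap_of_def filter_empty_conv)
      moreover have "- int B < wt ?k v" using goodD[OF less.prems(3), of "{v}"] V by (simp add: pot_single)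
      ultimately have "?k False v \<noteq> 0" unfolding wt_def by (metis add.right_neutral diff_0 less_irrefl mult_zero_right of_nat_0)
      then show ?thesis using False vC by simp
    qed
    have "valid E ?k (set V) (\<lambda>v. v \<in> set ?C)"
    proof (rule validI)
      fix u assume "u \<in> set V"
      then have u: "u = v" using V by simp
      have "cross E {v} {w \<in> set V. (w \<in> set ?C) = (v \<in> set ?C)} \<le> cross E {v} {v}"
        by (rule cross_mono) (auto simp: V)
      then show "cross E {u} {w \<in> set V. (w \<in> set ?C) = (u \<in> set ?C)} < ?k (u \<in> set ?C) u"
        using pos cross_loop[OF loopless, of v] unfolding u by simp
    next
      fix b T assume "T \<noteq> {}" "T \<subseteq> {u \<in> set V. (u \<in> set ?C) = b}"
      then have "T = {v}" using V by auto
      then show "inside E T < card T" by (simp add: inside_single[OF loopless])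
    qed
    moreover have "set C \<subseteq> set ?C" "set ?C \<subseteq> set C \<union> set V" using V by auto
    moreover have "(step A B E ^^ 1) ((False, V, P, Q) # rest, C) = (rest, ?C)" using st by simp
    moreover have "1 + 2 \<le> 3 * length V" using V by simp
    ultimately show ?thesis by blast
  next
    case True
    obtain S us ws where pl: "plan A B E V P Q = (S, us, ws)" by (cases "plan A B E V P Q") auto
    from plan_ok[OF less.prems(1) True less.prems(3,4) pl]
    have dS: "distinct S" and ok: "step_ok ?k (set V) (set S) (set us) (set ws)" by auto
    define X where "X = filter (\<lambda>v. v \<notin> set S) V"
    have X: "distinct X" "set X = set V - set S" unfolding X_def using less.prems(1) by auto
    have S: "set S \<noteq> {}" "set S \<subset> set V" and gS: "good (low ?k (set us) (set ws)) (set S)"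
      and gX: "\<And>c k'. valid E (low ?k (set us) (set ws)) (set S) c \<Longrightarrow> best c (set S) (set V - set S) ?k k' \<Longrightarrow> good k' (set V - set S)"
      using ok unfolding step_ok_def by auto
    let ?P1 = "lowered S P us" and ?Q1 = "lowered S Q ws"
    have k1: "cap_of ?P1 ?Q1 b v = low ?k (set us) (set ws) b v" if "v \<in> set S" for b v
      by (rule cap_of_lowered[OF dS that])
    have len: "length S + length X = length V"
    proof -
      have "card (set S) + card (set X) = card (set V)"
        using S(2) X(2) by (metis card_Diff_subset card_mono finite_set le_add_diff_inverse psubset_imp_subset)
      then show ?thesis using dS X(1) less.prems(1) by (simp add: distinct_card)
    qed
    have S0: "S \<noteq> []" and X0: "X \<noteq> []" using S X by auto
    then have lt: "length S < length V" "length X < length V" using len by (cases S; cases X; auto)+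
    have st1: "step A B E ((False, V, P, Q) # rest, C) = ((False, S, ?P1, ?Q1) # (True, V, P, Q) # rest, C)"
    proof -
      obtain v vs where Vv: "V = v # vs" "vs \<noteq> []" using True by (cases V; cases "tl V") auto
      show ?thesis unfolding step_def Let_def using Vv(2) by (simp add: Vv(1) pl[unfolded Vv(1)])
    qed
    have g1: "good (cap_of ?P1 ?Q1) (set S)" proof -
      have "good (cap_of ?P1 ?Q1) (set S) = good (low ?k (set us) (set ws)) (set S)" by (rule good_cong) (rule k1)
      then show ?thesis using gS by simp
    qed
    have b1: "bounded (cap_of ?P1 ?Q1) (set S)"
    proof -
      have "bounded (cap_of ?P1 ?Q1) (set S) = bounded (low ?k (set us) (set ws)) (set S)" by (rule bounded_cong) (rule k1)
      then show ?thesis using bounded_low[OF less.prems(4) psubset_imp_subset[OF S(2)]] by simp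
    qed
    have dj1: "set S \<inter> set C = {}" using less.prems(5) S by blast
    from less.hyps[OF lt(1) dS S0 g1 b1 dj1, of "(True, V, P, Q) # rest"]
    obtain j1 C1 where j1: "j1 + 2 \<le> 3 * length S"
      "(step A B E ^^ j1) ((False, S, ?P1, ?Q1) # (True, V, P, Q) # rest, C) = ((True, V, P, Q) # rest, C1)"
      "set C \<subseteq> set C1" "set C1 \<subseteq> set C \<union> set S" "valid E (cap_of ?P1 ?Q1) (set S) (\<lambda>v. v \<in> set C1)" by blast
    have v1: "valid E (low ?k (set us) (set ws)) (set S) (\<lambda>v. v \<in> set C1)"
      by (rule valid_mono[OF j1(5)]) (simp add: k1)
    obtain P2 Q2 where ct: "best_caps A B E P Q S X C1 = (P2, Q2)" by (cases "best_caps A B E P Q S X C1") auto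
    obtain k' where k': "best (\<lambda>v. v \<in> set C1) (set S) (set X) ?k k'" "\<forall>v\<in>set X. \<forall>b. cap_of P2 Q2 b v = k' b v"
      using best_caps_best[OF X(1) ct] by blast
    have kc: "k' \<in> cand E (\<lambda>v. v \<in> set C1) (set S) (set X) ?k" using k'(1) unfolding best_def by blast
    have st2: "step A B E ((True, V, P, Q) # rest, C1) = ((False, X, P2, Q2) # rest, C1)"
      by (simp add: step_def Let_def pl ct flip: X_def)
    have g2: "good (cap_of P2 Q2) (set X)" proof -
      have "good (cap_of P2 Q2) (set X) = good k' (set X)" by (rule good_cong) (use k'(2) in simp)
      then show ?thesis using gX[OF v1 k'(1)[unfolded X(2)]] unfolding X(2) by simp
    qed
    have b2: "bounded (cap_of P2 Q2) (set X)"
    proof -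
      have "bounded (cap_of P2 Q2) (set X) = bounded k' (set X)" by (rule bounded_cong) (use k'(2) in simp)
      moreover have "set X \<subseteq> set V" using X(2) by simp
      ultimately show ?thesis using bounded_cand[OF less.prems(4) _ kc] by simp
    qed
    have dj2: "set X \<inter> set C1 = {}" using j1(4) less.prems(5) X(2) by blast
    from less.hyps[OF lt(2) X(1) X0 g2 b2 dj2, of rest]
    obtain j2 C2 where j2: "j2 + 2 \<le> 3 * length X"
      "(step A B E ^^ j2) ((False, X, P2, Q2) # rest, C1) = (rest, C2)"
      "set C1 \<subseteq> set C2" "set C2 \<subseteq> set C1 \<union> set X" "valid E (cap_of P2 Q2) (set X) (\<lambda>v. v \<in> set C2)" by blast
    have same: "(v \<in> set C1) = (v \<in> set C2)" if "v \<in> set S" for v using j2(3,4) that X(2) by blast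
    have lowle: "low ?k (set us) (set ws) b v \<le> ?k b v" for b v by (simp add: low_def)
    have vS: "valid E ?k (set S) (\<lambda>v. v \<in> set C2)"
    proof -
      have "valid E ?k (set S) (\<lambda>v. v \<in> set C1) = valid E ?k (set S) (\<lambda>v. v \<in> set C2)"
        by (rule valid_cong) (rule same)
      then show ?thesis using valid_mono[OF v1 lowle] by simp
    qed
    have cs: "{u \<in> set S. (u \<in> set C1) = b} = {u \<in> set S. (u \<in> set C2) = b}" for b
      by (intro Collect_cong conj_cong refl) (simp add: same)
    \<comment> \<open>The colours of the complement are accumulated later, but the colour classes within \<open>S\<close> are still the same.\<close>
    have kc2: "k' \<in> cand E (\<lambda>v. v \<in> set C2) (set S) (set X) ?k"
    proof -
      have sn: "seen E (\<lambda>v. v \<in> set C1) (set S) b y = seen E (\<lambda>v. v \<in> set C2) (set S) b y" for b y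
        unfolding seen_def cs ..
      have bn: "ban E (\<lambda>v. v \<in> set C1) (set S) ?k = ban E (\<lambda>v. v \<in> set C2) (set S) ?k"
        unfolding ban_def sn ..
      have us: "usable E (\<lambda>v. v \<in> set C1) (set S) ?k u y \<longleftrightarrow> usable E (\<lambda>v. v \<in> set C2) (set S) ?k u y" for u y
        unfolding usable_def sn by (cases "u \<in> set S") (simp_all add: same)
      have ue: "use E (\<lambda>v. v \<in> set C1) (set S) ?k u y = use E (\<lambda>v. v \<in> set C2) (set S) ?k u y" if "u \<in> set S" for u y
        unfolding use_def bn same[OF that] ..
      from kc consider "k' = ban E (\<lambda>v. v \<in> set C1) (set S) ?k"
        | u y where "k' = use E (\<lambda>v. v \<in> set C1) (set S) ?k u y" "y \<in> set X" "usable E (\<lambda>v. v \<in> set C1) (set S) ?k u y"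
        unfolding cand_def by blast
      then show ?thesis
      proof cases
        case 1
        then show ?thesis unfolding bn cand_def by blast
      next
        case 2
        then have "u \<in> set S" unfolding usable_def by simp
        then show ?thesis using 2 unfolding us ue[OF \<open>u \<in> set S\<close>] cand_def by blast
      qed
    qed
    have vX: "valid E k' (set X) (\<lambda>v. v \<in> set C2)" by (rule valid_mono[OF j2(5)]) (use k'(2) in simp)
    have dSX: "set S \<inter> set X = {}" "set S \<union> set X = set V" using S(2) X(2) by auto
    have "valid E ?k (set V) (\<lambda>v. v \<in> set C2)"
      using valid_extend[OF loopless finite_set finite_set dSX(1) vS kc2 vX] unfolding dSX(2) .
    moreover have "(step A B E ^^ (j2 + (1 + (j1 + 1)))) ((False, V, P, Q) # rest, C) = (rest, C2)"
      using st1 j1(2) st2 j2(2) unfolding funpow_add o_apply by simp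
    moreover have "j2 + (1 + (j1 + 1)) + 2 \<le> 3 * length V" using j1(1) j2(1) len by linarith
    moreover have "set C \<subseteq> set C2" "set C2 \<subseteq> set C \<union> set V" using j1(3,4) j2(3,4) S X(2) by blast+
    ultimately show ?thesis by blast
  qed
qed

lemma solve_valid:
  fixes V :: "'v list"
  defines "k \<equiv> \<lambda>b (v::'v). if b then B - 1 else A - 1"
  assumes V: "distinct V" and good: "good k (set V)"
  shows "set (solve A B E V) \<subseteq> set V \<and> valid E k (set V) (\<lambda>v. v \<in> set (solve A B E V))"
proof (cases "V = []")
  case True
  then show ?thesis by (simp add: solve_def valid_def)
next
  case False
  let ?P = "tab V (\<lambda>_. B - 1)" and ?Q = "tab V (\<lambda>_. A - 1)"
  have kk: "cap_of ?P ?Q b v = k b v" if "v \<in> set V" for b v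
    unfolding cap_of_tab[OF V that] k_def ..
  have g: "good (cap_of ?P ?Q) (set V)" proof -
    have "good (cap_of ?P ?Q) (set V) = good k (set V)" by (rule good_cong) (rule kk)
    then show ?thesis using good by simp
  qed
  have b: "bounded (cap_of ?P ?Q) (set V)"
  proof -
    have "bounded (cap_of ?P ?Q) (set V) = bounded k (set V)" by (rule bounded_cong) (rule kk)
    then show ?thesis unfolding bounded_def k_def using AB B2 by simp
  qed
  have dj: "set V \<inter> set ([] :: 'v list) = {}" by simp
  from step_solves[OF V False g b dj, of "[]"]
  obtain j C where j: "j + 2 \<le> 3 * length V" "(step A B E ^^ j) ([(False, V, ?P, ?Q)], []) = ([], C)"
    "set C \<subseteq> set [] \<union> set V" "valid E (cap_of ?P ?Q) (set V) (\<lambda>v. v \<in> set C)"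
    by (elim exE conjE) (rule that)
  have idle: "(step A B E ^^ i) ([], C) = ([], C)" for i by (induction i) (auto simp: step_def)
  have "(step A B E ^^ (3 * length V)) ([(False, V, ?P, ?Q)], [])
      = (step A B E ^^ (3 * length V - j)) ((step A B E ^^ j) ([(False, V, ?P, ?Q)], []))"
    using j(1) funpow_add[of "3 * length V - j" j "step A B E"] by simp
  then have "solve A B E V = C" unfolding solve_def j(2) idle by simp
  then show ?thesis using j(3) valid_mono[OF j(4), of k] kk by simp
qed

end

section \<open>Functions computable in polynomial time\<close>

text \<open>A type class of encoded types, so that the encoding of compound data is found by type inference.\<close>

class encodable =
  fixes enc :: "'a \<Rightarrow> data"

instantiation nat :: encodable
begin
definition "enc = enc_nat"
instance ..
end

instantiation bool :: encodable
begin
definition "enc = enc_bool"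
instance ..
end

instantiation prod :: (encodable, encodable) encodable
begin
definition "enc p = Pair (enc (fst p)) (enc (snd p))"
instance ..
end

instantiation list :: (encodable) encodable
begin
definition "enc = enc_list enc"
instance ..
end

lemma enc_simps [simp]:
  "enc (0::nat) = Atom" "enc (Suc n) = Pair Atom (enc n)"
  "enc False = Atom" "enc True = Pair Atom Atom"
  "enc (x, y) = Pair (enc x) (enc y)"
  "enc ([] :: 'a::encodable list) = Atom" "enc (z # zs) = Pair (enc z) (enc zs)"
  by (simp_all add: enc_nat_def enc_bool_def enc_prod_def enc_list_def)

definition ssize :: "'a::encodable \<Rightarrow> nat" where
  "ssize x = dsize (enc x)"

lemma ssize_simps [simp]:
  "ssize (x, y) = 1 + ssize x + ssize y"
  "ssize (n::nat) = 2 * n + 1"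
  "ssize ([] :: 'a::encodable list) = 1" "ssize (z # zs) = 1 + ssize z + ssize zs"
proof -
  show "ssize n = 2 * n + 1" by (induction n) (auto simp: ssize_def)
qed (auto simp: ssize_def)

lemma ssize_prod: "ssize z = 1 + ssize (fst z) + ssize (snd z)"
  by (cases z) simp

lemma ssize_bool: "ssize (b::bool) \<le> 3" by (cases b) (auto simp: ssize_def)

lemma ssize_pos: "1 \<le> ssize x"
proof -
  have "1 \<le> dsize d" for d by (cases d) auto
  then show ?thesis by (simp add: ssize_def)
qed

lemma ssize_list: "ssize xs = 1 + (\<Sum>x\<leftarrow>xs. 1 + ssize x)"
  by (induction xs) auto

lemma ssize_member: "x \<in> set xs \<Longrightarrow> ssize x \<le> ssize xs"
  by (induction xs) auto

lemma length_ssize: "length xs \<le> ssize xs"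
  by (induction xs) auto

lemma ssize_list_le: "(\<And>x. x \<in> set xs \<Longrightarrow> ssize x \<le> m) \<Longrightarrow> ssize xs \<le> 1 + length xs * (1 + m)"
proof (induction xs)
  case (Cons x xs)
  then have "ssize xs \<le> 1 + length xs * (1 + m)" "ssize x \<le> m" by auto
  then show ?case by simp
qed simp

lemma ssize_append: "ssize (xs @ ys) + 1 = ssize xs + ssize ys"
  by (induction xs) auto

lemma ssize_rev [simp]: "ssize (rev xs) = ssize xs"
  by (simp add: ssize_list sum_list_rev flip: rev_map)

lemma ssize_take: "ssize (take n xs) \<le> ssize xs"
  using ssize_append[of "take n xs" "drop n xs"] ssize_pos[of "drop n xs"] by simp

lemma poly_nat_mono: "x \<le> y \<Longrightarrow> poly (p :: nat poly) x \<le> poly p y"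
  by (induction p) (auto intro: add_mono mult_mono)

text \<open>Bounded by a polynomial in the size of the argument.\<close>

definition poly_bounded :: "('a::encodable \<Rightarrow> nat) \<Rightarrow> bool" where
  "poly_bounded h \<longleftrightarrow> (\<exists>p. \<forall>x. h x \<le> poly p (ssize x))"

lemma pb_mono: "poly_bounded g \<Longrightarrow> (\<And>x. h x \<le> g x) \<Longrightarrow> poly_bounded h"
  unfolding poly_bounded_def by (meson order_trans)

lemma pb_const: "poly_bounded (\<lambda>_. n)"
  unfolding poly_bounded_def by (rule exI[of _ "[:n:]"]) simp

lemma pb_size: "poly_bounded ssize"
  unfolding poly_bounded_def by (rule exI[of _ "[:0, 1:]"]) simp

lemma pb_add: assumes "poly_bounded g" "poly_bounded h" shows "poly_bounded (\<lambda>x. g x + h x)"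
proof -
  obtain p q where "\<forall>x. g x \<le> poly p (ssize x)" "\<forall>x. h x \<le> poly q (ssize x)"
    using assms unfolding poly_bounded_def by auto
  then show ?thesis unfolding poly_bounded_def by (intro exI[of _ "p + q"]) (simp add: add_mono)
qed

lemma pb_mult: assumes "poly_bounded g" "poly_bounded h" shows "poly_bounded (\<lambda>x. g x * h x)"
proof -
  obtain p q where "\<forall>x. g x \<le> poly p (ssize x)" "\<forall>x. h x \<le> poly q (ssize x)"
    using assms unfolding poly_bounded_def by auto
  then show ?thesis unfolding poly_bounded_def by (intro exI[of _ "p * q"]) (simp add: mult_mono)
qed

lemma pb_poly: assumes "poly_bounded h" shows "poly_bounded (\<lambda>x. poly p (h x))"
proof -
  obtain q where q: "\<forall>x. h x \<le> poly q (ssize x)" using assms unfolding poly_bounded_def by auto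
  have "poly p (h x) \<le> poly (pcompose p q) (ssize x)" for x
    unfolding poly_pcompose by (rule poly_nat_mono) (use q in blast)
  then show ?thesis unfolding poly_bounded_def by blast
qed

lemmas pb_intros = pb_const pb_size pb_add pb_mult pb_poly

definition runs :: "cmd \<Rightarrow> nat \<Rightarrow> store \<Rightarrow> nat \<Rightarrow> data \<Rightarrow> bool" where
  "runs c N s T d \<longleftrightarrow> (\<exists>t s'. exec c s t s' \<and> t \<le> T \<and> s' 0 = d \<and> (\<forall>i>N. s' i = s i))"

text \<open>Some program computes the encoding of \<open>f x\<close> in variable \<open>0\<close> from that of \<open>x\<close>, within a time bound that is polynomial and
  bounds the size of the result too. The variables above \<open>N\<close> are left alone: this is what allows a program to
  keep intermediate results while another one runs.\<close>

definition poly_time :: "('a::encodable \<Rightarrow> 'b::encodable) \<Rightarrow> bool" where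
  "poly_time f \<longleftrightarrow> (\<exists>c N T. poly_bounded T \<and> (\<forall>x. ssize (f x) \<le> T x) \<and> (\<forall>x s. s 0 = enc x \<longrightarrow> runs c N s (T x) (enc (f x))))"

lemma ptI:
  assumes "poly_bounded T" "\<And>x. ssize (f x) \<le> T x"
    and "\<And>x s. s 0 = enc x \<Longrightarrow> \<exists>t s'. exec c s t s' \<and> t \<le> T x \<and> s' 0 = enc (f x) \<and> (\<forall>i>N. s' i = s i)"
  shows "poly_time f"
  unfolding poly_time_def runs_def
  by (rule exI[of _ c], rule exI[of _ N], rule exI[of _ T], intro conjI allI)
    (rule assms(1), rule assms(2), rule impI, erule assms(3))

lemma exec_ex:
  "exec c s t s' \<Longrightarrow> t \<le> T \<Longrightarrow> s' 0 = d \<Longrightarrow> \<forall>i>N. s' i = s i \<Longrightarrow>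
    \<exists>t s'. exec c s t s' \<and> t \<le> T \<and> s' 0 = d \<and> (\<forall>i>N. s' i = s i)"
  by blast

lemma exec_assign: "val e s = d \<Longrightarrow> cost e s = n \<Longrightarrow> exec (Assign x e) s (1 + n) (s(x := d))"
  using exec.Assign by blast

lemma ptE:
  assumes "poly_time f"
  obtains c N T where "poly_bounded T" "\<And>x. ssize (f x) \<le> T x"
    "\<And>x s. s 0 = enc x \<Longrightarrow> \<exists>t s'. exec c s t s' \<and> t \<le> T x \<and> s' 0 = enc (f x) \<and> (\<forall>i>N. s' i = s i)"
proof -
  from assms obtain c N T where *: "poly_bounded T" "\<forall>x. ssize (f x) \<le> T x"
    "\<forall>x s. s 0 = enc x \<longrightarrow> (\<exists>t s'. exec c s t s' \<and> t \<le> T x \<and> s' 0 = enc (f x) \<and> (\<forall>i>N. s' i = s i))"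
    unfolding poly_time_def runs_def by (elim exE conjE)
  show ?thesis by (rule that[OF *(1) spec[OF *(2)] mp[OF spec[OF spec[OF *(3)]]]])
qed

lemma pt_size: assumes "poly_time f" shows "poly_bounded (\<lambda>x. ssize (f x))"
proof (rule ptE[OF assms])
  fix T c N assume "poly_bounded T" "\<And>x. ssize (f x) \<le> T x"
  then show "poly_bounded (\<lambda>x. ssize (f x))" by (rule pb_mono)
qed

lemma pb_comp: assumes "poly_bounded h" "poly_time f" shows "poly_bounded (\<lambda>x. h (f x))"
proof -
  obtain p where p: "\<forall>x. h x \<le> poly p (ssize x)" using assms unfolding poly_bounded_def by auto
  show ?thesis by (rule pb_mono[OF pb_poly[OF pt_size[OF assms(2)], of p]]) (use p in blast)
qed

lemma pt_expr:
  fixes f :: "'a::encodable \<Rightarrow> 'b::encodable" and T :: "'a \<Rightarrow> nat"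
  assumes "poly_bounded T" "\<And>x s. val e (s(0 := enc x)) = enc (f x)" "\<And>x s. cost e (s(0 := enc x)) \<le> T x"
  shows "poly_time f"
proof (rule ptI)
  show "poly_bounded (\<lambda>x. 1 + T x)" by (intro pb_intros assms)
  show "ssize (f x) \<le> 1 + T x" for x
    using assms(2,3)[of undefined x] dsize_val_le_cost[of e "undefined(0 := enc x)"] by (simp add: ssize_def)
  show "\<exists>t s'. exec (Assign 0 e) s t s' \<and> t \<le> 1 + T x \<and> s' 0 = enc (f x) \<and> (\<forall>i>0. s' i = s i)"
    if "s 0 = enc x" for x s
  proof -
    have "s = s(0 := enc x)" using that by auto
    then have v: "val e s = enc (f x)" "cost e s \<le> T x" using assms(2,3)[of s x] by metis+
    show ?thesis by (rule exI, rule exI, rule conjI, rule exec.Assign) (use v in auto)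
  qed
qed

fun const_expr :: "data \<Rightarrow> expr" where
  "const_expr Atom = Quote_Atom"
| "const_expr (Pair a b) = Cons_Of (const_expr a) (const_expr b)"

lemma pt_const: "poly_time (\<lambda>_. c)"
proof (rule pt_expr[of "\<lambda>_. dsize (enc c)" "const_expr (enc c)"])
  have "val (const_expr d) s = d" "cost (const_expr d) s = dsize d" for d s
    by (induction d) auto
  then show "val (const_expr (enc c)) s = enc c" "cost (const_expr (enc c)) s \<le> dsize (enc c)" for s by auto
qed (rule pb_const)

lemma pt_id: "poly_time (\<lambda>x. x)"
  by (rule pt_expr[of ssize "Var 0"]) (intro pb_intros, simp_all add: ssize_def[symmetric])

lemma pt_fst0: "poly_time fst"
  by (rule pt_expr[of "\<lambda>x. 1 + ssize x" "Hd_Of (Var 0)"]) (intro pb_intros, simp_all add: ssize_def[symmetric] enc_prod_def ssize_prod)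

lemma pt_snd0: "poly_time snd"
  by (rule pt_expr[of "\<lambda>x. 1 + ssize x" "Tl_Of (Var 0)"]) (intro pb_intros, simp_all add: ssize_def[symmetric] enc_prod_def ssize_prod)

lemma pt_Suc0: "poly_time Suc"
  by (rule pt_expr[of "\<lambda>x. 2 + ssize x" "Cons_Of Quote_Atom (Var 0)"]) (intro pb_intros, simp_all add: ssize_def[symmetric])

lemma pt_Cons0: "poly_time (\<lambda>z. fst z # snd z)"
  by (rule pt_expr[of ssize "Var 0"]) (intro pb_intros, simp_all add: ssize_def[symmetric] enc_prod_def ssize_prod)

lemma pt_comp:
  fixes f :: "'a::encodable \<Rightarrow> 'b::encodable" and g :: "'b \<Rightarrow> 'c::encodable"
  assumes "poly_time f" "poly_time g"
  shows "poly_time (\<lambda>x. g (f x))"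
proof -
  obtain c N T where f: "poly_bounded T" "\<And>x. ssize (f x) \<le> T x"
    "\<And>x s. s 0 = enc x \<Longrightarrow> \<exists>t s'. exec c s t s' \<and> t \<le> T x \<and> s' 0 = enc (f x) \<and> (\<forall>i>N. s' i = s i)"
    by (rule ptE[OF assms(1)]) (rule that)
  obtain d M U where g: "poly_bounded U" "\<And>x. ssize (g x) \<le> U x"
    "\<And>x s. s 0 = enc x \<Longrightarrow> \<exists>t s'. exec d s t s' \<and> t \<le> U x \<and> s' 0 = enc (g x) \<and> (\<forall>i>M. s' i = s i)"
    by (rule ptE[OF assms(2)]) (rule that)
  show ?thesis
  proof (rule ptI[of "\<lambda>x. T x + U (f x)" _ "Seq c d" "max N M"])
    show "poly_bounded (\<lambda>x. T x + U (f x))" by (intro pb_add f pb_comp[OF g(1) assms(1)])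
    show "ssize (g (f x)) \<le> T x + U (f x)" for x using g(2)[of "f x"] by simp
    fix x :: 'a and s :: store assume "s 0 = enc x"
    from f(3)[of s x, OF this] obtain t s' where 1: "exec c s t s'" "t \<le> T x" "s' 0 = enc (f x)" "\<forall>i>N. s' i = s i" by blast
    from g(3)[of s' "f x", OF 1(3)] obtain u s'' where 2: "exec d s' u s''" "u \<le> U (f x)" "s'' 0 = enc (g (f x))" "\<forall>i>M. s'' i = s' i" by blast
    have "t + u \<le> T x + U (f x)" using 1(2) 2(2) by simp
    moreover have "\<forall>i>max N M. s'' i = s i" using 1(4) 2(4) by simp
    ultimately show "\<exists>t s'. exec (Seq c d) s t s' \<and> t \<le> T x + U (f x) \<and> s' 0 = enc (g (f x)) \<and> (\<forall>i>max N M. s' i = s i)"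
      using exec.Seq[OF 1(1) 2(1)] 2(3) by blast
  qed
qed

lemma pt_pair:
  fixes f :: "'a::encodable \<Rightarrow> 'b::encodable" and g :: "'a \<Rightarrow> 'c::encodable"
  assumes "poly_time f" "poly_time g"
  shows "poly_time (\<lambda>x. (f x, g x))"
proof -
  obtain c N T where f: "poly_bounded T" "\<And>x. ssize (f x) \<le> T x"
    "\<And>x s. s 0 = enc x \<Longrightarrow> \<exists>t s'. exec c s t s' \<and> t \<le> T x \<and> s' 0 = enc (f x) \<and> (\<forall>i>N. s' i = s i)"
    by (rule ptE[OF assms(1)]) (rule that)
  obtain d M U where g: "poly_bounded U" "\<And>x. ssize (g x) \<le> U x"
    "\<And>x s. s 0 = enc x \<Longrightarrow> \<exists>t s'. exec d s t s' \<and> t \<le> U x \<and> s' 0 = enc (g x) \<and> (\<forall>i>M. s' i = s i)"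
    by (rule ptE[OF assms(2)]) (rule that)
  let ?y = "max N M + 1" and ?z = "max N M + 2"
  let ?T = "\<lambda>x. 5 + 2 * ssize x + 4 * T x + 4 * U x"
  let ?c = "Seq (Assign ?y (Var 0)) (Seq c (Seq (Assign ?z (Var 0)) (Seq (Assign 0 (Var ?y))
     (Seq d (Assign 0 (Cons_Of (Var ?z) (Var 0)))))))"
  show ?thesis
  proof (rule ptI[of ?T _ ?c ?z])
    show "poly_bounded ?T" by (intro pb_intros f g)
    show "ssize (f x, g x) \<le> ?T x" for x using f(2)[of x] g(2)[of x] by simp
    fix x :: 'a and s :: store assume s0: "s 0 = enc x"
    let ?s1 = "s(?y := enc x)"
    have e1: "exec (Assign ?y (Var 0)) s (1 + ssize x) ?s1"
      by (rule exec_assign) (simp_all add: s0 ssize_def)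
    have z1: "?s1 0 = enc x" using s0 by simp
    obtain t s2 where e2: "exec c ?s1 t s2" "t \<le> T x" "s2 0 = enc (f x)" "\<forall>i>N. s2 i = ?s1 i"
      using f(3)[of ?s1 x, OF z1] by blast
    let ?s3 = "s2(?z := enc (f x))"
    have e3: "exec (Assign ?z (Var 0)) s2 (1 + ssize (f x)) ?s3"
      by (rule exec_assign) (simp_all add: e2(3) ssize_def)
    let ?s4 = "?s3(0 := enc x)"
    have y2: "s2 ?y = enc x" using e2(4) by simp
    have e4: "exec (Assign 0 (Var ?y)) ?s3 (1 + ssize x) ?s4"
      by (rule exec_assign) (simp_all add: y2[simplified] ssize_def)
    obtain u s5 where e5: "exec d ?s4 u s5" "u \<le> U x" "s5 0 = enc (g x)" "\<forall>i>M. s5 i = ?s4 i"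
      using g(3)[of ?s4 x, OF fun_upd_same] by blast
    have z5: "s5 ?z = enc (f x)" using e5(4) by simp
    let ?s6 = "s5(0 := enc (f x, g x))"
    have e6: "exec (Assign 0 (Cons_Of (Var ?z) (Var 0))) s5 (1 + (1 + ssize (f x) + ssize (g x))) ?s6"
      by (rule exec_assign) (simp_all only: val.simps cost.simps e5(3) z5 enc_simps ssize_def)
    have fr: "\<forall>i>?z. ?s6 i = s i" using e5(4) e2(4) by simp
    note ex = exec.Seq[OF e1 exec.Seq[OF e2(1) exec.Seq[OF e3 exec.Seq[OF e4 exec.Seq[OF e5(1) e6]]]]]
    have "1 + ssize x + (t + (1 + ssize (f x) + (1 + ssize x + (u + (1 + (1 + ssize (f x) + ssize (g x))))))) \<le> ?T x"
      using e2(2) e5(2) f(2)[of x] g(2)[of x] by simp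
    then show "\<exists>t s'. exec ?c s t s' \<and> t \<le> ?T x \<and> s' 0 = enc (f x, g x) \<and> (\<forall>i>?z. s' i = s i)"
      by (rule exec_ex[OF ex _ _ fr]) simp
  qed
qed

lemma pt_if:
  fixes f :: "'a::encodable \<Rightarrow> 'b::encodable"
  assumes "poly_time b" "poly_time f" "poly_time g"
  shows "poly_time (\<lambda>x. if b x then f x else g x)"
proof -
  obtain c0 N0 T0 where b: "poly_bounded T0" "\<And>x. ssize (b x) \<le> T0 x"
    "\<And>x s. s 0 = enc x \<Longrightarrow> \<exists>t s'. exec c0 s t s' \<and> t \<le> T0 x \<and> s' 0 = enc (b x) \<and> (\<forall>i>N0. s' i = s i)"
    by (rule ptE[OF assms(1)]) (rule that)
  obtain c N T where f: "poly_bounded T" "\<And>x. ssize (f x) \<le> T x"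
    "\<And>x s. s 0 = enc x \<Longrightarrow> \<exists>t s'. exec c s t s' \<and> t \<le> T x \<and> s' 0 = enc (f x) \<and> (\<forall>i>N. s' i = s i)"
    by (rule ptE[OF assms(2)]) (rule that)
  obtain d M U where g: "poly_bounded U" "\<And>x. ssize (g x) \<le> U x"
    "\<And>x s. s 0 = enc x \<Longrightarrow> \<exists>t s'. exec d s t s' \<and> t \<le> U x \<and> s' 0 = enc (g x) \<and> (\<forall>i>M. s' i = s i)"
    by (rule ptE[OF assms(3)]) (rule that)
  let ?y = "max N0 (max N M) + 1"
  let ?r = "Assign 0 (Var ?y)"
  let ?c = "Seq (Assign ?y (Var 0)) (Seq c0 (Cond (Var 0) (Seq ?r c) (Seq ?r d)))"
  let ?T = "\<lambda>x. 6 + 2 * ssize x + T0 x + T x + U x"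
  show ?thesis
  proof (rule ptI[of ?T _ ?c ?y])
    show "poly_bounded ?T" by (intro pb_intros f g b)
    show "ssize (if b x then f x else g x) \<le> ?T x" for x using f(2)[of x] g(2)[of x] by auto
    fix x :: 'a and s :: store assume s0: "s 0 = enc x"
    let ?s1 = "s(?y := enc x)"
    have e1: "exec (Assign ?y (Var 0)) s (1 + ssize x) ?s1"
      by (rule exec_assign) (simp_all add: s0 ssize_def)
    have z1: "?s1 0 = enc x" using s0 by simp
    obtain t s2 where e2: "exec c0 ?s1 t s2" "t \<le> T0 x" "s2 0 = enc (b x)" "\<forall>i>N0. s2 i = ?s1 i"
      using b(3)[of ?s1 x, OF z1] by blast
    let ?s4 = "s2(0 := enc x)"
    have y2: "s2 ?y = enc x" using e2(4) by simp
    have e4: "exec ?r s2 (1 + ssize x) ?s4"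
      by (rule exec_assign) (simp_all add: y2[simplified] ssize_def)
    have c: "cost (Var 0) s2 \<le> 3" using e2(3) ssize_bool[of "b x"] by (simp add: ssize_def)
    show "\<exists>t s'. exec ?c s t s' \<and> t \<le> ?T x \<and> s' 0 = enc (if b x then f x else g x) \<and> (\<forall>i>?y. s' i = s i)"
    proof (cases "b x")
      case True
      obtain u s5 where e5: "exec c ?s4 u s5" "u \<le> T x" "s5 0 = enc (f x)" "\<forall>i>N. s5 i = ?s4 i"
        using f(3)[of ?s4 x, OF fun_upd_same] by blast
      have v: "val (Var 0) s2 \<noteq> Atom" using e2(3) True by simp
      note ex = exec.Seq[OF e1 exec.Seq[OF e2(1) exec.Cond_True[OF v exec.Seq[OF e4 e5(1)]]]]
      have "1 + ssize x + (t + (1 + cost (Var 0) s2 + (1 + ssize x + u))) \<le> ?T x" using e2(2) e5(2) c by linarith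
      moreover have "\<forall>i>?y. s5 i = s i" using e5(4) e2(4) by simp
      moreover have "s5 0 = enc (if b x then f x else g x)" using e5(3) True by simp
      ultimately show ?thesis by (intro exec_ex[OF ex])
    next
      case False
      obtain u s5 where e5: "exec d ?s4 u s5" "u \<le> U x" "s5 0 = enc (g x)" "\<forall>i>M. s5 i = ?s4 i"
        using g(3)[of ?s4 x, OF fun_upd_same] by blast
      have v: "val (Var 0) s2 = Atom" using e2(3) False by simp
      note ex = exec.Seq[OF e1 exec.Seq[OF e2(1) exec.Cond_False[OF v exec.Seq[OF e4 e5(1)]]]]
      have "1 + ssize x + (t + (1 + cost (Var 0) s2 + (1 + ssize x + u))) \<le> ?T x" using e2(2) e5(2) c by linarith
      moreover have "\<forall>i>?y. s5 i = s i" using e5(4) e2(4) by simp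
      moreover have "s5 0 = enc (if b x then f x else g x)" using e5(3) False by simp
      ultimately show ?thesis by (intro exec_ex[OF ex])
    qed
  qed
qed

lemma pt_case_list0:
  fixes n :: "'a::encodable \<Rightarrow> 'c::encodable" and c :: "'a \<times> 'b::encodable \<times> 'b list \<Rightarrow> 'c"
  assumes "poly_time n" "poly_time c"
  shows "poly_time (\<lambda>z. case snd z of [] \<Rightarrow> n (fst z) | y # ys \<Rightarrow> c (fst z, y, ys))"
proof -
  obtain cn N T where f: "poly_bounded T" "\<And>x. ssize (n x) \<le> T x"
    "\<And>x s. s 0 = enc x \<Longrightarrow> \<exists>t s'. exec cn s t s' \<and> t \<le> T x \<and> s' 0 = enc (n x) \<and> (\<forall>i>N. s' i = s i)"
    by (rule ptE[OF assms(1)]) (rule that)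
  obtain d M U where g: "poly_bounded U" "\<And>x. ssize (c x) \<le> U x"
    "\<And>x s. s 0 = enc x \<Longrightarrow> \<exists>t s'. exec d s t s' \<and> t \<le> U x \<and> s' 0 = enc (c x) \<and> (\<forall>i>M. s' i = s i)"
    by (rule ptE[OF assms(2)]) (rule that)
  obtain p where p: "\<And>x. U x \<le> poly p (ssize x)" using g(1) unfolding poly_bounded_def by blast
  let ?c = "Cond (Tl_Of (Var 0)) d (Seq (Assign 0 (Hd_Of (Var 0))) cn)"
  let ?T = "\<lambda>z. 10 + 2 * ssize z + T (fst z) + poly p (ssize z)"
  have sz: "U (a, y, ys) \<le> poly p (ssize (a, y # ys))" for a y ys
    using p[of "(a, y, ys)"] by (simp add: ssize_def)
  show ?thesis
  proof (rule ptI[of ?T _ ?c "max N M"])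
    show "poly_bounded ?T" by (intro pb_intros f pb_comp[OF f(1) pt_fst0])
    show "ssize (case snd z of [] \<Rightarrow> n (fst z) | y # ys \<Rightarrow> c (fst z, y, ys)) \<le> ?T z" for z
    proof (cases z)
      case (Pair a l)
      then show ?thesis using f(2)[of a] order_trans[OF g(2) sz] by (cases l) (auto simp del: ssize_simps intro: trans_le_add2)
    qed
    fix z :: "'a \<times> 'b list" and s :: store assume s0: "s 0 = enc z"
    obtain a l where z: "z = (a, l)" by (cases z)
    have ck: "cost (Tl_Of (Var 0)) s = 1 + ssize z" using s0 by (simp add: ssize_def)
    show "\<exists>t s'. exec ?c s t s' \<and> t \<le> ?T z \<and>
      s' 0 = enc (case snd z of [] \<Rightarrow> n (fst z) | y # ys \<Rightarrow> c (fst z, y, ys)) \<and> (\<forall>i>max N M. s' i = s i)"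
    proof (cases l)
      case Nil
      let ?s4 = "s(0 := enc a)"
      have e4: "exec (Assign 0 (Hd_Of (Var 0))) s (1 + (1 + ssize z)) ?s4"
        by (rule exec_assign) (simp_all add: s0 z ssize_def)
      obtain u s5 where e5: "exec cn ?s4 u s5" "u \<le> T a" "s5 0 = enc (n a)" "\<forall>i>N. s5 i = ?s4 i"
        using f(3)[of ?s4 a, OF fun_upd_same] by blast
      have v: "val (Tl_Of (Var 0)) s = Atom" using s0 z Nil by simp
      note ex = exec.Cond_False[OF v exec.Seq[OF e4 e5(1)], of d]
      have "1 + cost (Tl_Of (Var 0)) s + (1 + (1 + ssize z) + u) \<le> ?T z" using e5(2) z unfolding ck by simp
      moreover have "\<forall>i>max N M. s5 i = s i" using e5(4) by simp
      moreover have "s5 0 = enc (case snd z of [] \<Rightarrow> n (fst z) | y # ys \<Rightarrow> c (fst z, y, ys))"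
        using e5(3) Nil z by simp
      ultimately show ?thesis by (intro exec_ex[OF ex])
    next
      case (Cons y ys)
      have "s 0 = enc (a, y, ys)" using s0 z Cons by simp
      then obtain u s5 where e5: "exec d s u s5" "u \<le> U (a, y, ys)" "s5 0 = enc (c (a, y, ys))" "\<forall>i>M. s5 i = s i"
        using g(3) by blast
      have v: "val (Tl_Of (Var 0)) s \<noteq> Atom" using s0 z Cons by simp
      note ex = exec.Cond_True[OF v e5(1), of "Seq (Assign 0 (Hd_Of (Var 0))) cn"]
      have "1 + cost (Tl_Of (Var 0)) s + u \<le> ?T z" using e5(2) sz[of a y ys] unfolding ck z Cons by linarith
      moreover have "\<forall>i>max N M. s5 i = s i" using e5(4) by simp
      moreover have "s5 0 = enc (case snd z of [] \<Rightarrow> n (fst z) | y # ys \<Rightarrow> c (fst z, y, ys))"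
        using e5(3) Cons z by simp
      ultimately show ?thesis by (intro exec_ex[OF ex])
    qed
  qed
qed

text \<open>Numbers and lists alike are encoded as right spines, whose length counts the iterations of a loop.\<close>

fun dlen :: "data \<Rightarrow> nat" where
  "dlen Atom = 0"
| "dlen (Pair a b) = Suc (dlen b)"

lemma dlen_nat [simp]: "dlen (enc (n::nat)) = n" by (induction n) auto
lemma dlen_list [simp]: "dlen (enc xs) = length xs" by (induction xs) auto
lemma dlen_le: "dlen d \<le> dsize d" by (induction d) auto

lemma loop_runs:
  fixes F :: "'a::encodable \<Rightarrow> 'a"
  assumes body: "\<And>x s. s 0 = enc x \<Longrightarrow> \<exists>t s'. exec c s t s' \<and> t \<le> T x \<and> s' 0 = enc (F x) \<and> (\<forall>i>N. s' i = s i)"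
    and bound: "\<And>j. j \<le> dlen d \<Longrightarrow> T ((F ^^ j) x) \<le> M" and L: "dsize d \<le> L"
    and s: "s 0 = enc x" "s (Suc N) = d"
  shows "\<exists>t s'. exec (While (Var (Suc N)) (Seq c (Assign (Suc N) (Tl_Of (Var (Suc N)))))) s t s' \<and>
    t \<le> (dlen d + 1) * (4 + 2 * L + M) \<and> s' 0 = enc ((F ^^ dlen d) x) \<and> (\<forall>i>Suc N. s' i = s i)"
  using bound L s
proof (induction d arbitrary: x s)
  case Atom
  have "exec (While (Var (Suc N)) (Seq c (Assign (Suc N) (Tl_Of (Var (Suc N)))))) s (1 + cost (Var (Suc N)) s) s"
    by (rule exec.While_False) (use Atom in simp)
  moreover have "1 + cost (Var (Suc N)) s \<le> (dlen Atom + 1) * (4 + 2 * L + M)" using Atom by simp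
  moreover have "s 0 = enc ((F ^^ dlen Atom) x)" using Atom by simp
  ultimately show ?case by (rule exec_ex) blast
next
  case (Pair a d)
  obtain t s1 where e1: "exec c s t s1" "t \<le> T x" "s1 0 = enc (F x)" "\<forall>i>N. s1 i = s i"
    using body[of s x, OF Pair.prems(3)] by blast
  let ?s2 = "s1(Suc N := d)"
  have sN: "s1 (Suc N) = Pair a d" using e1(4) Pair.prems(4) by simp
  have e2: "exec (Assign (Suc N) (Tl_Of (Var (Suc N)))) s1 (1 + (1 + dsize (Pair a d))) ?s2"
    by (rule exec_assign) (simp_all add: sN)
  have ex: "\<exists>t s'. exec (While (Var (Suc N)) (Seq c (Assign (Suc N) (Tl_Of (Var (Suc N)))))) ?s2 t s' \<and>
    t \<le> (dlen d + 1) * (4 + 2 * L + M) \<and> s' 0 = enc ((F ^^ dlen d) (F x)) \<and> (\<forall>i>Suc N. s' i = ?s2 i)"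
  proof (rule Pair.IH(2))
    show "T ((F ^^ j) (F x)) \<le> M" if "j \<le> dlen d" for j
      using Pair.prems(1)[of "Suc j"] that by (simp add: funpow_swap1)
    show "dsize d \<le> L" using Pair.prems(2) by simp
    show "?s2 0 = enc (F x)" using e1(3) by simp
    show "?s2 (Suc N) = d" by simp
  qed
  then obtain u s3 where e3: "exec (While (Var (Suc N)) (Seq c (Assign (Suc N) (Tl_Of (Var (Suc N)))))) ?s2 u s3"
    "u \<le> (dlen d + 1) * (4 + 2 * L + M)" "s3 0 = enc ((F ^^ dlen d) (F x))" "\<forall>i>Suc N. s3 i = ?s2 i" by blast
  have v: "val (Var (Suc N)) s \<noteq> Atom" using Pair.prems(4) by simp
  note w = exec.While_True[OF v exec.Seq[OF e1(1) e2] e3(1)]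
  have TM: "T x \<le> M" using Pair.prems(1)[of 0] by simp
  have "1 + cost (Var (Suc N)) s + (t + (1 + (1 + dsize (Pair a d)))) + u \<le> (dlen (Pair a d) + 1) * (4 + 2 * L + M)"
    using e1(2) e3(2) TM Pair.prems(2,4) by simp
  moreover have "s3 0 = enc ((F ^^ dlen (Pair a d)) x)" using e3(3) by (simp add: funpow_swap1)
  moreover have "\<forall>i>Suc N. s3 i = s i" using e3(4) e1(4) by simp
  ultimately show ?case by (intro exec_ex[OF w])
qed

text \<open>The size bound on all intermediate states is essential: iteration preserves polynomial time only if the states stay polynomially
  small.\<close>

lemma pt_loop0:
  fixes F :: "'a::encodable \<Rightarrow> 'a" and h :: "'x::encodable \<Rightarrow> 'l::encodable"
  assumes F: "poly_time F" and h: "poly_time h" and g: "poly_time g" and b: "poly_bounded b"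
    and bound: "\<And>x j. j \<le> dlen (enc (h x)) \<Longrightarrow> ssize ((F ^^ j) (g x)) \<le> b x"
  shows "poly_time (\<lambda>x. (F ^^ dlen (enc (h x))) (g x))"
proof -
  obtain c N T where f: "poly_bounded T" "\<And>x. ssize (F x) \<le> T x"
    "\<And>x s. s 0 = enc x \<Longrightarrow> \<exists>t s'. exec c s t s' \<and> t \<le> T x \<and> s' 0 = enc (F x) \<and> (\<forall>i>N. s' i = s i)"
    by (rule ptE[OF F]) (rule that)
  obtain p where p: "\<And>x. T x \<le> poly p (ssize x)" using f(1) unfolding poly_bounded_def by blast
  obtain d M U where gh: "poly_bounded U" "\<And>x. ssize (h x, g x) \<le> U x"
    "\<And>x s. s 0 = enc x \<Longrightarrow> \<exists>t s'. exec d s t s' \<and> t \<le> U x \<and> s' 0 = enc (h x, g x) \<and> (\<forall>i>M. s' i = s i)"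
    by (rule ptE[OF pt_pair[OF h g]]) (rule that)
  let ?y = "Suc N"
  let ?w = "While (Var ?y) (Seq c (Assign ?y (Tl_Of (Var ?y))))"
  let ?c = "Seq d (Seq (Assign ?y (Hd_Of (Var 0))) (Seq (Assign 0 (Tl_Of (Var 0))) ?w))"
  let ?M = "\<lambda>x. poly p (b x)"
  let ?T = "\<lambda>x. 4 + 3 * U x + (U x + 1) * (4 + 2 * U x + ?M x) + b x"
  show ?thesis
  proof (rule ptI[of ?T _ ?c "max M ?y"])
    show "poly_bounded ?T" by (intro pb_intros gh b)
    show "ssize ((F ^^ dlen (enc (h x))) (g x)) \<le> ?T x" for x using bound[of "dlen (enc (h x))" x] by simp
    fix x :: 'x and s :: store assume s0: "s 0 = enc x"
    obtain t s1 where e1: "exec d s t s1" "t \<le> U x" "s1 0 = enc (h x, g x)" "\<forall>i>M. s1 i = s i"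
      using gh(3)[of s x, OF s0] by blast
    let ?s2 = "s1(?y := enc (h x))"
    have e2: "exec (Assign ?y (Hd_Of (Var 0))) s1 (1 + (1 + ssize (h x, g x))) ?s2"
      by (rule exec_assign) (simp_all add: e1(3) ssize_def)
    let ?s3 = "?s2(0 := enc (g x))"
    have e3: "exec (Assign 0 (Tl_Of (Var 0))) ?s2 (1 + (1 + ssize (h x, g x))) ?s3"
      by (rule exec_assign) (simp_all add: e1(3) ssize_def)
    have "\<exists>t s'. exec ?w ?s3 t s' \<and> t \<le> (dlen (enc (h x)) + 1) * (4 + 2 * U x + ?M x) \<and>
      s' 0 = enc ((F ^^ dlen (enc (h x))) (g x)) \<and> (\<forall>i>Suc N. s' i = ?s3 i)"
    proof (rule loop_runs[OF f(3)])
      show "T ((F ^^ j) (g x)) \<le> ?M x" if "j \<le> dlen (enc (h x))" for j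
        using p[of "(F ^^ j) (g x)"] poly_nat_mono[OF bound[OF that], of p] by linarith
      show "dsize (enc (h x)) \<le> U x" using gh(2)[of x] by (simp add: ssize_def)
    qed auto
    then obtain u s4 where e4: "exec ?w ?s3 u s4" "u \<le> (dlen (enc (h x)) + 1) * (4 + 2 * U x + ?M x)"
      "s4 0 = enc ((F ^^ dlen (enc (h x))) (g x))" "\<forall>i>Suc N. s4 i = ?s3 i" by blast
    note ex = exec.Seq[OF e1(1) exec.Seq[OF e2 exec.Seq[OF e3 e4(1)]]]
    have "dlen (enc (h x)) \<le> U x" using dlen_le[of "enc (h x)"] gh(2)[of x] by (simp add: ssize_def)
    then have "u \<le> (U x + 1) * (4 + 2 * U x + ?M x)" using e4(2) by (meson add_le_mono1 mult_le_mono1 order_trans)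
    then have "t + (1 + (1 + ssize (h x, g x)) + (1 + (1 + ssize (h x, g x)) + u)) \<le> ?T x"
      using e1(2) gh(2)[of x] by linarith
    moreover have "\<forall>i>max M ?y. s4 i = s i" using e4(4) e1(4) by simp
    ultimately show "\<exists>t s'. exec ?c s t s' \<and> t \<le> ?T x \<and> s' 0 = enc ((F ^^ dlen (enc (h x))) (g x)) \<and> (\<forall>i>max M ?y. s' i = s i)"
      using e4(3) by (intro exec_ex[OF ex])
  qed
qed

section \<open>List and number functions in polynomial time\<close>

lemma pt_fst: "poly_time f \<Longrightarrow> poly_time (\<lambda>x. fst (f x))" by (rule pt_comp[OF _ pt_fst0])
lemma pt_snd: "poly_time f \<Longrightarrow> poly_time (\<lambda>x. snd (f x))" by (rule pt_comp[OF _ pt_snd0])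
lemma pt_Suc: "poly_time f \<Longrightarrow> poly_time (\<lambda>x. Suc (f x))" by (rule pt_comp[OF _ pt_Suc0])

lemma pt2:
  assumes "poly_time (\<lambda>z. F (fst z) (snd z))" "poly_time a" "poly_time b"
  shows "poly_time (\<lambda>x. F (a x) (b x))"
  using pt_comp[OF pt_pair[OF assms(2,3)] assms(1)] by simp

lemma pt3:
  assumes "poly_time (\<lambda>z. F (fst z) (fst (snd z)) (snd (snd z)))" "poly_time a" "poly_time b" "poly_time c"
  shows "poly_time (\<lambda>x. F (a x) (b x) (c x))"
  using pt_comp[OF pt_pair[OF assms(2) pt_pair[OF assms(3,4)]] assms(1)] by simp

lemma pt_Cons: "poly_time f \<Longrightarrow> poly_time g \<Longrightarrow> poly_time (\<lambda>x. f x # g x)"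
  by (rule pt2[OF pt_Cons0])

lemma pt_Let:
  assumes "poly_time a" "poly_time (\<lambda>z. F (fst z) (snd z))"
  shows "poly_time (\<lambda>x. let y = a x in F x y)"
  unfolding Let_def by (rule pt2[OF assms(2) pt_id assms(1)])

lemma pt_case_list:
  assumes "poly_time l" "poly_time n" "poly_time (\<lambda>z. c (fst z) (fst (snd z)) (snd (snd z)))"
  shows "poly_time (\<lambda>x. case l x of [] \<Rightarrow> n x | y # ys \<Rightarrow> c x y ys)"
  using pt_comp[OF pt_pair[OF pt_id assms(1)] pt_case_list0[OF assms(2,3)]]
  by (rule back_subst[of poly_time]) (auto split: list.splits)

text \<open>The body may use the original argument \<open>x\<close>, which is carried along as part of the state.\<close>

lemma pt_loop:
  fixes F :: "'x::encodable \<Rightarrow> 's::encodable \<Rightarrow> 's" and h :: "'x \<Rightarrow> 'l::encodable"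
  assumes F: "poly_time (\<lambda>z. F (fst z) (snd z))" and h: "poly_time h" and g: "poly_time g" and b: "poly_bounded b"
    and bound: "\<And>x j. j \<le> dlen (enc (h x)) \<Longrightarrow> ssize ((F x ^^ j) (g x)) \<le> b x"
  shows "poly_time (\<lambda>x. (F x ^^ dlen (enc (h x))) (g x))"
proof -
  let ?F = "\<lambda>z. (fst z, F (fst z) (snd z))"
  have it: "(?F ^^ j) (x, s) = (x, (F x ^^ j) s)" for j x s by (induction j) auto
  have "poly_time (\<lambda>x. (?F ^^ dlen (enc (h x))) ((\<lambda>x. (x, g x)) x))"
  proof (rule pt_loop0[OF pt_pair[OF pt_fst[OF pt_id] F] h pt_pair[OF pt_id g]])
    show "poly_bounded (\<lambda>x. 1 + ssize x + b x)" by (intro pb_intros b)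
    show "ssize ((?F ^^ j) (x, g x)) \<le> 1 + ssize x + b x" if "j \<le> dlen (enc (h x))" for x j
      using bound[OF that] unfolding it by simp
  qed
  from pt_snd[OF this] show ?thesis unfolding it by simp
qed

lemma pt_iter:
  fixes F :: "'x::encodable \<Rightarrow> 's::encodable \<Rightarrow> 's"
  assumes F: "poly_time (\<lambda>z. F (fst z) (snd z))" and h: "poly_time h" and g: "poly_time g" and b: "poly_bounded b"
    and bound: "\<And>x j. j \<le> h x \<Longrightarrow> ssize ((F x ^^ j) (g x)) \<le> b x"
  shows "poly_time (\<lambda>x. (F x ^^ h x) (g x))"
  using pt_loop[OF F h g b] bound by simp

text \<open>The list that is still to be processed is part of the state of the loop.\<close>

lemma pt_fold:
  fixes f :: "'x::encodable \<Rightarrow> 'y::encodable \<Rightarrow> 's::encodable \<Rightarrow> 's"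
  assumes f: "poly_time (\<lambda>z. f (fst z) (fst (snd z)) (snd (snd z)))" and xs: "poly_time xs" and g: "poly_time g" and b: "poly_bounded b"
    and bound: "\<And>x j. j \<le> length (xs x) \<Longrightarrow> ssize (fold (f x) (take j (xs x)) (g x)) \<le> b x"
  shows "poly_time (\<lambda>x. fold (f x) (xs x) (g x))"
proof -
  define F where "F x z = (case fst z of [] \<Rightarrow> z | y # ys \<Rightarrow> (ys, f x y (snd z)))" for x z
  have it: "(F x ^^ j) (ys, s) = (drop j ys, fold (f x) (take j ys) s)" for j x ys s
  proof (induction j arbitrary: ys s)
    case (Suc j)
    have "(F x ^^ Suc j) (ys, s) = (F x ^^ j) (F x (ys, s))" by (simp only: funpow_Suc_right o_apply)
    also have "F x (ys, s) = (case ys of [] \<Rightarrow> (ys, s) | y # zs \<Rightarrow> (zs, f x y s))" by (cases ys) (simp_all add: F_def)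
    finally show ?case by (cases ys) (simp_all add: Suc)
  qed simp
  have ptF: "poly_time (\<lambda>z. F (fst z) (snd z))"
    unfolding F_def
    by (intro pt_case_list pt_pair pt_fst pt_snd pt_id
        pt3[of f, OF f])
  have "poly_time (\<lambda>x. (F x ^^ dlen (enc (xs x))) ((\<lambda>x. (xs x, g x)) x))"
  proof (rule pt_loop[OF ptF xs pt_pair[OF xs g]])
    show "poly_bounded (\<lambda>x. 1 + ssize (xs x) + b x)" by (intro pb_intros b pt_size xs)
    show "ssize ((F x ^^ j) (xs x, g x)) \<le> 1 + ssize (xs x) + b x" if "j \<le> dlen (enc (xs x))" for x j
    proof -
      have "ssize (drop j (xs x)) \<le> ssize (xs x)"
        using ssize_append[of "take j (xs x)" "drop j (xs x)"] ssize_pos[of "take j (xs x)"] by simp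
      then show ?thesis using bound[of j x] that unfolding it by simp
    qed
  qed
  from pt_snd[OF this] show ?thesis unfolding it by simp
qed

lemma pt_rev: assumes "poly_time xs" shows "poly_time (\<lambda>x. rev (xs x))"
proof -
  have r: "fold (\<lambda>y s. y # s) ys [] = rev ys" for ys by (simp add: fold_Cons_rev)
  have "poly_time (\<lambda>x. fold (\<lambda>y s. y # s) (xs x) [])"
  proof (rule pt_fold[OF _ assms pt_const])
    show "poly_bounded (\<lambda>x. ssize (xs x))" by (rule pt_size[OF assms])
    show "ssize (fold (\<lambda>y s. y # s) (take j (xs x)) []) \<le> ssize (xs x)" for j x
      unfolding r using ssize_take by simp
  qed (intro pt_Cons pt_fst pt_snd pt_id)
  then show ?thesis unfolding r .
qed

lemma pt_foldr:
  fixes f :: "'x::encodable \<Rightarrow> 'y::encodable \<Rightarrow> 's::encodable \<Rightarrow> 's"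
  assumes f: "poly_time (\<lambda>z. f (fst z) (fst (snd z)) (snd (snd z)))" and xs: "poly_time xs" and g: "poly_time g" and b: "poly_bounded b"
    and bound: "\<And>x ys. set ys \<subseteq> set (xs x) \<Longrightarrow> length ys \<le> length (xs x) \<Longrightarrow> ssize ys \<le> ssize (xs x) \<Longrightarrow> ssize (foldr (f x) ys (g x)) \<le> b x"
  shows "poly_time (\<lambda>x. foldr (f x) (xs x) (g x))"
proof -
  have "poly_time (\<lambda>x. fold (f x) (rev (xs x)) (g x))"
  proof (rule pt_fold[OF f pt_rev[OF xs] g b])
    fix x j
    let ?ys = "rev (take j (rev (xs x)))"
    have "fold (f x) (take j (rev (xs x))) (g x) = foldr (f x) ?ys (g x)" by (simp add: foldr_conv_fold)
    moreover have "ssize ?ys \<le> ssize (xs x)" using ssize_take[of j "rev (xs x)"] by simp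
    moreover have "set ?ys \<subseteq> set (xs x)" using set_take_subset[of j "rev (xs x)"] by simp
    moreover have "length ?ys \<le> length (xs x)" by simp
    ultimately show "ssize (fold (f x) (take j (rev (xs x))) (g x)) \<le> b x" using bound by metis
  qed
  then show ?thesis by (simp add: foldr_conv_fold)
qed

text \<open>The size of the result is bounded because each entry of the list is no larger than the list.\<close>

lemma pt_map:
  fixes f :: "'x::encodable \<Rightarrow> 'y::encodable \<Rightarrow> 's::encodable"
  assumes f: "poly_time (\<lambda>z. f (fst z) (snd z))" and xs: "poly_time xs"
  shows "poly_time (\<lambda>x. map (f x) (xs x))"
proof -
  obtain p where p: "\<And>z. ssize (f (fst z) (snd z)) \<le> poly p (ssize z)"
    using pt_size[OF f] unfolding poly_bounded_def by blast
  let ?m = "\<lambda>x. poly p (1 + ssize x + ssize (xs x))"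
  have m: "map g ys = foldr (\<lambda>y s. g y # s) ys []" for g :: "'y \<Rightarrow> 's" and ys by (induction ys) auto
  have "poly_time (\<lambda>x. foldr (\<lambda>y s. f x y # s) (xs x) [])"
  proof (rule pt_foldr[OF _ xs pt_const])
    show "poly_time (\<lambda>z. f (fst z) (fst (snd z)) # snd (snd z))"
      by (intro pt_Cons pt_fst pt_snd pt_id pt2[of f, OF f])
    show "poly_bounded (\<lambda>x. 1 + ssize (xs x) * (1 + ?m x))" by (intro pb_intros pt_size xs)
    fix x ys assume ys: "set ys \<subseteq> set (xs x)" "length ys \<le> length (xs x)"
    have "ssize (map (f x) ys) \<le> 1 + length (map (f x) ys) * (1 + ?m x)"
    proof (rule ssize_list_le)
      fix u assume "u \<in> set (map (f x) ys)"
      then obtain y where y: "y \<in> set (xs x)" "u = f x y" using ys by auto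
      have "ssize u \<le> poly p (ssize (x, y))" using p[of "(x, y)"] y by simp
      also have "\<dots> \<le> ?m x" by (rule poly_nat_mono) (use ssize_member[OF y(1)] in simp)
      finally show "ssize u \<le> ?m x" .
    qed
    also have "\<dots> \<le> 1 + ssize (xs x) * (1 + ?m x)"
    proof -
      have "length (map (f x) ys) \<le> ssize (xs x)" using ys(2) length_ssize[of "xs x"] by simp
      then show ?thesis by (intro add_left_mono mult_right_mono) auto
    qed
    finally show "ssize (foldr (\<lambda>y s. f x y # s) ys []) \<le> 1 + ssize (xs x) * (1 + ?m x)"
      unfolding m .
  qed
  then show ?thesis unfolding m .
qed

lemma ssize_filter: "ssize (filter P xs) \<le> ssize xs" by (induction xs) auto

lemma pt_filter:
  fixes P :: "'x::encodable \<Rightarrow> 'y::encodable \<Rightarrow> bool"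
  assumes P: "poly_time (\<lambda>z. P (fst z) (snd z))" and xs: "poly_time xs"
  shows "poly_time (\<lambda>x. filter (P x) (xs x))"
proof -
  have m: "filter Q ys = foldr (\<lambda>y s. if Q y then y # s else s) ys []" for Q :: "'y \<Rightarrow> bool" and ys by (induction ys) auto
  have "poly_time (\<lambda>x. foldr (\<lambda>y s. if P x y then y # s else s) (xs x) [])"
  proof (rule pt_foldr[OF _ xs pt_const])
    show "poly_time (\<lambda>z. if P (fst z) (fst (snd z)) then fst (snd z) # snd (snd z) else snd (snd z))"
      by (intro pt_if pt_Cons pt_fst pt_snd pt_id pt2[of P, OF P])
    show "poly_bounded (\<lambda>x. ssize (xs x))" by (rule pt_size[OF xs])
    show "ssize (foldr (\<lambda>y s. if P x y then y # s else s) ys []) \<le> ssize (xs x)"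
      if "ssize ys \<le> ssize (xs x)" for x ys
      unfolding m[symmetric] using ssize_filter[of "P x" ys] that by linarith
  qed
  then show ?thesis unfolding m .
qed

lemma pt_length:
  fixes xs :: "'x::encodable \<Rightarrow> 'a::encodable list"
  assumes "poly_time xs" shows "poly_time (\<lambda>x. length (xs x))"
proof -
  have m: "fold (\<lambda>_ s. Suc s) ys n = length ys + n" for ys :: "'a list" and n by (induction ys arbitrary: n) auto
  have "poly_time (\<lambda>x. fold (\<lambda>_ s. Suc s) (xs x) 0)"
  proof (rule pt_fold[OF _ assms pt_const])
    show "poly_bounded (\<lambda>x. 2 * ssize (xs x) + 1)" by (intro pb_intros pt_size assms)
    show "ssize (fold (\<lambda>_ s. Suc s) (take j (xs x)) 0) \<le> 2 * ssize (xs x) + 1" for j x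
      unfolding m using length_ssize[of "xs x"] by simp
  qed (intro pt_Suc pt_fst pt_snd pt_id)
  then show ?thesis unfolding m by simp
qed

lemma pt_add: assumes "poly_time f" "poly_time g" shows "poly_time (\<lambda>x. f x + (g x :: nat))"
proof -
  have m: "(Suc ^^ j) n = j + n" for j n by (induction j) auto
  have "poly_time (\<lambda>x. (Suc ^^ f x) (g x))"
  proof (rule pt_iter[where F = "\<lambda>_. Suc", OF _ assms])
    show "poly_bounded (\<lambda>x. ssize (f x) + ssize (g x))" by (intro pb_intros pt_size assms)
    show "poly_time (\<lambda>z. Suc (snd z))" by (intro pt_Suc pt_snd pt_id)
  qed (simp add: m)
  then show ?thesis unfolding m .
qed

lemma pt_pred0: "poly_time (\<lambda>n. n - Suc 0)"
proof (rule pt_expr[of "\<lambda>n. 1 + ssize n" "Tl_Of (Var 0)"])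
  show "val (Tl_Of (Var 0)) (s(0 := enc n)) = enc (n - Suc 0)" for n and s :: store by (cases n) auto
qed (intro pb_intros, simp add: ssize_def[symmetric])

lemma pt_diff: assumes "poly_time f" "poly_time g" shows "poly_time (\<lambda>x. f x - (g x :: nat))"
proof -
  have m: "((\<lambda>n. n - Suc 0) ^^ j) n = n - j" for j n by (induction j) auto
  have "poly_time (\<lambda>x. ((\<lambda>n. n - Suc 0) ^^ g x) (f x))"
  proof (rule pt_iter[where F = "\<lambda>_ n. n - Suc 0", OF _ assms(2,1)])
    show "poly_bounded (\<lambda>x. ssize (f x))" by (intro pb_intros pt_size assms)
    show "poly_time (\<lambda>z. snd z - Suc 0)" by (rule pt_comp[OF pt_snd0 pt_pred0])
  qed (simp add: m)
  then show ?thesis unfolding m .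
qed

lemma pt_mult: assumes "poly_time f" "poly_time g" shows "poly_time (\<lambda>x. f x * (g x :: nat))"
proof -
  have m: "((\<lambda>n. n + y) ^^ j) 0 = j * y" for j and y :: nat by (induction j) auto
  have "poly_time (\<lambda>x. ((\<lambda>n. n + g x) ^^ f x) 0)"
  proof (rule pt_iter[where F = "\<lambda>x n. n + g x", OF _ assms(1) pt_const])
    show "poly_time (\<lambda>z. snd z + g (fst z))" by (intro pt_add pt_snd pt_id pt_comp[OF pt_fst0 assms(2)])
    show "poly_bounded (\<lambda>x. 2 * (ssize (f x) * ssize (g x)) + 1)" by (intro pb_intros pt_size assms)
    show "ssize (((\<lambda>n. n + g x) ^^ j) 0) \<le> 2 * (ssize (f x) * ssize (g x)) + 1" if "j \<le> f x" for x j
    proof -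
      have "j * g x \<le> ssize (f x) * ssize (g x)" by (rule mult_mono) (use that in auto)
      then show ?thesis unfolding m by (simp del: ssize_simps(2) add: ssize_simps(2)[of "j * g x"])
    qed
  qed
  then show ?thesis unfolding m .
qed

lemma pt_eq0: assumes "poly_time f" shows "poly_time (\<lambda>x. f x = (0::nat))"
proof -
  have "poly_time (\<lambda>n::nat. n \<noteq> 0)"
  proof (rule ptI)
    show "poly_bounded (\<lambda>n::nat. 3 + 2 * ssize n)" by (intro pb_intros)
    show "ssize (n \<noteq> 0) \<le> 3 + 2 * ssize n" for n :: nat using ssize_bool[of "n \<noteq> 0"] by simp
    show "\<exists>t s'. exec (Cond (Var 0) (Assign 0 (const_expr (enc True))) Skip) s t s' \<and> t \<le> 3 + 2 * ssize n
      \<and> s' 0 = enc (n \<noteq> 0) \<and> (\<forall>i>0. s' i = s i)" if s: "s 0 = enc n" for n :: nat and s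
    proof (cases n)
      case 0
      have v: "val (Var 0) s = Atom" using s 0 by simp
      show ?thesis
        by (rule exec_ex[OF exec.Cond_False[OF v exec.Skip]]) (use s 0 in auto)
    next
      case (Suc m)
      have v: "val (Var 0) s \<noteq> Atom" using s Suc by simp
      have "dsize (s 0) = ssize n" by (simp only: ssize_def s)
      then show ?thesis
        by (intro exec_ex[OF exec.Cond_True[OF v exec.Assign]]) (use Suc in simp_all)
    qed
  qed
  then have "poly_time (\<lambda>x. f x \<noteq> 0)" by (rule pt_comp[OF assms])
  from pt_if[OF this pt_const[of False] pt_const[of True]]
  show ?thesis by (rule back_subst[of poly_time]) auto
qed

lemma pt_conj: assumes "poly_time f" "poly_time g" shows "poly_time (\<lambda>x. f x \<and> g x)"
  using pt_if[OF assms pt_const[of False]] by (rule back_subst[of poly_time]) auto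
lemma pt_disj: assumes "poly_time f" "poly_time g" shows "poly_time (\<lambda>x. f x \<or> g x)"
  using pt_if[OF assms(1) pt_const[of True] assms(2)] by (rule back_subst[of poly_time]) auto
lemma pt_not: assumes "poly_time f" shows "poly_time (\<lambda>x. \<not> f x)"
  using pt_if[OF assms pt_const[of False] pt_const[of True]] by (rule back_subst[of poly_time]) auto
lemma pt_eqb: assumes "poly_time f" "poly_time g" shows "poly_time (\<lambda>x. f x = (g x::bool))"
  using pt_if[OF assms(1) assms(2) pt_not[OF assms(2)]] by (rule back_subst[of poly_time]) auto

lemma pt_le: assumes "poly_time f" "poly_time g" shows "poly_time (\<lambda>x. f x \<le> (g x :: nat))"
  using pt_eq0[OF pt_diff[OF assms]] by (rule back_subst[of poly_time]) auto
lemma pt_less: assumes "poly_time f" "poly_time g" shows "poly_time (\<lambda>x. f x < (g x :: nat))"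
  using pt_le[OF pt_Suc[OF assms(1)] assms(2)] by (rule back_subst[of poly_time]) auto
lemma pt_eqn: assumes "poly_time f" "poly_time g" shows "poly_time (\<lambda>x. f x = (g x :: nat))"
  using pt_conj[OF pt_le[OF assms] pt_le[OF assms(2,1)]] by (rule back_subst[of poly_time]) auto

lemma pt_null: assumes "poly_time f" shows "poly_time (\<lambda>x. f x = [])"
  using pt_eq0[OF pt_length[OF assms]] by (rule back_subst[of poly_time]) auto

lemma pt_mem:
  fixes f :: "'x::encodable \<Rightarrow> nat"
  assumes "poly_time f" "poly_time xs" shows "poly_time (\<lambda>x. f x \<in> set (xs x))"
proof -
  have "poly_time (\<lambda>x. filter (\<lambda>y. y = f x) (xs x))"
    by (intro pt_filter pt_eqn pt_snd pt_id pt_comp[OF pt_fst0 assms(1)] assms)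
  from pt_not[OF pt_null[OF this]] show ?thesis by (rule back_subst[of poly_time]) (auto simp: filter_empty_conv)
qed

lemma pt_append:
  fixes f :: "'x::encodable \<Rightarrow> 'b::encodable list"
  assumes "poly_time f" "poly_time g" shows "poly_time (\<lambda>x. f x @ g x)"
proof -
  have m: "foldr (\<lambda>y s. y # s) ys zs = ys @ zs" for ys zs :: "'b list" by (induction ys) auto
  have "poly_time (\<lambda>x. foldr (\<lambda>y s. y # s) (f x) (g x))"
  proof (rule pt_foldr[OF _ assms])
    show "poly_bounded (\<lambda>x. ssize (f x) + ssize (g x))" by (intro pb_intros pt_size assms)
    show "ssize (foldr (\<lambda>y s. y # s) ys (g x)) \<le> ssize (f x) + ssize (g x)" if "ssize ys \<le> ssize (f x)" for x ys
      unfolding m using ssize_append[of ys "g x"] that by linarith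
  qed (intro pt_Cons pt_fst pt_snd pt_id)
  then show ?thesis unfolding m .
qed

lemma pt_concat:
  fixes f :: "'x::encodable \<Rightarrow> 'y::encodable list list"
  assumes "poly_time f" shows "poly_time (\<lambda>x. concat (f x))"
proof -
  have m: "concat zs = foldr (\<lambda>y s. y @ s) zs []" for zs :: "'y list list" by (induction zs) auto
  have sz: "ssize (concat zs) \<le> ssize zs" for zs :: "'y list list"
  proof (induction zs)
    case (Cons z zs)
    then show ?case using ssize_append[of z "concat zs"] by simp
  qed simp
  have "poly_time (\<lambda>x. foldr (\<lambda>y s. y @ s) (f x) [])"
  proof (rule pt_foldr[OF _ assms pt_const])
    show "poly_bounded (\<lambda>x. ssize (f x))" by (intro pt_size assms)
    show "ssize (foldr (\<lambda>y s. y @ s) ys []) \<le> ssize (f x)" if "ssize ys \<le> ssize (f x)" for x and ys :: "'y list list"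
      unfolding m[symmetric] using sz[of ys] that by linarith
  qed (intro pt_append pt_fst pt_snd pt_id)
  then show ?thesis unfolding m .
qed

lemma pt_replicate:
  fixes f :: "'x::encodable \<Rightarrow> 'b::encodable"
  assumes "poly_time n" "poly_time f" shows "poly_time (\<lambda>x. replicate (n x) (f x))"
proof -
  have m: "((\<lambda>s. y # s) ^^ j) [] = replicate j y" for j and y :: 'b by (induction j) auto
  have "poly_time (\<lambda>x. ((\<lambda>s. f x # s) ^^ n x) [])"
  proof (rule pt_iter[where F = "\<lambda>x s. f x # s", OF _ assms(1) pt_const])
    show "poly_time (\<lambda>z. f (fst z) # snd z)" by (intro pt_Cons pt_snd pt_id pt_comp[OF pt_fst0 assms(2)])
    show "poly_bounded (\<lambda>x. 1 + ssize (n x) * (1 + ssize (f x)))" by (intro pb_intros pt_size assms)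
    show "ssize (((\<lambda>s. f x # s) ^^ j) []) \<le> 1 + ssize (n x) * (1 + ssize (f x))" if "j \<le> n x" for x j
    proof -
      have "ssize (replicate j (f x)) \<le> 1 + j * (1 + ssize (f x))"
        using ssize_list_le[of "replicate j (f x)" "ssize (f x)"] by simp
      also have "\<dots> \<le> 1 + ssize (n x) * (1 + ssize (f x))"
        using that by (intro add_left_mono mult_right_mono) auto
      finally show ?thesis unfolding m .
    qed
  qed
  then show ?thesis unfolding m .
qed

lemma pt_upt0: assumes "poly_time n" shows "poly_time (\<lambda>x. [0..<n x])"
proof -
  let ?F = "\<lambda>z. (Suc (fst z), fst z # snd z)"
  have m: "(?F ^^ j) (0, []) = (j, rev [0..<j])" for j by (induction j) auto
  have "poly_time (\<lambda>x. (?F ^^ n x) (0, []))"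
  proof (rule pt_iter[where F = "\<lambda>_. ?F", OF _ assms pt_const])
    show "poly_time (\<lambda>z. (Suc (fst (snd z)), fst (snd z) # snd (snd z)))"
      by (intro pt_pair pt_Suc pt_Cons pt_fst pt_snd pt_id)
    show "poly_bounded (\<lambda>x. 1 + ssize (n x) + (1 + ssize (n x) * (1 + ssize (n x))))" by (intro pb_intros pt_size assms)
    show "ssize ((?F ^^ j) (0, [])) \<le> 1 + ssize (n x) + (1 + ssize (n x) * (1 + ssize (n x)))" if j: "j \<le> n x" for x j
    proof -
      have "ssize [0..<j] \<le> 1 + length [0..<j] * (1 + ssize (n x))"
        by (rule ssize_list_le) (use j in auto)
      also have "\<dots> \<le> 1 + ssize (n x) * (1 + ssize (n x))"
        using j by (intro add_left_mono mult_right_mono) auto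
      finally show ?thesis unfolding m using j by simp
    qed
  qed
  from pt_rev[OF pt_snd[OF this]] show ?thesis unfolding m by simp
qed

section \<open>The algorithm runs in polynomial time\<close>

text \<open>With these rules, the definition of a function can be followed symbol by symbol to show that it is computable in polynomial time. In each
  proof below, \<open>pt_comp[rotated]\<close> adapts the assumptions about the arguments to the additional state inside of \<open>map\<close> and the like.\<close>

lemmas pt_rules = pt_const pt_id pt_fst pt_snd pt_pair pt_Suc pt_Cons pt_if pt_case_list pt_map pt_filter pt_length
  pt_add pt_diff pt_mult pt_conj pt_disj pt_not pt_eqb pt_le pt_less pt_eqn pt_null pt_mem pt_append pt_concat
  pt_replicate pt_upt0 pt_Let

lemma pt_cross:
  fixes E :: "'x::encodable \<Rightarrow> (nat \<times> nat) list"
  assumes "poly_time E" "poly_time a" "poly_time b"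
  shows "poly_time (\<lambda>x. cross (E x) (set (a x)) (set (b x)))"
  unfolding cross_def by (intro pt_rules assms[THEN pt_comp[rotated]])

lemma pt_cross1:
  fixes E :: "'x::encodable \<Rightarrow> (nat \<times> nat) list"
  assumes "poly_time E" "poly_time a" "poly_time b"
  shows "poly_time (\<lambda>x. cross (E x) {a x} (set (b x)))"
  using pt_cross[OF assms(1) pt_Cons[OF assms(2) pt_const[of "[]"]] assms(3)] by simp

lemma pt_cross2:
  fixes E :: "'x::encodable \<Rightarrow> (nat \<times> nat) list"
  assumes "poly_time E" "poly_time a" "poly_time b"
  shows "poly_time (\<lambda>x. cross (E x) {a x} {b x})"
  using pt_cross1[OF assms(1,2) pt_Cons[OF assms(3) pt_const[of "[]"]]] by simp

lemma pt_inside: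
  fixes E :: "'x::encodable \<Rightarrow> (nat \<times> nat) list"
  assumes "poly_time E" "poly_time a"
  shows "poly_time (\<lambda>x. inside (E x) (set (a x)))"
  unfolding inside_def by (intro pt_rules assms[THEN pt_comp[rotated]])

lemma pt_cap_of:
  fixes P :: "'x::encodable \<Rightarrow> nat list"
  assumes "poly_time P" "poly_time Q" "poly_time b" "poly_time v"
  shows "poly_time (\<lambda>x. cap_of (P x) (Q x) (b x) (v x))"
  unfolding cap_of_def by (intro pt_rules assms[THEN pt_comp[rotated]])

lemma pt_tab:
  fixes V :: "'x::encodable \<Rightarrow> nat list"
  assumes "poly_time V" "poly_time (\<lambda>z. f (fst z) (snd z))"
  shows "poly_time (\<lambda>x. tab (V x) (f x))"
  unfolding tab_def by (intro pt_rules assms pt2[OF assms(2)])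

lemma pt_pick:
  fixes xs :: "'x::encodable \<Rightarrow> 'y::encodable list"
  assumes bt: "poly_time (\<lambda>z. bt (fst z) (fst (snd z)) (snd (snd z)))" and xs: "poly_time xs" and d: "poly_time d"
  shows "poly_time (\<lambda>x. pick (bt x) (xs x) (d x))"
  unfolding pick_def
proof (rule pt_fold[OF _ xs d])
  show "poly_time (\<lambda>z. if bt (fst z) (fst (snd z)) (snd (snd z)) then fst (snd z) else snd (snd z))"
    by (intro pt_rules bt)
  show "poly_bounded (\<lambda>x. ssize (xs x) + ssize (d x))" by (intro pb_intros pt_size xs d)
  show "ssize (fold (\<lambda>y b. if bt x y b then y else b) (take j (xs x)) (d x)) \<le> ssize (xs x) + ssize (d x)" for x j
  proof -
    have "pick (bt x) (take j (xs x)) (d x) \<in> set (d x # take j (xs x))" by (rule pick_in)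
    then have "pick (bt x) (take j (xs x)) (d x) \<in> set (d x # xs x)" by (auto dest: in_set_takeD)
    then show ?thesis unfolding pick_def using ssize_member[of _ "xs x"] by (auto intro: trans_le_add1)
  qed
qed

lemma pt_load:
  fixes tk :: "'x::encodable \<Rightarrow> (nat \<times> nat) list"
  assumes "poly_time tk" "poly_time v"
  shows "poly_time (\<lambda>x. load (tk x) (v x))"
  unfolding load_def by (intro pt_rules assms[THEN pt_comp[rotated]])

lemma pt_root_weight:
  fixes P :: "'x::encodable \<Rightarrow> nat list"
  assumes "poly_time P" "poly_time Q" "poly_time r" "poly_time v"
  shows "poly_time (\<lambda>x. root_weight A B (P x) (Q x) (r x) (v x))"
  unfolding root_weight_def by (intro pt_rules pt_cap_of assms[THEN pt_comp[rotated]])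

lemma pt_improves:
  fixes P :: "'x::encodable \<Rightarrow> nat list"
  assumes "poly_time K" "poly_time P" "poly_time Q" "poly_time r" "poly_time tk" "poly_time t"
  shows "poly_time (\<lambda>x. improves (K x) (root_weight A B (P x) (Q x) (r x)) (tk x) (t x))"
  unfolding improves_def by (intro pt_rules pt_load pt_root_weight assms[THEN pt_comp[rotated]])

lemma ssize_flip_foldr:
  fixes ys :: "('a::encodable \<times> 'a) list"
  shows "ssize (snd (foldr (\<lambda>t s. if \<not> fst s \<and> Q t then (True, (snd t, fst t) # snd s) else (fst s, t # snd s)) ys (False, []))) = ssize ys"
proof (induction ys)
  case (Cons y ys)
  then show ?case using ssize_prod[of y] by simp
qed simp

lemma ssize_flip: "ssize (flip K w tk) = ssize (tk :: (nat \<times> nat) list)"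
  unfolding flip_def by (rule ssize_flip_foldr)

text \<open>A token that has been moved has the same size as before, so that no state exceeds the original list by more than a constant.\<close>

lemma pt_flip:
  fixes P :: "'x::encodable \<Rightarrow> nat list"
  assumes "poly_time K" "poly_time P" "poly_time Q" "poly_time r" "poly_time tk"
  shows "poly_time (\<lambda>x. flip (K x) (root_weight A B (P x) (Q x) (r x)) (tk x))"
  unfolding flip_def
proof (rule pt_snd, rule pt_foldr[OF _ assms(5) pt_const])
  show "poly_time (\<lambda>z. if \<not> fst (snd (snd z)) \<and> improves (K (fst z)) (root_weight A B (P (fst z)) (Q (fst z)) (r (fst z))) (tk (fst z)) (fst (snd z))
    then (True, (snd (fst (snd z)), fst (fst (snd z))) # snd (snd (snd z))) else (fst (snd (snd z)), fst (snd z) # snd (snd (snd z))))"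
    by (intro pt_rules pt_improves assms[THEN pt_comp[rotated]])
  show "poly_bounded (\<lambda>x. 4 + ssize (tk x))" by (intro pb_intros pt_size assms)
  show "ssize (foldr (\<lambda>t s. if \<not> fst s \<and> improves (K x) (root_weight A B (P x) (Q x) (r x)) (tk x) t
    then (True, (snd t, fst t) # snd s) else (fst s, t # snd s)) ys (False, [])) \<le> 4 + ssize (tk x)"
    if "ssize ys \<le> ssize (tk x)" for x ys
    using ssize_flip_foldr[of "improves (K x) (root_weight A B (P x) (Q x) (r x)) (tk x)" ys] that
    by (subst ssize_prod) (use ssize_bool in \<open>simp add: add_mono\<close>)
qed

lemma pt_tokens:
  fixes E :: "'x::encodable \<Rightarrow> (nat \<times> nat) list"
  assumes "poly_time E" "poly_time V" "poly_time m"
  shows "poly_time (\<lambda>x. tokens (E x) (V x) (m x))"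
  unfolding tokens_def by (intro pt_rules assms[THEN pt_comp[rotated]])

lemma pt_balanced:
  fixes E :: "'x::encodable \<Rightarrow> (nat \<times> nat) list"
  assumes "poly_time E" "poly_time P" "poly_time Q" "poly_time r" "poly_time V" "poly_time K"
  shows "poly_time (\<lambda>x. balanced A B (E x) (P x) (Q x) (r x) (V x) (K x))"
proof -
  have t: "poly_time (\<lambda>x. tokens (E x) (V x) (K x * (B * (A - 1))))" by (intro pt_rules pt_tokens assms)
  show ?thesis unfolding balanced_def Let_def
  proof (rule pt_iter[OF _ _ t])
    show "poly_time (\<lambda>z. flip (K (fst z)) (root_weight A B (P (fst z)) (Q (fst z)) (r (fst z))) (snd z))"
      by (intro pt_rules pt_flip assms[THEN pt_comp[rotated]])
    show "poly_time (\<lambda>x. length (V x) * ((length (tokens (E x) (V x) (K x * (B * (A - 1)))) + K x * (A * length (P x) + B * length (Q x))) *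
       (length (tokens (E x) (V x) (K x * (B * (A - 1)))) + K x * (A * length (P x) + B * length (Q x)))))"
      by (intro pt_rules t assms)
    show "poly_bounded (\<lambda>x. ssize (tokens (E x) (V x) (K x * (B * (A - 1)))))" by (rule pt_size[OF t])
    show "ssize ((flip (K x) (root_weight A B (P x) (Q x) (r x)) ^^ j) (tokens (E x) (V x) (K x * (B * (A - 1)))))
      \<le> ssize (tokens (E x) (V x) (K x * (B * (A - 1))))" for x j
      by (induction j) (auto simp: ssize_flip)
  qed
qed

lemma pt_levels:
  fixes E :: "'x::encodable \<Rightarrow> (nat \<times> nat) list"
  assumes "poly_time E" "poly_time V" "poly_time P" "poly_time Q" "poly_time r" "poly_time y"
  shows "poly_time (\<lambda>x. levels A B (E x) (V x) (P x) (Q x) (r x) (y x))"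
  unfolding levels_def by (intro pt_rules pt_balanced pt_load pt_root_weight assms[THEN pt_comp[rotated]])

lemma pt_shifted_pot:
  fixes E :: "'x::encodable \<Rightarrow> (nat \<times> nat) list"
  assumes "poly_time E" "poly_time V" "poly_time P" "poly_time Q" "poly_time S"
  shows "poly_time (\<lambda>x. shifted_pot A B (E x) (V x) (P x) (Q x) (S x))"
  unfolding shifted_pot_def by (intro pt_rules pt_inside assms[THEN pt_comp[rotated]])

lemma pt_minset:
  fixes E :: "'x::encodable \<Rightarrow> (nat \<times> nat) list"
  assumes "poly_time E" "poly_time V" "poly_time P" "poly_time Q"
  shows "poly_time (\<lambda>x. minset A B (E x) (V x) (P x) (Q x))"
  unfolding minset_def by (intro pt_pick pt_rules pt_shifted_pot pt_levels assms[THEN pt_comp[rotated]])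

lemma pt_nbs_list:
  fixes E :: "'x::encodable \<Rightarrow> (nat \<times> nat) list"
  assumes "poly_time E" "poly_time V" "poly_time v"
  shows "poly_time (\<lambda>x. nbs_list (E x) (V x) (v x))"
  unfolding nbs_list_def by (intro pt_rules pt_cross2 assms[THEN pt_comp[rotated]])

lemma pt_tight_list:
  fixes E :: "'x::encodable \<Rightarrow> (nat \<times> nat) list"
  assumes "poly_time E" "poly_time V" "poly_time P" "poly_time Q" "poly_time v"
  shows "poly_time (\<lambda>x. tight_list (E x) (V x) (P x) (Q x) (v x))"
  unfolding tight_list_def by (intro pt_rules pt_cross1 pt_nbs_list pt_cap_of assms[THEN pt_comp[rotated]])

lemma pt_reducible_test:
  fixes E :: "'x::encodable \<Rightarrow> (nat \<times> nat) list"
  assumes "poly_time E" "poly_time V" "poly_time P" "poly_time Q" "poly_time v"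
  shows "poly_time (\<lambda>x. reducible_test B (E x) (V x) (P x) (Q x) (v x))"
  unfolding reducible_test_def by (intro pt_rules pt_cross1 pt_tight_list pt_cap_of assms[THEN pt_comp[rotated]])

lemma pt_vertex_step:
  fixes E :: "'x::encodable \<Rightarrow> (nat \<times> nat) list"
  assumes "poly_time E" "poly_time V" "poly_time P" "poly_time Q"
  shows "poly_time (\<lambda>x. vertex_step B (E x) (V x) (P x) (Q x))"
  unfolding vertex_step_def by (intro pt_rules pt_cross1 pt_tight_list pt_nbs_list pt_reducible_test pt_cap_of assms[THEN pt_comp[rotated]])

lemma pt_cut_edges:
  fixes E :: "'x::encodable \<Rightarrow> (nat \<times> nat) list"
  assumes "poly_time E" "poly_time S" "poly_time X"
  shows "poly_time (\<lambda>x. cut_edges (E x) (S x) (X x))"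
  unfolding cut_edges_def by (intro pt_rules assms[THEN pt_comp[rotated]])

lemma pt_plan:
  fixes E :: "'x::encodable \<Rightarrow> (nat \<times> nat) list"
  assumes "poly_time E" "poly_time V" "poly_time P" "poly_time Q"
  shows "poly_time (\<lambda>x. plan A B (E x) (V x) (P x) (Q x))"
  unfolding plan_def by (intro pt_rules pt_minset pt_shifted_pot pt_vertex_step pt_cut_edges assms[THEN pt_comp[rotated]])

lemma pt_lowered:
  fixes V :: "'x::encodable \<Rightarrow> nat list"
  assumes "poly_time V" "poly_time P" "poly_time us"
  shows "poly_time (\<lambda>x. lowered (V x) (P x) (us x))"
  unfolding lowered_def by (intro pt_tab pt_rules assms[THEN pt_comp[rotated]])

lemma pt_seen:
  fixes E :: "'x::encodable \<Rightarrow> (nat \<times> nat) list"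
  assumes "poly_time E" "poly_time C" "poly_time S" "poly_time b" "poly_time y"
  shows "poly_time (\<lambda>x. seen (E x) (\<lambda>v. v \<in> set (C x)) (set (S x)) (b x) (y x))"
proof -
  have eq: "seen E (\<lambda>v. v \<in> set C) (set S) b y = cross E {y} (set (filter (\<lambda>u. (u \<in> set C) = b) S))"
    for E :: "(nat \<times> nat) list" and C S b y
    unfolding seen_def set_filter ..
  show ?thesis unfolding eq by (intro pt_cross1 pt_rules assms[THEN pt_comp[rotated]])
qed

lemma pt_ban:
  fixes E :: "'x::encodable \<Rightarrow> (nat \<times> nat) list"
  assumes "poly_time E" "poly_time C" "poly_time S" "poly_time P" "poly_time Q" "poly_time b" "poly_time y"
  shows "poly_time (\<lambda>x. ban (E x) (\<lambda>v. v \<in> set (C x)) (set (S x)) (cap_of (P x) (Q x)) (b x) (y x))"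
  unfolding ban_def by (intro pt_seen pt_cap_of pt_rules assms[THEN pt_comp[rotated]])

lemma pt_use:
  fixes E :: "'x::encodable \<Rightarrow> (nat \<times> nat) list"
  assumes "poly_time E" "poly_time C" "poly_time S" "poly_time P" "poly_time Q" "poly_time u0" "poly_time y0" "poly_time b" "poly_time y"
  shows "poly_time (\<lambda>x. use (E x) (\<lambda>v. v \<in> set (C x)) (set (S x)) (cap_of (P x) (Q x)) (u0 x) (y0 x) (b x) (y x))"
  unfolding use_def by (intro pt_ban pt_cap_of pt_rules assms[THEN pt_comp[rotated]])

lemma pt_usable:
  fixes E :: "'x::encodable \<Rightarrow> (nat \<times> nat) list"
  assumes "poly_time E" "poly_time C" "poly_time S" "poly_time P" "poly_time Q" "poly_time u" "poly_time y"
  shows "poly_time (\<lambda>x. usable (E x) (\<lambda>v. v \<in> set (C x)) (set (S x)) (cap_of (P x) (Q x)) (u x) (y x))"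
  unfolding usable_def by (intro pt_seen pt_cross2 pt_cap_of pt_rules assms[THEN pt_comp[rotated]])

lemma pt_best_caps:
  fixes E :: "'x::encodable \<Rightarrow> (nat \<times> nat) list"
  assumes "poly_time E" "poly_time P" "poly_time Q" "poly_time S" "poly_time X" "poly_time C"
  shows "poly_time (\<lambda>x. best_caps A B (E x) (P x) (Q x) (S x) (X x) (C x))"
  unfolding best_caps_def cap_lists_def
  by (intro pt_pick pt_tab pt_usable pt_use pt_ban pt_rules assms[THEN pt_comp[rotated]])

lemma pt_step:
  fixes E :: "'x::encodable \<Rightarrow> (nat \<times> nat) list"
  assumes "poly_time E" "poly_time st"
  shows "poly_time (\<lambda>x. step A B (E x) (st x))"
  unfolding step_def by (intro pt_plan pt_best_caps pt_lowered pt_rules assms[THEN pt_comp[rotated]])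

text \<open>Each list of caps in a task comes from bounded caps on a set of vertices. This keeps its length, and
  with it the size of every state of the algorithm, polynomial.\<close>

definition task_ok :: "nat \<Rightarrow> nat \<Rightarrow> nat task \<Rightarrow> bool" where
  "task_ok A n t \<longleftrightarrow> distinct (fst (snd t)) \<and> set (fst (snd t)) \<subseteq> {..<n} \<and>
     (\<exists>f g. fst (snd (snd t)) = tab (fst (snd t)) f \<and> snd (snd (snd t)) = tab (fst (snd t)) g \<and>
       (\<forall>v. f v \<le> A \<and> g v \<le> A))"

lemma minset_sub: "distinct V \<Longrightarrow> distinct (minset A B E V P Q) \<and> set (minset A B E V P Q) \<subseteq> set V"
proof -
  assume V: "distinct V"
  let ?xs = "concat (map (\<lambda>r. concat (map (\<lambda>x. if r = x then [] else levels A B E V P Q r x) V)) V)"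
  let ?d = "case V of [] \<Rightarrow> [] | v # _ \<Rightarrow> [v]"
  have lev: "distinct S \<and> set S \<subseteq> set V" if "S \<in> set (levels A B E V P Q r x)" for S r x
    using that V unfolding levels_def Let_def by auto
  have "minset A B E V P Q \<in> set (?d # ?xs)" unfolding minset_def by (rule pick_in)
  then have "minset A B E V P Q = ?d \<or> minset A B E V P Q \<in> set ?xs" by (simp only: list.set insert_iff)
  then show ?thesis
  proof
    assume "minset A B E V P Q = ?d"
    then show ?thesis by (cases V) auto
  next
    assume "minset A B E V P Q \<in> set ?xs"
    then have "\<exists>r\<in>set V. \<exists>x\<in>set V. minset A B E V P Q \<in> set (if r = x then [] else levels A B E V P Q r x)"
      by (simp only: set_concat set_map image_image UN_iff)
    then obtain r x where "minset A B E V P Q \<in> set (if r = x then [] else levels A B E V P Q r x)" by blast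
    then have "minset A B E V P Q \<in> set (levels A B E V P Q r x)" by (cases "r = x") simp_all
    then show ?thesis by (rule lev)
  qed
qed

lemma vertex_step_sub: "distinct V \<Longrightarrow> distinct (fst (vertex_step B E V P Q)) \<and> set (fst (vertex_step B E V P Q)) \<subseteq> set V"
  unfolding vertex_step_def by (auto split: list.splits)

lemma plan_sub: "distinct V \<Longrightarrow> distinct (fst (plan A B E V P Q)) \<and> set (fst (plan A B E V P Q)) \<subseteq> set V"
  using minset_sub[of V A B E P Q] vertex_step_sub[of V B E P Q]
  unfolding plan_def Let_def by (auto split: list.splits)

lemma best_caps_le: "\<exists>k'. best_caps A B E P Q S X C = cap_lists X k' \<and> (\<forall>b y. k' b y \<le> cap_of P Q b y)"
proof -
  let ?c = "\<lambda>v. v \<in> set C" and ?k = "cap_of P Q"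
  let ?xs = "concat (map (\<lambda>u. concat (map (\<lambda>y. if usable E ?c (set S) ?k u y
          then [cap_lists X (use E ?c (set S) ?k u y)] else []) X)) S)"
  let ?d = "cap_lists X (ban E ?c (set S) ?k)"
  have "best_caps A B E P Q S X C \<in> set (?d # ?xs)" unfolding best_caps_def by (rule pick_in)
  then have "best_caps A B E P Q S X C = ?d \<or> (\<exists>u y. best_caps A B E P Q S X C = cap_lists X (use E ?c (set S) ?k u y))"
    by (auto split: if_splits)
  moreover have "ban E ?c (set S) ?k b y \<le> ?k b y" for b y by (simp add: ban_def)
  moreover have "use E ?c (set S) ?k u y0 b y \<le> ?k b y" for u y0 b y by (simp add: use_def ban_def)
  ultimately show ?thesis by blast
qed

lemma cap_of_tab_le:
  assumes "distinct V" "\<And>v. f v \<le> A \<and> g v \<le> A"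
  shows "cap_of (tab V f) (tab V g) b v \<le> A"
  using assms unfolding cap_of_def by (simp add: filter_tab)

lemma task_ok_tab:
  assumes "distinct V" "set V \<subseteq> {..<n}" "\<And>v. f v \<le> A" "\<And>v. g v \<le> A"
  shows "task_ok A n (b, V, tab V f, tab V g)"
proof -
  have "\<exists>f' g'. tab V f = tab V f' \<and> tab V g = tab V g' \<and> (\<forall>v. f' v \<le> A \<and> g' v \<le> A)"
    by (rule exI[of _ f], rule exI[of _ g]) (simp add: assms)
  then show ?thesis unfolding task_ok_def fst_conv snd_conv using assms(1,2) by (intro conjI)
qed

text \<open>After \<open>j\<close> steps.\<close>

definition state_ok :: "nat \<Rightarrow> nat \<Rightarrow> nat \<Rightarrow> nat task list \<times> nat list \<Rightarrow> bool" where
  "state_ok A n j st \<longleftrightarrow> length (fst st) \<le> j + 1 \<and> length (snd st) \<le> j \<and> set (snd st) \<subseteq> {..<n} \<and>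
     (\<forall>t\<in>set (fst st). task_ok A n t)"

lemma step_state_ok:
  assumes "state_ok A n j st"
  shows "state_ok A n (Suc j) (step A B E st)"
proof (cases "fst st")
  case Nil
  then show ?thesis using assms unfolding step_def state_ok_def by auto
next
  case (Cons t rest)
  obtain fl V P Q where t: "t = (fl, V, P, Q)" by (cases t) auto
  have tok: "task_ok A n t" and rest: "\<And>u. u \<in> set rest \<Longrightarrow> task_ok A n u"
    and C: "length (snd st) \<le> j" "set (snd st) \<subseteq> {..<n}" and len: "length rest \<le> j"
    using assms Cons unfolding state_ok_def by auto
  obtain f g where V: "distinct V" "set V \<subseteq> {..<n}" and PQ: "P = tab V f" "Q = tab V g" "\<And>v. f v \<le> A \<and> g v \<le> A"
    using tok unfolding task_ok_def t by auto
  have cap: "cap_of P Q b v \<le> A" for b v unfolding PQ(1,2) by (rule cap_of_tab_le[OF V(1) PQ(3)])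
  define S where "S = fst (plan A B E V P Q)"
  have S: "distinct S" "set S \<subseteq> {..<n}" using plan_sub[OF V(1), of A B E P Q] V(2) unfolding S_def by auto
  show ?thesis
  proof (cases fl)
    case True
    define X where "X = filter (\<lambda>v. v \<notin> set S) V"
    obtain k' where k': "best_caps A B E P Q S X (snd st) = cap_lists X k'" "\<And>b y. k' b y \<le> cap_of P Q b y"
      using best_caps_le by blast
    have "k' b v \<le> A" for b v using order_trans[OF k'(2) cap] .
    then have "task_ok A n (False, X, tab X (k' True), tab X (k' False))"
      using V by (intro task_ok_tab) (auto simp: X_def)
    moreover have "step A B E st = ((False, X, tab X (k' True), tab X (k' False)) # rest, snd st)"
      using True unfolding step_def Cons t Let_def X_def S_def by (simp add: k'(1)[unfolded X_def S_def] cap_lists_def)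
    ultimately show ?thesis using rest C len unfolding state_ok_def by auto
  next
    case False
    show ?thesis
    proof (cases "V = []")
      case True
      then have "step A B E st = (rest, snd st)" using False unfolding step_def Cons t Let_def by simp
      then show ?thesis using rest C len unfolding state_ok_def by auto
    next
      case V0: False
      then obtain v vs where Vv: "V = v # vs" by (cases V) auto
      show ?thesis
      proof (cases "vs = []")
        case True
        then have "step A B E st = (rest, if v \<in> set P then v # snd st else snd st)"
          using False unfolding step_def Cons t Let_def by (simp add: Vv)
        then show ?thesis using rest C len V(2) Vv unfolding state_ok_def by auto
      next
        case vs: False
        let ?t1 = "(False, S, lowered S P (fst (snd (plan A B E V P Q))), lowered S Q (snd (snd (plan A B E V P Q))))"
        have st: "step A B E st = (?t1 # (True, V, P, Q) # rest, snd st)"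
          using False vs unfolding step_def Cons t Let_def S_def by (simp add: Vv)
        have c1: "length (filter (\<lambda>u. u = v) P) \<le> A" "length (filter (\<lambda>u. u = v) Q) \<le> A" for v
          using cap[of True v] cap[of False v] unfolding cap_of_def by simp_all
        have "task_ok A n ?t1" unfolding lowered_def
          by (rule task_ok_tab[OF S]) (use c1 in \<open>auto intro: order_trans[OF diff_le_self]\<close>)
        moreover have "task_ok A n (True, V, P, Q)" unfolding PQ(1,2) by (rule task_ok_tab[OF V]) (use PQ(3) in auto)
        ultimately show ?thesis using rest C len unfolding st state_ok_def by auto
      qed
    qed
  qed
qed

lemma ssize_nats: "set xs \<subseteq> {..<n} \<Longrightarrow> length xs \<le> m \<Longrightarrow> ssize (xs :: nat list) \<le> 1 + m * (2 * n + 2)"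
proof -
  assume xs: "set xs \<subseteq> {..<n}" "length xs \<le> m"
  have "ssize xs \<le> 1 + length xs * (1 + (2 * n + 1))" by (rule ssize_list_le) (use xs in force)
  also have "\<dots> \<le> 1 + m * (2 * n + 2)" using xs(2) by (intro add_left_mono mult_le_mono) auto
  finally show ?thesis .
qed

lemma ssize_task:
  assumes "task_ok A n t"
  shows "ssize t \<le> 9 + (n + 2 * (n * A)) * (2 * n + 2)"
proof -
  obtain b V P Q where t: "t = (b, V, P, Q)" by (cases t) auto
  obtain f g where V: "distinct V" "set V \<subseteq> {..<n}" and PQ: "P = tab V f" "Q = tab V g" "\<And>v. f v \<le> A \<and> g v \<le> A"
    using assms unfolding task_ok_def t by auto
  have lV: "length V \<le> n" using V card_mono[of "{..<n}" "set V"] by (simp add: distinct_card)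
  have lt: "length (tab V h) \<le> n * A" if "\<And>v. h v \<le> A" for h
  proof -
    have "(\<Sum>v\<leftarrow>V. h v) \<le> (\<Sum>v\<leftarrow>V. A)" by (rule sum_list_mono) (use that in simp)
    also have "\<dots> = length V * A" by (simp add: sum_list_triv)
    also have "\<dots> \<le> n * A" using lV by simp
    finally show ?thesis unfolding length_tab .
  qed
  have sub: "set (tab V h) \<subseteq> {..<n}" for h using set_tab[of V h] V(2) by blast
  have "ssize V \<le> 1 + n * (2 * n + 2)" by (rule ssize_nats[OF V(2) lV])
  moreover have "ssize P \<le> 1 + (n * A) * (2 * n + 2)" unfolding PQ(1) by (rule ssize_nats[OF sub lt]) (use PQ(3) in blast)
  moreover have "ssize Q \<le> 1 + (n * A) * (2 * n + 2)" unfolding PQ(2) by (rule ssize_nats[OF sub lt]) (use PQ(3) in blast)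
  ultimately show ?thesis using ssize_bool[of b] unfolding t by (simp add: algebra_simps)
qed

lemma ssize_state_ok:
  assumes "state_ok A n j st" "j \<le> m"
  shows "ssize st \<le> 3 + (m + 1) * (10 + (n + 2 * (n * A)) * (2 * n + 2)) + m * (2 * n + 2)"
proof -
  let ?M = "9 + (n + 2 * (n * A)) * (2 * n + 2)"
  have "ssize (fst st) \<le> 1 + length (fst st) * (1 + ?M)"
    by (rule ssize_list_le) (use assms(1) ssize_task in \<open>auto simp: state_ok_def\<close>)
  also have "\<dots> \<le> 1 + (m + 1) * (1 + ?M)"
    using assms unfolding state_ok_def by (intro add_left_mono mult_le_mono1) simp
  also have "1 + ?M = 10 + (n + 2 * (n * A)) * (2 * n + 2)" by simp
  finally have 1: "ssize (fst st) \<le> 1 + (m + 1) * (10 + (n + 2 * (n * A)) * (2 * n + 2))" .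
  have "ssize (snd st) \<le> 1 + m * (2 * n + 2)"
    by (rule ssize_nats) (use assms in \<open>auto simp: state_ok_def\<close>)
  then show ?thesis using 1 ssize_prod[of st] by linarith
qed

lemma pt_solve:
  assumes "B \<le> A"
  shows "poly_time (\<lambda>I. solve A B (snd I) [0..<fst I])"
  unfolding solve_def
proof (rule pt_snd, rule pt_iter)
  show "poly_time (\<lambda>z :: (nat \<times> (nat \<times> nat) list) \<times> (nat task list \<times> nat list). step A B (snd (fst z)) (snd z))"
    by (intro pt_step pt_rules)
  show "poly_time (\<lambda>I::nat \<times> (nat \<times> nat) list. 3 * length [0..<fst I])" by (intro pt_rules)
  show "poly_time (\<lambda>I::nat \<times> (nat \<times> nat) list. ([(False, [0..<fst I], tab [0..<fst I] (\<lambda>_. B - 1), tab [0..<fst I] (\<lambda>_. A - 1))], [] :: nat list))"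
    by (intro pt_tab pt_rules)
  let ?b = "\<lambda>n::nat. 3 + (3 * n + 1) * (10 + (n + 2 * (n * A)) * (2 * n + 2)) + 3 * n * (2 * n + 2)"
  have mono: "?b n \<le> ?b m" if "n \<le> m" for n m
    using that by (intro add_mono mult_le_mono order_refl)
  show "poly_bounded (\<lambda>I::nat \<times> (nat \<times> nat) list. ?b (ssize I))" by (intro pb_intros)
  fix I :: "nat \<times> (nat \<times> nat) list" and j
  assume j: "j \<le> 3 * length [0..<fst I]"
  let ?s0 = "([(False, [0..<fst I], tab [0..<fst I] (\<lambda>_. B - 1), tab [0..<fst I] (\<lambda>_. A - 1))], [] :: nat list)"
  have "state_ok A (fst I) j ((step A B (snd I) ^^ j) ?s0)"
  proof (induction j)
    case 0
    have "task_ok A (fst I) (False, [0..<fst I], tab [0..<fst I] (\<lambda>_. B - 1), tab [0..<fst I] (\<lambda>_. A - 1))"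
      by (rule task_ok_tab) (use assms in auto)
    then show ?case by (simp add: state_ok_def)
  next
    case (Suc j)
    then show ?case using step_state_ok[of A "fst I" j _ B "snd I"] by simp
  qed
  from ssize_state_ok[OF this, of "3 * fst I"] j
  have "ssize ((step A B (snd I) ^^ j) ?s0) \<le> ?b (fst I)" by simp
  also have "\<dots> \<le> ?b (ssize I)" by (rule mono) (use ssize_prod[of I] in simp)
  finally show "ssize ((step A B (snd I) ^^ j) ?s0) \<le> ?b (ssize I)" .
qed

section \<open>From multigraphs to edge lists\<close>

definition edge_list :: "'v mgraph \<Rightarrow> ('v \<times> 'v) list \<Rightarrow> bool" where
  "edge_list G E \<longleftrightarrow> edges G = mset (map (\<lambda>(u, v). Upair u v) E)"

lemma edge_list_exists: "\<exists>E. edge_list G E"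
proof -
  obtain es where es: "mset es = edges G" using ex_mset by blast
  have "\<exists>f. \<forall>e. (\<lambda>(u, v). Upair u v) (f e) = (e :: 'a uprod)"
  proof (rule choice, rule allI)
    fix e :: "'a uprod"
    obtain u v where "e = Upair u v" by (cases e)
    then show "\<exists>p. (\<lambda>(u, v). Upair u v) p = e" by (intro exI[of _ "(u, v)"]) simp
  qed
  then obtain f where f: "\<And>e :: 'a uprod. (\<lambda>(u, v). Upair u v) (f e) = e" by blast
  have m: "map (\<lambda>(u, v). Upair u v) (map f es) = es" unfolding map_map o_def f by simp
  show ?thesis unfolding edge_list_def by (rule exI[of _ "map f es"]) (simp only: m es)
qed

lemma size_filter_edges:
  assumes "edge_list G E"
  shows "size {#e \<in># edges G. R (set_uprod e)#} = length (filter (\<lambda>e. R {fst e, snd e}) E)"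
proof -
  have "size {#e \<in># edges G. R (set_uprod e)#} = length (filter (\<lambda>e. R (set_uprod e)) (map (\<lambda>(u, v). Upair u v) E))"
    unfolding assms[unfolded edge_list_def] mset_filter[symmetric] size_mset ..
  also have "length (filter (\<lambda>e. R (set_uprod e)) (map (\<lambda>(u, v). Upair u v) E)) = length (filter (\<lambda>e. R {fst e, snd e}) E)"
    by (induction E) auto
  finally show ?thesis .
qed

lemma loopless_edge_list:
  assumes "edge_list G E" "loopless G"
  shows "\<forall>e\<in>set E. fst e \<noteq> snd e"
proof
  fix e assume "e \<in> set E"
  then have "Upair (fst e) (snd e) \<in># edges G" using assms(1) unfolding edge_list_def by force
  then show "fst e \<noteq> snd e" using assms(2) unfolding loopless_def by metis
qed

lemma edges_in_inside:
  assumes "edge_list G E"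
  shows "size {#e \<in># edges G. set_uprod e \<subseteq> S#} = inside E S"
  unfolding size_filter_edges[OF assms, of "\<lambda>X. X \<subseteq> S"] inside_def by simp

lemma degree_cross:
  assumes "edge_list G E" "loopless G" "v \<in> W"
  shows "degree_of (induced G W) v = cross E {v} W"
proof -
  have "Upair v v \<notin># edges (induced G W)" using assms(2) unfolding loopless_def induced_def by simp
  then have "degree_of (induced G W) v = size {#e \<in># edges (induced G W). v \<in> set_uprod e#}"
    unfolding degree_of_def by (simp only: not_in_iff add_0_right)
  also have "{#e \<in># edges (induced G W). v \<in> set_uprod e#} = {#e \<in># edges G. set_uprod e \<subseteq> W \<and> v \<in> set_uprod e#}"
    unfolding induced_def by (simp add: filter_filter_mset)
  also have "size \<dots> = length (filter (\<lambda>e. {fst e, snd e} \<subseteq> W \<and> v \<in> {fst e, snd e}) E)"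
    by (rule size_filter_edges[OF assms(1)])
  also have "filter (\<lambda>e. {fst e, snd e} \<subseteq> W \<and> v \<in> {fst e, snd e}) E
      = filter (\<lambda>e. fst e \<in> {v} \<and> snd e \<in> W \<or> fst e \<in> W \<and> snd e \<in> {v}) E"
    by (rule filter_cong) (use assms(3) in auto)
  finally show ?thesis unfolding cross_def .
qed

lemma multigraph_induced: "multigraph G \<Longrightarrow> multigraph (induced G S)"
  unfolding multigraph_def induced_def by auto

lemma induced_induced: "W \<subseteq> S \<Longrightarrow> induced (induced G S) W = induced G W"
proof -
  assume "W \<subseteq> S"
  then have "filter_mset (\<lambda>e. set_uprod e \<subseteq> W) (filter_mset (\<lambda>e. set_uprod e \<subseteq> S) (edges G)) = filter_mset (\<lambda>e. set_uprod e \<subseteq> W) (edges G)"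
    unfolding filter_filter_mset by (intro filter_mset_cong) auto
  moreover have "verts G \<inter> S \<inter> W = verts G \<inter> W" using \<open>W \<subseteq> S\<close> by blast
  ultimately show ?thesis unfolding induced_def by simp
qed

lemma cycle_edges_ends: "e \<in># cycle_edges vs \<Longrightarrow> set_uprod e \<subseteq> set vs"
proof -
  assume "e \<in># cycle_edges vs"
  then obtain p where p: "p \<in> set (zip vs (rotate1 vs))" "e = (\<lambda>(a, b). Upair a b) p"
    unfolding cycle_edges_def by auto
  obtain a b where ab: "p = (a, b)" by (cases p)
  then show ?thesis using p set_zip_leftD[of a b vs "rotate1 vs"] set_zip_rightD[of a b vs "rotate1 vs"] by simp
qed

text \<open>A cycle spans as many edges as it has vertices.\<close>

lemma no_cycle:
  assumes E: "edge_list G E" and T: "\<And>T. T \<noteq> {} \<Longrightarrow> T \<subseteq> W \<Longrightarrow> inside E T < card T"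
  shows "\<not> (is_cycle (induced G S) vs \<and> set vs \<subseteq> W)"
proof
  assume c: "is_cycle (induced G S) vs \<and> set vs \<subseteq> W"
  then have "cycle_edges vs \<subseteq># filter_mset (\<lambda>e. set_uprod e \<subseteq> S) (edges G)"
    unfolding is_cycle_def induced_def by simp
  from subset_mset.order_trans[OF this multiset_filter_subset]
  have vs: "vs \<noteq> []" "distinct vs" "set vs \<subseteq> W" "cycle_edges vs \<subseteq># edges G"
    using c unfolding is_cycle_def by simp_all
  have "filter_mset (\<lambda>e. set_uprod e \<subseteq> set vs) (cycle_edges vs) = filter_mset (\<lambda>_. True) (cycle_edges vs)"
    by (rule filter_mset_cong) (use cycle_edges_ends in auto)
  then have "cycle_edges vs = filter_mset (\<lambda>e. set_uprod e \<subseteq> set vs) (cycle_edges vs)" by simp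
  also have "\<dots> \<subseteq># filter_mset (\<lambda>e. set_uprod e \<subseteq> set vs) (edges G)"
    by (rule multiset_filter_mono[OF vs(4)])
  finally have "size (cycle_edges vs) \<le> inside E (set vs)"
    unfolding edges_in_inside[OF E, symmetric] by (rule size_mset_mono)
  moreover have "size (cycle_edges vs) = card (set vs)"
    unfolding cycle_edges_def using vs(2) by (simp add: distinct_card)
  ultimately show False using T[of "set vs"] vs by simp
qed

text \<open>A cycle cannot leave a set that no edge of the cycle leaves.\<close>

lemma cycle_closed:
  assumes "\<And>a b. Upair a b \<in># cycle_edges vs \<Longrightarrow> a \<in> P \<Longrightarrow> b \<in> P" "x \<in> set vs" "x \<in> P"
  shows "set vs \<subseteq> P"
proof -
  have step: "vs ! (Suc i mod length vs) \<in> P" if "i < length vs" "vs ! i \<in> P" for i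
  proof -
    have "(vs ! i, rotate1 vs ! i) \<in> set (zip vs (rotate1 vs))"
      using that(1) by (auto simp: in_set_zip intro!: exI[of _ i])
    then have "Upair (vs ! i) (vs ! (Suc i mod length vs)) \<in># cycle_edges vs"
      unfolding cycle_edges_def using that(1) by (auto simp: nth_rotate1 intro!: image_eqI[where x = "(vs ! i, rotate1 vs ! i)"])
    then show ?thesis using assms(1) that(2) by blast
  qed
  obtain i0 where i0: "i0 < length vs" "vs ! i0 = x" using assms(2) by (auto simp: in_set_conv_nth)
  have all: "vs ! ((i0 + j) mod length vs) \<in> P" for j
  proof (induction j)
    case 0
    then show ?case using i0 assms(3) by simp
  next
    case (Suc j)
    have "(i0 + j) mod length vs < length vs" using i0(1) by (intro mod_less_divisor) linarith
    from step[OF this Suc] show ?case by (simp add: mod_Suc_eq)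
  qed
  show ?thesis
  proof
    fix y assume "y \<in> set vs"
    then obtain i where i: "i < length vs" "vs ! i = y" by (auto simp: in_set_conv_nth)
    have "(i0 + (length vs - i0 + i)) mod length vs = i" using i0(1) i(1) by simp
    then show "y \<in> P" using all[of "length vs - i0 + i"] i(2) by simp
  qed
qed

lemma valid_F_coloring:
  assumes G: "multigraph G" "loopless G" and E: "edge_list G E"
    and k: "k = (\<lambda>b v. if b then d1 + 1 else d2 + 1)" and val: "valid E k (verts G) c"
  shows "F_coloring d1 d2 G {v\<in>verts G. c v} {v\<in>verts G. \<not> c v}"
proof -
  have "in_F (if b then d1 else d2) (induced G {v\<in>verts G. c v = b})" for b
    unfolding in_F_def forest_def
  proof (intro conjI ballI)
    let ?W = "{v\<in>verts G. c v = b}"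
    show "multigraph (induced G ?W)" by (rule multigraph_induced[OF G(1)])
    show "\<nexists>vs. is_cycle (induced G ?W) vs"
    proof
      assume "\<exists>vs. is_cycle (induced G ?W) vs"
      then obtain vs where vs: "is_cycle (induced G ?W) vs" ..
      then have "set vs \<subseteq> ?W" unfolding is_cycle_def induced_def by simp
      moreover have "\<not> (is_cycle (induced G ?W) vs \<and> set vs \<subseteq> ?W)"
        by (rule no_cycle[OF E]) (rule validD2[OF val])
      ultimately show False using vs by simp
    qed
    fix v assume "v \<in> verts (induced G ?W)"
    then have v: "v \<in> ?W" unfolding induced_def by simp
    then have "cross E {v} ?W < k b v" using validD1[OF val, of v] by auto
    then show "degree_of (induced G ?W) v \<le> (if b then d1 else d2)"
      unfolding degree_cross[OF E G(2) v] k by (simp split: if_splits)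
  qed
  from this[of True] this[of False]
  have "in_F d1 (induced G {v\<in>verts G. c v})" "in_F d2 (induced G {v\<in>verts G. \<not> c v})" by simp_all
  then show ?thesis unfolding F_coloring_def by (intro conjI) blast+
qed

lemma params_coloring: "d2 \<ge> 2 * d1 + 2 \<Longrightarrow> \<forall>e\<in>set E. fst e \<noteq> snd e \<Longrightarrow> params (d2 + 2) (d1 + 2) E"
  unfolding params_def by auto

context params begin

lemma good_valid:
  assumes "finite V" "good k V" "bounded k V"
  shows "\<exists>c. valid E k V c"
proof (cases "V = {}")
  case True
  then show ?thesis by (simp add: valid_def)
next
  case False
  obtain xs where xs: "set xs = V" "distinct xs" using finite_distinct_list[OF assms(1)] by blast
  let ?P = "tab xs (k True)" and ?Q = "tab xs (k False)"
  have kk: "cap_of ?P ?Q b v = k b v" if "v \<in> set xs" for b v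
    unfolding cap_of_tab[OF xs(2) that] by simp
  have "good (cap_of ?P ?Q) (set xs) = good k (set xs)" by (rule good_cong) (rule kk)
  moreover have "bounded (cap_of ?P ?Q) (set xs) = bounded k (set xs)" by (rule bounded_cong) (rule kk)
  ultimately have g: "good (cap_of ?P ?Q) (set xs)" "bounded (cap_of ?P ?Q) (set xs)" using assms(2,3) xs(1) by simp_all
  have "xs \<noteq> []" "set xs \<inter> set ([] :: 'v list) = {}" using False xs by auto
  from step_solves[where rest = "[]", OF xs(2) this(1) g this(2)]
  obtain c where "valid E (cap_of ?P ?Q) (set xs) c" by (elim exE conjE) (rule that)
  then have "valid E k (set xs) c" by (rule valid_mono) (simp add: kk)
  then show ?thesis using xs(1) by blast
qed

text \<open>If \<open>S\<close> has minimum potential even among all nonempty sets, then no potential outside becomes negative when all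
  colours that are seen from \<open>S\<close> are banned.\<close>

lemma good_ban:
  assumes fin: "finite V" and S: "S \<subseteq> V" and bd: "bounded k V"
    and min: "\<And>T. T \<noteq> {} \<Longrightarrow> T \<subseteq> V \<Longrightarrow> pot k S \<le> pot k T"
  shows "good (ban E c S k) (V - S)"
  unfolding good_def
proof (intro allI impI)
  fix T assume T: "T \<noteq> {} \<and> T \<subseteq> V - S"
  have f: "finite T" "finite S" using T S fin finite_subset by blast+
  have "pot (ban E c S k) T = pot k (S \<union> T) - pot k S + (\<Sum>y\<in>T. gain c S k (ban E c S k) y)"
    by (rule pot_after[OF f(2,1)]) (use T in blast)
  moreover have "0 \<le> (\<Sum>y\<in>T. gain c S k (ban E c S k) y)"
    by (rule sum_nonneg, rule gain_ban(3)) (use T bd in \<open>auto simp: bounded_def\<close>)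
  moreover have "pot k S \<le> pot k (S \<union> T)" by (rule min) (use T S in auto)
  ultimately show "- int B < pot (ban E c S k) T" using AB' by linarith
qed

lemma pot_uniform:
  assumes "k = (\<lambda>b v. if b then B - 1 else A - 1)"
  shows "pot k S = (2 * D - int A) * int (card S) - D * int (inside E S)"
proof -
  have "wt k v = 2 * D - int A" for v
    using AB B2 unfolding wt_def assms D_def by (simp add: of_nat_diff algebra_simps)
  then show ?thesis unfolding pot_def by simp
qed

end

section \<open>Sparsity, critical multigraphs and the algorithm on encoded inputs\<close>

lemma coefficient:
  fixes d1 d2 :: nat
  defines "a \<equiv> 2 - (real d2 + 2) / ((real d1 + 2) * (real d2 + 1))"
  shows "((real d1 + 2) * (real d2 + 1)) * a = 2 * ((real d1 + 2) * (real d2 + 1)) - (real d2 + 2)"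
    and "((real d1 + 2) * (real d2 + 1)) * (1 / (real d2 + 1)) = real d1 + 2"
proof -
  have "(real d1 + 2) * (real d2 + 1) \<noteq> 0" by simp
  then show "((real d1 + 2) * (real d2 + 1)) * a = 2 * ((real d1 + 2) * (real d2 + 1)) - (real d2 + 2)"
    unfolding a_def by (simp add: right_diff_distrib)
  show "((real d1 + 2) * (real d2 + 1)) * (1 / (real d2 + 1)) = real d1 + 2" by simp
qed

text \<open>The density condition on a set with \<open>n\<close> vertices and \<open>m\<close> edges, multiplied by \<open>D\<close>.\<close>

lemma pot_iff:
  fixes d1 d2 m n :: nat
  assumes d: "d2 \<ge> 2 * d1 + 2"
  shows "real m < (2 - (real d2 + 2) / ((real d1 + 2) * (real d2 + 1))) * real n + 1 / (real d2 + 1) \<longleftrightarrow>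
    - int (d1 + 2) < (2 * params.D (d2 + 2) (d1 + 2) - int (d2 + 2)) * int n - params.D (d2 + 2) (d1 + 2) * int m"
proof -
  let ?a = "2 - (real d2 + 2) / ((real d1 + 2) * (real d2 + 1))"
  define D where "D = (real d1 + 2) * (real d2 + 1)"
  have D0: "0 < D" unfolding D_def by simp
  have DD: "real_of_int (params.D (d2 + 2) (d1 + 2)) = D"
    using params.D_def[OF params_coloring[OF d, of "[] :: (nat \<times> nat) list"]] unfolding D_def by (simp add: algebra_simps)
  have c1: "D * ?a = 2 * D - (real d2 + 2)" and c2: "D * (1 / (real d2 + 1)) = real d1 + 2"
    unfolding D_def by (rule coefficient)+
  have "real m < ?a * real n + 1 / (real d2 + 1) \<longleftrightarrow> D * real m < D * (?a * real n + 1 / (real d2 + 1))"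
    using D0 by simp
  also have "D * (?a * real n + 1 / (real d2 + 1)) = (D * ?a) * real n + D * (1 / (real d2 + 1))"
    by (simp only: distrib_left mult.assoc)
  also have "\<dots> = (2 * D - (real d2 + 2)) * real n + (real d1 + 2)" unfolding c1 c2 ..
  also have "D * real m < (2 * D - (real d2 + 2)) * real n + (real d1 + 2) \<longleftrightarrow>
    real_of_int (- int (d1 + 2)) < real_of_int ((2 * params.D (d2 + 2) (d1 + 2) - int (d2 + 2)) * int n - params.D (d2 + 2) (d1 + 2) * int m)"
    by (simp add: DD[simplified] algebra_simps)
  finally show ?thesis by (simp only: of_int_less_iff)
qed

text \<open>If the caps are not good, a set \<open>S\<close> of minimum potential is a proper subset of the vertices, because its potential is at most \<open>- B\<close> and that of the
  whole vertex set is not. By criticality the subgraph on \<open>S\<close> has a colouring. It can be combined with a colouring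
  of the rest for which all colours seen from \<open>S\<close> are banned: no monochromatic edge joins the two parts, and hence every monochromatic cycle
  lies in one of them.\<close>

lemma critical_bound:
  fixes G :: "'v mgraph"
  assumes d: "d2 \<ge> 2 * d1 + 2" and G: "multigraph G" "loopless G" and crit: "F_critical d1 d2 G"
  shows "(2 - (real d2 + 2) / ((real d1 + 2) * (real d2 + 1))) * real (num_verts G) + 1 / (real d2 + 1) \<le> real (num_edges G)"
proof (rule ccontr)
  assume "\<not> ?thesis"
  then have less: "real (num_edges G) < (2 - (real d2 + 2) / ((real d1 + 2) * (real d2 + 1))) * real (num_verts G) + 1 / (real d2 + 1)"
    by simp
  obtain E where E: "edge_list G E" using edge_list_exists by blast
  have lf: "\<forall>e\<in>set E. fst e \<noteq> snd e" by (rule loopless_edge_list[OF E G(2)])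
  interpret params "d2 + 2" "d1 + 2" E by (rule params_coloring[OF d lf])
  define k :: "bool \<Rightarrow> 'v \<Rightarrow> nat" where "k = (\<lambda>b v. if b then d1 + 1 else d2 + 1)"
  have fin: "finite (verts G)" using G(1) unfolding multigraph_def by simp
  have pu: "pot k S = (2 * D - int (d2 + 2)) * int (card S) - D * int (inside E S)" for S
    by (rule pot_uniform) (simp add: k_def fun_eq_iff)
  have bd: "bounded k V" for V unfolding bounded_def k_def by simp
  have uncol: "\<not> F_colorable d1 d2 G" using crit unfolding F_critical_def by simp
  have all: "size (edges G) = inside E (verts G)"
  proof -
    have "filter_mset (\<lambda>e. set_uprod e \<subseteq> verts G) (edges G) = filter_mset (\<lambda>_. True) (edges G)"
      by (rule filter_mset_cong) (use G(1) in \<open>auto simp: multigraph_def\<close>)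
    then show ?thesis using edges_in_inside[OF E, of "verts G"] by simp
  qed
  have potV: "- int (d1 + 2) < pot k (verts G)"
    using less[unfolded pot_iff[OF d]] unfolding pu num_verts_def num_edges_def all .
  show False
  proof (cases "good k (verts G)")
    case True
    from good_valid[OF fin True bd] obtain c where "valid E k (verts G) c" ..
    from valid_F_coloring[OF G E k_def this] uncol show False unfolding F_colorable_def by blast
  next
    case False
    define \<S> where "\<S> = {T. T \<noteq> {} \<and> T \<subseteq> verts G}"
    have finS: "finite \<S>" unfolding \<S>_def using fin by simp
    from False have "\<exists>T. T \<noteq> {} \<and> T \<subseteq> verts G \<and> \<not> - int (d1 + 2) < pot k T"
      unfolding good_def by (simp only: not_all not_imp conj_assoc)
    then obtain T0 where "T0 \<noteq> {}" "T0 \<subseteq> verts G" "\<not> - int (d1 + 2) < pot k T0" by (elim exE conjE)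
    then have T0: "T0 \<in> \<S>" "pot k T0 \<le> - int (d1 + 2)"
      unfolding \<S>_def mem_Collect_eq by (simp_all only: not_less simp_thms)
    have "\<exists>S\<in>\<S>. \<forall>T\<in>\<S>. pot k S \<le> pot k T"
    proof -
      have "Min (pot k ` \<S>) \<in> pot k ` \<S>" by (rule Min_in) (use finS T0 in auto)
      then obtain S where S: "S \<in> \<S>" "pot k S = Min (pot k ` \<S>)" by auto
      have "pot k S \<le> pot k T" if "T \<in> \<S>" for T unfolding S(2) by (rule Min_le) (use finS that in auto)
      then show ?thesis using S(1) by blast
    qed
    then obtain S where S: "S \<in> \<S>" "\<And>T. T \<in> \<S> \<Longrightarrow> pot k S \<le> pot k T" by blast
    have S0: "S \<noteq> {}" "S \<subseteq> verts G" using S(1) unfolding \<S>_def by auto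
    have "pot k S \<le> - int (d1 + 2)" using S(2)[OF T0(1)] T0(2) by linarith
    then have SV: "S \<noteq> verts G" using potV by auto
    let ?H = "induced G S"
    have Hv: "verts ?H = S" using S0 unfolding induced_def by auto
    have "is_subgraph ?H G"
      using multigraph_induced[OF G(1), of S] S0 unfolding is_subgraph_def Hv by (simp add: induced_def)
    moreover have "?H \<noteq> G"
    proof
      assume "?H = G"
      then have "verts ?H = verts G" by (rule arg_cong)
      then show False using SV unfolding Hv by (rule notE[rotated])
    qed
    ultimately have "F_colorable d1 d2 ?H" using crit unfolding F_critical_def by blast
    then obtain V1 V2 where H: "V1 \<union> V2 = S" "V1 \<inter> V2 = {}"
      "in_F d1 (induced ?H V1)" "in_F d2 (induced ?H V2)"
      unfolding F_colorable_def F_coloring_def Hv by blast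
    define X where "X = verts G - S"
    define c1 where "c1 v = (v \<in> V1)" for v
    let ?k' = "ban E c1 S k"
    have "good ?k' X" unfolding X_def
      by (rule good_ban[OF fin S0(2) bd]) (use S(2) in \<open>auto simp: \<S>_def\<close>)
    moreover have "bounded ?k' X" using bd[of X] unfolding bounded_def ban_def by auto
    moreover have finX: "finite X" using fin unfolding X_def by simp
    ultimately obtain c2 where c2: "valid E ?k' X c2" using good_valid by blast
    define c where "c v = (if v \<in> S then v \<in> V1 else c2 v)" for v
    have F: "in_F (if b then d1 else d2) (induced G {v\<in>verts G. c v = b})" for b
    proof -
      define W where "W = {v\<in>verts G. c v = b}"
      define SB where "SB = {v\<in>S. c1 v = b}"
      define XB where "XB = {v\<in>X. c2 v = b}"
      have W: "W = SB \<union> XB" unfolding W_def SB_def XB_def X_def c_def c1_def using S0(2) by auto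
      have dj: "SB \<inter> XB = {}" unfolding SB_def XB_def X_def by auto
      have SBV: "SB = (if b then V1 else V2)" unfolding SB_def c1_def using H(1,2) by auto
      have SBS: "SB \<subseteq> S" unfolding SB_def by blast
      have inS: "in_F (if b then d1 else d2) (induced G SB)"
        using H(3,4) induced_induced[of V1 S G] induced_induced[of V2 S G] H(1) unfolding SBV by (cases b) auto
      have sep: "cross E {y} SB = 0" if "y \<in> XB" for y
      proof -
        have "y \<in> X" "c2 y = b" using that unfolding XB_def by auto
        then have "0 < ?k' b y" using validD1[OF c2, of y] by auto
        then have "seen E c1 S b y = 0" unfolding ban_def by (auto split: if_splits)
        then show ?thesis unfolding seen_def SB_def .
      qed
      have finXB: "finite XB" using finX unfolding XB_def by simp
      have "cross E SB XB = 0" using cross_sum[OF finXB dj, of E] sep by simp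
      then have sep2: "cross E {u} XB = 0" if "u \<in> SB" for u
        using cross_mono[of "{u}" SB XB XB E] that by simp
      have noedge: "Upair u y \<notin># edges G" if "u \<in> SB" "y \<in> XB" for u y
      proof
        assume "Upair u y \<in># edges G"
        then obtain p where p: "p \<in> set E" "(\<lambda>(u, v). Upair u v) p = Upair u y"
          using E unfolding edge_list_def by auto
        from p(2) have "fst p = u \<and> snd p = y \<or> fst p = y \<and> snd p = u" by (simp add: case_prod_beta)
        then have "filter (\<lambda>e. fst e \<in> {y} \<and> snd e \<in> SB \<or> fst e \<in> SB \<and> snd e \<in> {y}) E \<noteq> []"
          using p(1) that unfolding filter_empty_conv by auto
        then show False using sep[OF that(2)] unfolding cross_def by simp
      qed
      have degW: "cross E {v} W = cross E {v} SB + cross E {v} XB" for v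
        unfolding W by (rule cross_loopless_Un[OF lf dj])
      show ?thesis unfolding in_F_def forest_def W_def[symmetric]
      proof (intro conjI ballI)
        show "multigraph (induced G W)" by (rule multigraph_induced[OF G(1)])
        show "\<nexists>vs. is_cycle (induced G W) vs"
        proof
          assume "\<exists>vs. is_cycle (induced G W) vs"
          then obtain vs where vs: "is_cycle (induced G W) vs" ..
          then have v: "vs \<noteq> []" "distinct vs" "set vs \<subseteq> W" and sub: "cycle_edges vs \<subseteq># {#e \<in># edges G. set_uprod e \<subseteq> W#}"
            unfolding is_cycle_def induced_def by auto
          have eG: "Upair a b \<in># edges G" if "Upair a b \<in># cycle_edges vs" for a b
            using mset_subset_eqD[OF sub that] by simp
          have mem: "a \<in> set vs \<and> b \<in> set vs" if "Upair a b \<in># cycle_edges vs" for a b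
            using cycle_edges_ends[OF that] by simp
          have "\<not> (is_cycle (induced G W) vs \<and> set vs \<subseteq> XB)"
          proof (rule no_cycle[OF E])
            show "inside E T < card T" if "T \<noteq> {}" "T \<subseteq> XB" for T
              using validD2[OF c2 that(1), of b] that(2) unfolding XB_def by simp
          qed
          then have "\<not> set vs \<subseteq> XB" using vs by simp
          then obtain x where x: "x \<in> set vs" "x \<in> SB" using v(3) W by blast
          have "set vs \<subseteq> SB"
          proof (rule cycle_closed[OF _ x])
            fix a b assume ab: "Upair a b \<in># cycle_edges vs" "a \<in> SB"
            have "b \<in> SB \<or> b \<in> XB" using mem[OF ab(1)] v(3) W by blast
            then show "b \<in> SB" using noedge[OF ab(2)] eG[OF ab(1)] by blast
          qed
          have "cycle_edges vs = filter_mset (\<lambda>e. set_uprod e \<subseteq> SB) (cycle_edges vs)"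
          proof -
            have "filter_mset (\<lambda>e. set_uprod e \<subseteq> SB) (cycle_edges vs) = filter_mset (\<lambda>_. True) (cycle_edges vs)"
              by (rule filter_mset_cong) (use cycle_edges_ends \<open>set vs \<subseteq> SB\<close> in blast)+
            then show ?thesis by simp
          qed
          also have "\<dots> \<subseteq># filter_mset (\<lambda>e. set_uprod e \<subseteq> SB) (edges G)"
            by (rule multiset_filter_mono) (rule subset_mset.order_trans[OF sub multiset_filter_subset])
          finally have "is_cycle (induced G SB) vs"
            using v \<open>set vs \<subseteq> SB\<close> SBS S0(2) unfolding is_cycle_def induced_def by auto
          then show False using inS unfolding in_F_def forest_def by blast
        qed
        fix v assume "v \<in> verts (induced G W)"
        then have v: "v \<in> W" unfolding induced_def by simp
        show "degree_of (induced G W) v \<le> (if b then d1 else d2)"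
        proof (cases "v \<in> SB")
          case True
          have "v \<in> verts (induced G SB)" using True SBS S0(2) unfolding induced_def by auto
          then have "degree_of (induced G SB) v \<le> (if b then d1 else d2)" using inS unfolding in_F_def by blast
          then show ?thesis unfolding degree_cross[OF E G(2) v] degree_cross[OF E G(2) True] degW
            using sep2[OF True] by simp
        next
          case False
          then have vX: "v \<in> XB" using v W by blast
          then have "cross E {v} XB < ?k' b v" using validD1[OF c2, of v] unfolding XB_def by auto
          also have "\<dots> \<le> (if b then d1 + 1 else d2 + 1)" unfolding ban_def k_def by simp
          finally show ?thesis unfolding degree_cross[OF E G(2) v] degW using sep[OF vX] by (simp split: if_splits)
        qed
      qed
    qed
    from F[of True] F[of False]
    have "in_F d1 (induced G {v\<in>verts G. c v})" "in_F d2 (induced G {v\<in>verts G. \<not> c v})" by simp_all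
    then have "F_coloring d1 d2 G {v\<in>verts G. c v} {v\<in>verts G. \<not> c v}"
      unfolding F_coloring_def by (intro conjI) blast+
    then show False using uncol unfolding F_colorable_def by blast
  qed
qed

definition colour_bits :: "nat \<Rightarrow> nat \<Rightarrow> instance_graph \<Rightarrow> bool list" where
  "colour_bits A B I = map (\<lambda>i. i \<in> set (solve A B (snd I) [0..<fst I])) [0..<fst I]"

lemma pt_colour_bits:
  assumes "B \<le> A"
  shows "poly_time (colour_bits A B)"
  unfolding colour_bits_def[abs_def]
  by (intro pt_rules pt_comp[OF _ pt_solve[OF assms]])

lemma colour_bits_correct:
  assumes d: "d2 \<ge> 2 * d1 + 2" and G: "multigraph (graph_of I)" "loopless (graph_of I)"
    and sp: "strictly_sparse (2 - (real d2 + 2) / ((real d1 + 2) * (real d2 + 1))) (- 1 / (real d2 + 1)) (graph_of I)"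
  shows "coloring_output d1 d2 I (colour_bits (d2 + 2) (d1 + 2) I)"
proof -
  let ?G = "graph_of I" and ?E = "snd I"
  have E: "edge_list ?G ?E" unfolding edge_list_def graph_of_def by simp
  have lf: "\<forall>e\<in>set ?E. fst e \<noteq> snd e" by (rule loopless_edge_list[OF E G(2)])
  interpret params "d2 + 2" "d1 + 2" ?E by (rule params_coloring[OF d lf])
  define k :: "bool \<Rightarrow> nat \<Rightarrow> nat" where "k = (\<lambda>b v. if b then d1 + 1 else d2 + 1)"
  have V: "set [0..<fst I] = verts ?G" unfolding graph_of_def by auto
  have pu: "pot k S = (2 * D - int (d2 + 2)) * int (card S) - D * int (inside ?E S)" for S
    by (rule pot_uniform) (simp add: k_def fun_eq_iff)
  have gk: "good k (verts ?G)" unfolding good_def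
  proof (intro allI impI)
    fix T assume T: "T \<noteq> {} \<and> T \<subseteq> verts ?G"
    have Tv: "verts (induced ?G T) = T" using T unfolding induced_def by auto
    have "is_subgraph (induced ?G T) ?G"
      using multigraph_induced[OF G(1), of T] T unfolding is_subgraph_def Tv by (simp add: induced_def)
    then have "real (num_edges (induced ?G T)) < (2 - (real d2 + 2) / ((real d1 + 2) * (real d2 + 1))) * real (num_verts (induced ?G T)) - (- 1 / (real d2 + 1))"
      using sp unfolding strictly_sparse_def by blast
    moreover have "num_edges (induced ?G T) = inside ?E T"
      unfolding num_edges_def using edges_in_inside[OF E, of T] by (simp add: induced_def)
    moreover have "num_verts (induced ?G T) = card T" unfolding num_verts_def Tv ..
    ultimately have "real (inside ?E T) < (2 - (real d2 + 2) / ((real d1 + 2) * (real d2 + 1))) * real (card T) + 1 / (real d2 + 1)"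
      by simp
    then show "- int (d1 + 2) < pot k T" unfolding pot_iff[OF d] pu .
  qed
  have keq: "(\<lambda>b (v::nat). if b then d1 + 2 - 1 else d2 + 2 - 1) = k" unfolding k_def by (simp add: fun_eq_iff)
  have g: "good (\<lambda>b (v::nat). if b then d1 + 2 - 1 else d2 + 2 - 1) (set [0..<fst I])"
    by (simp only: keq V gk)
  let ?C = "solve (d2 + 2) (d1 + 2) ?E [0..<fst I]"
  have "valid ?E (\<lambda>b v. if b then d1 + 2 - 1 else d2 + 2 - 1) (set [0..<fst I]) (\<lambda>v. v \<in> set ?C)"
    by (rule conjunct2[OF solve_valid[OF distinct_upt g]])
  then have val: "valid ?E k (verts ?G) (\<lambda>v. v \<in> set ?C)" by (simp only: keq V)
  have "F_coloring d1 d2 ?G {v\<in>verts ?G. v \<in> set ?C} {v\<in>verts ?G. \<not> v \<in> set ?C}"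
    by (rule valid_F_coloring[OF G E k_def val])
  moreover have "{v\<in>verts ?G. v \<in> set ?C} = {i. i < fst I \<and> colour_bits (d2 + 2) (d1 + 2) I ! i}"
    unfolding colour_bits_def graph_of_def by auto
  moreover have "{v\<in>verts ?G. \<not> v \<in> set ?C} = {i. i < fst I \<and> \<not> colour_bits (d2 + 2) (d1 + 2) I ! i}"
    unfolding colour_bits_def graph_of_def by auto
  moreover have "length (colour_bits (d2 + 2) (d1 + 2) I) = fst I" unfolding colour_bits_def by simp
  ultimately show ?thesis unfolding coloring_output_def by simp
qed

lemma enc_graph_enc: "enc_graph I = enc I"
proof -
  have "(\<lambda>(u, v). Pair (enc_nat u) (enc_nat v)) = (enc :: nat \<times> nat \<Rightarrow> data)"
    by (auto simp: enc_prod_def enc_nat_def)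
  then show ?thesis unfolding enc_graph_def enc_prod_def[of I] enc_list_def enc_nat_def by simp
qed

lemma enc_bits: "enc_list enc_bool bs = enc bs"
proof -
  have "enc_bool = enc" by (auto simp: enc_bool_def)
  then show ?thesis unfolding enc_list_def by simp
qed

text \<open>Vertices are encoded in unary, so that an instance of size \<open>n\<close> has an encoding of size quadratic in \<open>n\<close>.\<close>

lemma ssize_graph:
  assumes "multigraph (graph_of I)"
  shows "ssize I \<le> poly [:3, 6, 4:] (graph_size I)"
proof -
  let ?n = "fst I" and ?m = "length (snd I)"
  have gs: "graph_size I = ?n + ?m" unfolding graph_size_def num_verts_def num_edges_def graph_of_def by simp
  have e: "fst e < ?n \<and> snd e < ?n" if "e \<in> set (snd I)" for e
  proof -
    have "Upair (fst e) (snd e) \<in># edges (graph_of I)" using that unfolding graph_of_def by force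
    then have "set_uprod (Upair (fst e) (snd e)) \<subseteq> verts (graph_of I)" using assms unfolding multigraph_def by blast
    then show ?thesis unfolding graph_of_def by simp
  qed
  have "ssize (snd I) \<le> 1 + ?m * (1 + (4 * ?n + 3))"
    by (rule ssize_list_le) (use e ssize_prod in \<open>fastforce\<close>)
  then have "ssize I \<le> 1 + (2 * ?n + 1) + (1 + ?m * (1 + (4 * ?n + 3)))" using ssize_prod[of I] by simp
  also have "\<dots> \<le> 3 + 2 * graph_size I + graph_size I * (4 * graph_size I + 4)"
  proof -
    have "?m * (1 + (4 * ?n + 3)) \<le> graph_size I * (4 * graph_size I + 4)" unfolding gs by (intro mult_le_mono) simp_all
    moreover have "?n \<le> graph_size I" unfolding gs by simp
    ultimately show ?thesis by linarith
  qed
  also have "\<dots> = poly [:3, 6, 4:] (graph_size I)" by (simp add: algebra_simps)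
  finally show ?thesis .
qed

theorem theorem1p2:
  fixes d1 d2 :: nat
  assumes "d2 \<ge> 2 * d1 + 2"
  shows "(\<forall>G :: 'v mgraph. multigraph G \<and> loopless G \<and> F_critical d1 d2 G \<longrightarrow>
            real (num_edges G) \<ge>
              (2 - (real d2 + 2) / ((real d1 + 2) * (real d2 + 1))) * real (num_verts G)
              + 1 / (real d2 + 1))
       \<and> poly_time_F_coloring d1 d2
           (\<lambda>G. multigraph G \<and> loopless G \<and>
                strictly_sparse (2 - (real d2 + 2) / ((real d1 + 2) * (real d2 + 1)))
                  (- 1 / (real d2 + 1)) G)"
proof (intro conjI allI impI)
  fix G :: "'v mgraph"
  assume "multigraph G \<and> loopless G \<and> F_critical d1 d2 G"
  then show "real (num_edges G) \<ge> (2 - (real d2 + 2) / ((real d1 + 2) * (real d2 + 1))) * real (num_verts G) + 1 / (real d2 + 1)"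
    using critical_bound[OF assms] by blast
next
  have "d1 + 2 \<le> d2 + 2" using assms by simp
  from pt_colour_bits[OF this]
  obtain c N T where c: "poly_bounded T" "\<And>I. ssize (colour_bits (d2 + 2) (d1 + 2) I) \<le> T I"
    "\<And>I s. s 0 = enc I \<Longrightarrow> \<exists>t s'. exec c s t s' \<and> t \<le> T I \<and> s' 0 = enc (colour_bits (d2 + 2) (d1 + 2) I) \<and> (\<forall>i>N. s' i = s i)"
    by (rule ptE) (rule that)
  obtain p where p: "\<And>I. T I \<le> poly p (ssize I)" using c(1) unfolding poly_bounded_def by blast
  show "poly_time_F_coloring d1 d2
           (\<lambda>G. multigraph G \<and> loopless G \<and>
                strictly_sparse (2 - (real d2 + 2) / ((real d1 + 2) * (real d2 + 1)))
                  (- 1 / (real d2 + 1)) G)"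
    unfolding poly_time_F_coloring_def poly_time_search_def
  proof (rule exI[of _ c], rule exI[of _ "pcompose p [:3, 6, 4:]"], intro allI impI)
    fix I :: instance_graph
    assume I: "multigraph (graph_of I) \<and> loopless (graph_of I) \<and>
                strictly_sparse (2 - (real d2 + 2) / ((real d1 + 2) * (real d2 + 1))) (- 1 / (real d2 + 1)) (graph_of I)"
    let ?y = "colour_bits (d2 + 2) (d1 + 2) I"
    have "coloring_output d1 d2 I ?y" using colour_bits_correct[OF assms] I by blast
    moreover have "computes_within c (enc_graph I) (poly (pcompose p [:3, 6, 4:]) (graph_size I)) (enc_list enc_bool ?y)"
    proof -
      let ?s = "(\<lambda>_. Atom)(0 := enc I)"
      have "?s 0 = enc I" by simp
      from c(3)[of ?s I, OF this] obtain t s' where e: "exec c ?s t s'" "t \<le> T I" "s' 0 = enc ?y" by blast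
      have "T I \<le> poly p (poly [:3, 6, 4:] (graph_size I))"
        using p[of I] poly_nat_mono[OF ssize_graph, of I p] I by (meson order_trans)
      then have "t \<le> poly (pcompose p [:3, 6, 4:]) (graph_size I)" using e(2) unfolding poly_pcompose by linarith
      then show ?thesis unfolding computes_within_def enc_graph_enc enc_bits using e(1,3) by blast
    qed
    ultimately show "\<exists>y. coloring_output d1 d2 I y \<and>
      computes_within c (enc_graph I) (poly (pcompose p [:3, 6, 4:]) (graph_size I)) (enc_list enc_bool y)" by blast
  qed
qed

end
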